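(* Let $X\in\mathrm{Dom}(\nabla)$ be such that $\mathbb E[X]=0$. Then $$d_W(X,\mathcal N)\le\mathbb E\left[\left|1-\frac12\langle\nabla_\cdot X,-\nabla_\cdot L^{-1}X\rangle\right|\right]+\frac12\,\mathbb E\left[\int_0^\infty|\nabla_tL^{-1}X|\,|\nabla_tX|^2\,dt\right]+\frac14\,\mathbb E\left[\int_0^\infty|\nabla_tL^{-1}X|\int_{2\lfloor t/2\rfloor}^{2\lfloor t/2\rfloor+2}|\nabla_sX|^2\,ds\,dt\right].$$
   Context: $\mathbb N=\{0,1,2,\ldots\}$, $\mathbb R_+=[0,\infty)$. $(U_k)_{k\in\mathbb N}$ is an i.i.d. sequence uniformly distributed on $[-1,1]$, and $L^2(\Omega)$ denotes the square-integrable random variables measurable with respect to $\sigma(U_k:k\in\mathbb N)$, regarded as functionals of $(U_k)_{k\in\mathbb N}$. Multiple stochastic integrals. $\Delta_n:=\bigcup [2k_1,2k_1+2]\times\cdots\times[2k_n,2k_n+2]$, the union being over pairwise distinct $k_1,\ldots,k_n\in\mathbb N$; $\hat L^2(\mathbb R_+^n)$ is the space of symmetric square-integrable functions on $\mathbb R_+^n$ vanishing outside $\Delta_n$. For $f_n\in\hat L^2(\mathbb R_+^n)$ (integrable, then extended by continuity using $\mathbb E[I_n(f_n)^2]\le n!\|f_n\|^2_{L^2(\mathbb R_+^n,(dx/2)^{\otimes n})}$), $$I_n(f_n):=\sum_{r=0}^n\frac{(-1)^{n-r}}{2^{n-r}}\binom nr\sum_{k_1,\ldots,k_r\ge0\text{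 distinct}}\int_{\mathbb R_+^{n-r}}f_n(2k_1+1+U_{k_1},\ldots,2k_r+1+U_{k_r},y_1,\ldots,y_{n-r})\,dy_1\cdots dy_{n-r}.$$ Every $X\in L^2(\Omega)$ has a decomposition $X=\mathbb E[X]+\sum_{n\ge1}I_n(f_n)$ with $f_n\in\hat L^2(\mathbb R_+^n)$, integrals of different orders being orthogonal. Operators. For $t\in\mathbb R_+$, $X\circ\Psi_t$ is the random variable obtained from $X$ by replacing $U_{\lfloor t/2\rfloor}$ by $t-2\lfloor t/2\rfloor-1$ and leaving all other $U_j$ unchanged, and $$\nabla_tX:=X\circ\Psi_t-\frac12\int_{2\lfloor t/2\rfloor}^{2\lfloor t/2\rfloor+2}X\circ\Psi_s\,ds,\qquad \mathrm{Dom}(\nabla):=\{X\in L^2(\Omega):\mathbb E[\|\nabla X\|^2_{L^2(\mathbb R_+)}]<\infty\}.$$ $L^{-1}$ is the linear operator on centered elements of $L^2(\Omega)$ given by $L^{-1}I_n(f_n)=-\frac1nI_n(f_n)$, $n\ge1$. $\langle\cdot,\cdot\rangle$ is the inner product of $L^2(\mathbb R_+)=L^2(\mathbb R_+,dt)$. $\mathcal N$ is a standard normal random variable, and $d_W(X,Y)=\sup_h|\mathbb E[h(X)]-\mathbb E[h(Y)]|$ over Lipschitz $h:\mathbb R\to\mathbb R$ with constant at most $1$. The right-hand side may be $+\infty$. *)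

theory Defs
  imports "HOL-Probability.Probability"
begin

text \<open>
  Square-integrable functionals of an i.i.d. sequence that is uniform on $[-1,1]$ are represented by
  measurable functions \<open>F\<close> on the sequence space, the random variable being $F(U_0,U_1,\ldots)$.
  As usual, functionals are identified when they agree almost everywhere; operators on $L^2$ classes
  that are only determined up to null sets return an arbitrary representative.
\<close>

definition path_law :: "(nat \<Rightarrow> real) measure" where
  "path_law = (\<Pi>\<^sub>M k\<in>UNIV. uniform_measure lborel {-1..1})"

definition L2_Omega :: "((nat \<Rightarrow> real) \<Rightarrow> real) set" where
  "L2_Omega = {F \<in> borel_measurable path_law. integrable path_law (\<lambda>u. (F u)\<^sup>2)}"

definition L2_tendsto ::
    "'a measure \<Rightarrow> (nat \<Rightarrow> 'a \<Rightarrow> real) \<Rightarrow> ('a \<Rightarrow> real) \<Rightarrow> bool" where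
  "L2_tendsto M G F \<longleftrightarrow> (\<lambda>j. \<integral>\<^sup>+x. ennreal ((G j x - F x)\<^sup>2) \<partial>M) \<longlonglongrightarrow> 0"

definition halfline :: "real measure" where
  "halfline = restrict_space lborel {0..}"

text \<open>A point $(x_1,\ldots,x_n)$ of $\mathbb{R}_+^n$ is an extensional function on \<open>{..<n}\<close>.\<close>

definition Rplus_pow :: "nat \<Rightarrow> (nat \<Rightarrow> real) measure" where
  "Rplus_pow n = (\<Pi>\<^sub>M i\<in>{..<n}. halfline)"

definition Delta :: "nat \<Rightarrow> (nat \<Rightarrow> real) set" where
  "Delta n = (\<Union>k\<in>{k \<in> {..<n} \<rightarrow>\<^sub>E (UNIV :: nat set). inj_on k {..<n}}.
      (\<Pi>\<^sub>E i\<in>{..<n}. {2 * real (k i) .. 2 * real (k i) + 2}))"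

definition L2_hat :: "nat \<Rightarrow> ((nat \<Rightarrow> real) \<Rightarrow> real) set" where
  "L2_hat n = {f \<in> borel_measurable (Rplus_pow n).
      integrable (Rplus_pow n) (\<lambda>x. (f x)\<^sup>2) \<and>
      (\<forall>\<pi>. \<pi> permutes {..<n} \<longrightarrow> (\<forall>x\<in>space (Rplus_pow n). f (x \<circ> \<pi>) = f x)) \<and>
      (\<forall>x\<in>space (Rplus_pow n) - Delta n. f x = 0)}"

text \<open>
  The explicit formula for integrable kernels. The integration variables
  $y_1,\ldots,y_{n-r}$ are indexed by \<open>{r..<n}\<close>, their positions in the argument of \<open>f\<close>.
\<close>

definition mult_int_L1 :: "nat \<Rightarrow> ((nat \<Rightarrow> real) \<Rightarrow> real) \<Rightarrow> (nat \<Rightarrow> real) \<Rightarrow> real" where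
  "mult_int_L1 n f u =
     (\<Sum>r\<le>n. (-1) ^ (n - r) / 2 ^ (n - r) * real (n choose r) *
       (\<Sum>\<^sub>\<infinity>k\<in>{k \<in> {..<r} \<rightarrow>\<^sub>E (UNIV :: nat set). inj_on k {..<r}}.
          \<integral>y. f (\<lambda>i\<in>{..<n}. if i < r then 2 * real (k i) + 1 + u (k i) else y i)
            \<partial>(\<Pi>\<^sub>M i\<in>{r..<n}. halfline)))"

text \<open>
  Extension by continuity: for a non-integrable kernel, the (almost surely unique) $L^2$ limit of the
  integrals of integrable kernels converging to it in $L^2(\mathbb{R}_+^n)$.
\<close>

definition mult_int :: "nat \<Rightarrow> ((nat \<Rightarrow> real) \<Rightarrow> real) \<Rightarrow> (nat \<Rightarrow> real) \<Rightarrow> real" where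
  "mult_int n f =
     (if integrable (Rplus_pow n) f then mult_int_L1 n f
      else (SOME Z. Z \<in> L2_Omega \<and>
        (\<exists>g. (\<forall>j. g j \<in> L2_hat n \<and> integrable (Rplus_pow n) (g j)) \<and>
             L2_tendsto (Rplus_pow n) g f \<and>
             L2_tendsto path_law (\<lambda>j. mult_int_L1 n (g j)) Z)))"

definition Psi :: "real \<Rightarrow> (nat \<Rightarrow> real) \<Rightarrow> nat \<Rightarrow> real" where
  "Psi t u = u(nat \<lfloor>t / 2\<rfloor> := t - 2 * of_int \<lfloor>t / 2\<rfloor> - 1)"

definition cell :: "real \<Rightarrow> real set" where
  "cell t = {2 * of_int \<lfloor>t / 2\<rfloor> .. 2 * of_int \<lfloor>t / 2\<rfloor> + 2}"

definition nabla :: "((nat \<Rightarrow> real) \<Rightarrow> real) \<Rightarrow> real \<Rightarrow> (nat \<Rightarrow> real) \<Rightarrow> real" where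
  "nabla F t u = F (Psi t u) - 1 / 2 * (LBINT s:cell t. F (Psi s u))"

definition Dom_nabla :: "((nat \<Rightarrow> real) \<Rightarrow> real) set" where
  "Dom_nabla = {F \<in> L2_Omega.
      (\<integral>\<^sup>+u. (\<integral>\<^sup>+t\<in>{0..}. ennreal ((nabla F t u)\<^sup>2) \<partial>lborel) \<partial>path_law) < \<infinity>}"

text \<open>
  $L^{-1}$ on a centered functional: with the chaos decomposition $F=\sum_{n\ge1}I_n(f_n)$,
  $L^{-1}F=-\sum_{n\ge1}\frac1n I_n(f_n)$, both series converging in $L^2$.
\<close>

definition L_inv :: "((nat \<Rightarrow> real) \<Rightarrow> real) \<Rightarrow> (nat \<Rightarrow> real) \<Rightarrow> real" where
  "L_inv F = (SOME Y. Y \<in> L2_Omega \<and>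
     (\<exists>f. (\<forall>n\<ge>1. f n \<in> L2_hat n) \<and>
          L2_tendsto path_law (\<lambda>m u. \<Sum>n=1..m. mult_int n (f n) u) F \<and>
          L2_tendsto path_law (\<lambda>m u. \<Sum>n=1..m. - (1 / real n) * mult_int n (f n) u) Y))"

definition inner_Rplus :: "(real \<Rightarrow> real) \<Rightarrow> (real \<Rightarrow> real) \<Rightarrow> real" where
  "inner_Rplus g h = (LBINT t:{0..}. g t * h t)"

definition d_W :: "'a measure \<Rightarrow> ('a \<Rightarrow> real) \<Rightarrow> 'b measure \<Rightarrow> ('b \<Rightarrow> real) \<Rightarrow> ennreal" where
  "d_W M X M' Y = (SUP h\<in>{h :: real \<Rightarrow> real. 1-lipschitz_on UNIV h}.
      ennreal \<bar>(\<integral>\<omega>. h (X \<omega>) \<partial>M) - (\<integral>\<omega>. h (Y \<omega>) \<partial>M')\<bar>)"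

end

theory Submission
  imports Defs
begin

text \<open>
  A functional \<open>F\<close> of the sequence \<open>U\<close> splits into its Hoeffding components
  $F_K = \prod_{k \in K} (\mathrm{Id} - E_k)\, E[F \mid U_j, j \in K]$, where $E_k$ averages over the
  $k$-th coordinate. The multiple integral of order $n$ collects the components with $|K| = n$, so
  $L^{-1}F$ has the components $-F_K / |K|$ and, with $D_k = \mathrm{Id} - E_k$, Parseval's identity gives
  $E[F G] = - \sum_k E[D_k L^{-1}F \, D_k G]$ for centered \<open>F\<close>.
  On the cell $[2k, 2k+2]$ the gradient is $D_k$ with the $k$-th coordinate replaced.
  Take $G = f(F)$, where \<open>f\<close> solves Stein's equation $f'(x) - x f(x) = h(x) - E[h(\mathcal{N})]$ and satisfies
  $|f'| \le 1$ and $|f'(x) - f'(y)| \le 2 |x - y|$. Resampling one coordinate, the gradient of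
  $L^{-1}F$ has mean zero over the cell, so $f$ may be expanded to second order around $F$ itself; the
  remainder contains the squared increment of $F$, whose cross term averages to zero.
\<close>

text \<open>The operators of the statement are fixed only up to null sets: \<open>L_inv\<close> and,
  for non-integrable kernels, \<open>mult_int\<close> return values picked by \<open>SOME\<close>,
  so nothing can be computed from the kernels behind them. The chosen random variables are instead
  pinned down by their inner products with Hoeffding components, which is all that Parseval's
  identity asks for. That a chaos decomposition exists has to be proved too; otherwise the choice
  would carry no information.

  Exchanging sums over cells with expectations rests on square summability of both gradients. For
  \<open>F\<close> it is the domain condition; for \<open>L_inv F\<close> it is automatic, since a
  component on \<open>K\<close> is counted \<open>card K\<close> times with weight
  \<open>1 / (card K)^2\<close>.

  Origin of the constants: a cell has length 2 and the uniform law has mass 1, so every integral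
  over a cell costs a factor 2, which accounts for 1/2, 1/2 and 1/4. The Lipschitz constant 2 of f'
  makes the Taylor remainder exactly \<open>(y - x)^2\<close>, and averaging this square over both
  values of the coordinate gives the two error terms with coefficient one each.\<close>

section \<open>Stein's equation\<close>

abbreviation lower_integral :: "(real \<Rightarrow> real) \<Rightarrow> real \<Rightarrow> real" where
  "lower_integral g x \<equiv> (LBINT y:{..x}. g y)"

abbreviation upper_integral :: "(real \<Rightarrow> real) \<Rightarrow> real \<Rightarrow> real" where
  "upper_integral g x \<equiv> (LBINT y:{x..}. g y)"

lemma integrable_imp_set_integrable:
  fixes f :: "'a \<Rightarrow> real"
  shows "integrable M f \<Longrightarrow> S \<in> sets M \<Longrightarrow> set_integrable M S f"
  unfolding set_integrable_def by (rule integrable_mult_indicator)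

lemma integral_eq_lower_plus_upper:
  assumes "integrable lborel g"
  shows "(\<integral>y. g y \<partial>lborel) = lower_integral g x + upper_integral g x"
proof -
  have *: "set_integrable lborel S g" if "S \<in> sets borel" for S
    using assms that by (simp add: integrable_imp_set_integrable)
  have "(\<integral>y. g y \<partial>lborel) = (LBINT y:{..x} \<union> {x..}. g y)"
    unfolding set_lebesgue_integral_def by (rule Bochner_Integration.integral_cong) (auto simp: indicator_def)
  also have "\<dots> = lower_integral g x + upper_integral g x"
    by (rule set_integral_Un_AE) (use AE_lborel_singleton[of x] in \<open>auto simp: * elim!: eventually_mono\<close>)
  finally show ?thesis .
qed

text \<open>Only values near \<open>x\<close> matter, so the half line is cut at the fixed point
  \<open>x - 1\<close> and the fundamental theorem is applied to the compact remainder.\<close>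

lemma lower_integral_has_real_derivative:
  assumes g: "integrable lborel g" and cont: "continuous_on UNIV g"
  shows "(lower_integral g has_real_derivative g x) (at x)"
proof -
  have *: "set_integrable lborel S g" if "S \<in> sets borel" for S
    using g that by (simp add: integrable_imp_set_integrable)
  let ?a = "x - 1" and ?b = "x + 1"
  have "((\<lambda>t. integral {?a..t} g) has_real_derivative g x) (at x within {?a..?b})"
    by (rule integral_has_real_derivative) (auto intro: continuous_on_subset[OF cont])
  then have "((\<lambda>t. integral {?a..t} g) has_real_derivative g x) (at x)"
    by (subst (asm) at_within_interior) (auto simp: interior_atLeastAtMost_real)
  then have "((\<lambda>t. lower_integral g ?a + integral {?a..t} g) has_real_derivative g x) (at x)"
    by (auto intro!: derivative_eq_intros)
  then show ?thesis
  proof (rule has_field_derivative_transform_within_open[where S="{?a<..<?b}"])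
    fix t assume that: "t \<in> {?a<..<?b}"
    have "lower_integral g t = (LBINT y:{..?a} \<union> {?a..t}. g y)"
      using that by (intro arg_cong[where f="\<lambda>S. set_lebesgue_integral lborel S g"]) auto
    also have "\<dots> = lower_integral g ?a + (LBINT y:{?a..t}. g y)"
      by (rule set_integral_Un_AE) (use AE_lborel_singleton[of ?a] in \<open>auto simp: * elim!: eventually_mono\<close>)
    also have "(LBINT y:{?a..t}. g y) = integral {?a..t} g"
      by (rule set_borel_integral_eq_integral) (simp add: *)
    finally show "lower_integral g ?a + integral {?a..t} g = lower_integral g t" by simp
  qed auto
qed

lemma lower_integral_tendsto:
  assumes g: "integrable lborel g"
  shows "(lower_integral g \<longlongrightarrow> (\<integral>y. g y \<partial>lborel)) at_top"
  using tendsto_integral_at_top[of lborel g] g by (simp add: set_lebesgue_integral_def)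

section \<open>The Gaussian density and its first moment\<close>

abbreviation \<phi> :: "real \<Rightarrow> real" where "\<phi> \<equiv> std_normal_density"

lemma normal_density_has_derivative [derivative_intros]:
  "(\<phi> has_real_derivative - x * \<phi> x) (at x)"
proof -
  have "((\<lambda>x. c * exp (- x\<^sup>2 / 2)) has_real_derivative - x * (c * exp (- x\<^sup>2 / 2))) (at x)" for c
    by (auto intro!: derivative_eq_intros)
  then show ?thesis unfolding std_normal_density_def[abs_def] .
qed

lemma continuous_normal_density: "continuous_on S \<phi>"
  by (rule DERIV_continuous_on[OF has_field_derivative_at_within[OF normal_density_has_derivative]])

lemma normal_density_tendsto_0: "(\<phi> \<longlongrightarrow> 0) at_top"
  unfolding std_normal_density_def[abs_def] by real_asymp

lemma normal_density_le_half: "\<phi> x \<le> 1 / 2"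
proof -
  have "2 \<le> sqrt (2 * pi)"
    using pi_gt3 by (intro real_le_rsqrt) simp
  then have "1 / sqrt (2 * pi) \<le> 1 / 2" by (simp add: field_simps)
  moreover have "\<phi> x \<le> 1 / sqrt (2 * pi)"
    unfolding std_normal_density_def by (simp add: field_simps)
  ultimately show ?thesis by linarith
qed

lemma integrable_id_normal: "integrable lborel (\<lambda>y. y * \<phi> y)"
  using integrable_std_normal_moment[of 1] by (simp add: mult.commute)

lemma integral_id_normal: "(\<integral>y. y * \<phi> y \<partial>lborel) = 0"
  using integral_std_normal_moment_odd[of 0] by (simp add: mult.commute)

text \<open>Both sides have derivative \<open>x * \<phi> x\<close>, so they differ by a constant. It
  is read off at plus infinity, where the integral tends to the mean of the normal law and the
  density to 0.\<close>

lemma lower_integral_id: "lower_integral (\<lambda>y. y * \<phi> y) x = - \<phi> x"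
proof -
  let ?G = "\<lambda>x. lower_integral (\<lambda>y. y * \<phi> y) x + \<phi> x"
  have "(?G has_real_derivative 0) (at x)" for x
    by (rule derivative_eq_intros lower_integral_has_real_derivative refl integrable_id_normal
        continuous_intros continuous_normal_density)+ simp
  then have const: "?G x = ?G y" for x y
    using DERIV_const_ratio_const2[of x y ?G 0] DERIV_isconst_all[of ?G] by metis
  have "(?G \<longlongrightarrow> 0 + 0) at_top"
    using lower_integral_tendsto[OF integrable_id_normal] normal_density_tendsto_0
    unfolding integral_id_normal by (rule tendsto_add)
  moreover have "(?G \<longlongrightarrow> ?G x) at_top"
    by (rule tendsto_eq_rhs[OF tendsto_const[of "?G x"], THEN tendsto_cong[THEN iffD1, rotated]])
       (use const in auto)
  ultimately have "?G x = 0"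
    using tendsto_unique[of at_top ?G] by fastforce
  then show ?thesis by simp
qed

lemma upper_integral_id: "upper_integral (\<lambda>y. y * \<phi> y) x = \<phi> x"
  using integral_eq_lower_plus_upper[OF integrable_id_normal, of x]
  by (simp add: integral_id_normal lower_integral_id)

lemma upper_integral_normal_eq: "upper_integral \<phi> x = 1 - lower_integral \<phi> x"
  using integral_eq_lower_plus_upper[of \<phi> x] by simp

lemma upper_integral_normal_uminus: "upper_integral \<phi> (- x) = lower_integral \<phi> x"
proof -
  have "lower_integral \<phi> x = (LBINT y:{y. - y \<in> {..x}}. \<phi> (- y))"
    by (rule set_integral_reflect)
  also have "\<dots> = upper_integral \<phi> (- x)"
    by (simp add: std_normal_density_def set_lebesgue_integral_def indicator_def minus_le_iff)
  finally show ?thesis ..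
qed

lemma upper_integral_normal_has_derivative:
  "(upper_integral \<phi> has_real_derivative - \<phi> x) (at x)"
  unfolding upper_integral_normal_eq[abs_def]
  by (auto intro!: derivative_eq_intros lower_integral_has_real_derivative continuous_normal_density)

section \<open>Lower bounds for the Mills ratio of the normal law\<close>

definition mills_root :: "real \<Rightarrow> real" where
  "mills_root x = (sqrt (x\<^sup>2 + 4) - x) / 2"

lemma mills_root_pos: "0 < mills_root x"
proof -
  have "\<bar>x\<bar> < sqrt (x\<^sup>2 + 4)" by (rule real_less_rsqrt) simp
  then show ?thesis unfolding mills_root_def by simp
qed

text \<open>Together with positivity this equation determines r = \<open>mills_root x\<close>. The
  estimates below use it to trade \<open>x * r\<close> for \<open>1 - r^2\<close>, which leaves
  expressions in r alone.\<close>

lemma mills_root_eq: "(mills_root x)\<^sup>2 + x * mills_root x = 1"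
proof -
  have "(sqrt (x\<^sup>2 + 4))\<^sup>2 = x\<^sup>2 + 4" by simp
  then show ?thesis unfolding mills_root_def by (simp add: power2_eq_square field_simps)
qed

lemma mills_root_le_1: assumes "0 \<le> x" shows "mills_root x \<le> 1"
proof -
  have "sqrt (x\<^sup>2 + 4) \<le> x + 2"
    using assms by (intro real_le_lsqrt) (auto simp: power2_eq_square field_simps)
  then show ?thesis unfolding mills_root_def by simp
qed

text \<open>Differentiating \<open>r^2 + x * r = 1\<close> implicitly gives
  \<open>r' = - r / (2 * r + x)\<close>, and \<open>r * (2 * r + x) = 1 + r^2\<close> eliminates
  \<open>x\<close>.\<close>

lemma mills_root_has_derivative:
  "(mills_root has_real_derivative - ((mills_root x)\<^sup>2 / (1 + (mills_root x)\<^sup>2))) (at x)"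
proof -
  let ?s = "sqrt (x\<^sup>2 + 4)" and ?r = "mills_root x"
  have s: "?s > 0" by (simp add: add_nonneg_pos)
  have d: "(mills_root has_real_derivative (x / ?s - 1) / 2) (at x)"
    unfolding mills_root_def[abs_def] using s by (auto intro!: derivative_eq_intros simp: field_simps)
  have "?s = 2 * ?r + x" by (simp add: mills_root_def field_simps)
  then have e1: "?r * ?s = 1 + ?r\<^sup>2"
    using mills_root_eq[of x] by (simp add: algebra_simps power2_eq_square)
  have "(x / ?s - 1) / 2 = - ?r / ?s"
    using s by (simp add: mills_root_def field_simps)
  also have "\<dots> = - (?r\<^sup>2 / (?r * ?s))"
    using mills_root_pos[of x] s by (simp add: power2_eq_square field_simps)
  finally have "(x / ?s - 1) / 2 = - (?r\<^sup>2 / (1 + ?r\<^sup>2))" unfolding e1 .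
  with d show ?thesis by (simp only:)
qed

text \<open>Birnbaum's lower bound for the Mills ratio.\<close>

lemma mills_ratio_ge: "mills_root x * \<phi> x \<le> upper_integral \<phi> x"
proof -
  let ?D = "\<lambda>x. mills_root x * \<phi> x - upper_integral \<phi> x"
  \<comment> \<open>The derivative is \<open>\<phi> x * (r^2 - r^2 / (1 + r^2))\<close>, and the
    denominator is at least 1.\<close>
  have deriv: "\<exists>d. (?D has_real_derivative d) (at x) \<and> 0 \<le> d" for x
  proof -
    let ?r = "mills_root x"
    have "(?D has_real_derivative (- (?r\<^sup>2 / (1 + ?r\<^sup>2))) * \<phi> x + ?r * (- x * \<phi> x) - (- \<phi> x)) (at x)"
      by (rule derivative_eq_intros mills_root_has_derivative upper_integral_normal_has_derivative refl)+ simp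
    moreover have "(- (?r\<^sup>2 / (1 + ?r\<^sup>2))) * \<phi> x + ?r * (- x * \<phi> x) - (- \<phi> x) = \<phi> x * (?r\<^sup>2 - ?r\<^sup>2 / (1 + ?r\<^sup>2))"
    proof -
      have "?r * x = 1 - ?r\<^sup>2" using mills_root_eq[of x] by (simp add: algebra_simps)
      then have "(?r * x) * \<phi> x = (1 - ?r\<^sup>2) * \<phi> x" by simp
      then have "?r * (- x * \<phi> x) = - (1 - ?r\<^sup>2) * \<phi> x" by (simp add: algebra_simps)
      then show ?thesis by (simp add: algebra_simps diff_divide_distrib)
    qed
    moreover have "?r\<^sup>2 / (1 + ?r\<^sup>2) \<le> ?r\<^sup>2"
      using divide_left_mono[of 1 "1 + ?r\<^sup>2" "?r\<^sup>2"] by (simp add: add_pos_nonneg)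
    moreover have "0 \<le> \<phi> x * (?r\<^sup>2 - ?r\<^sup>2 / (1 + ?r\<^sup>2))"
      using calculation(3) by simp
    ultimately show ?thesis by (intro exI conjI) auto
  qed
  have mono: "?D x \<le> ?D y" if "x \<le> y" for y
    using that deriv by (rule DERIV_nonneg_imp_nondecreasing) 
  \<comment> \<open>On the nonnegative axis \<open>mills_root\<close> is at most 1, so the
    nondecreasing difference stays below the density, which tends to 0; hence it is nonpositive
    everywhere.\<close>
  have "?D x \<le> \<phi> y" if "max x 0 \<le> y" for y
  proof -
    have "?D x \<le> ?D y" using mono that by simp
    also have "\<dots> \<le> mills_root y * \<phi> y"
      by (simp add: set_lebesgue_integral_def)
    also have "\<dots> \<le> \<phi> y"
      using mills_root_le_1[of y] that by (simp add: mult_left_le_one_le mills_root_pos less_imp_le)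
    finally show ?thesis .
  qed
  then have "\<forall>\<^sub>F y in at_top. ?D x \<le> \<phi> y"
    unfolding eventually_at_top_linorder by blast
  then have "?D x \<le> 0"
    by (rule tendsto_lowerbound[OF normal_density_tendsto_0]) simp
  then show ?thesis by simp
qed

text \<open>For positive \<open>x\<close> the number q = \<open>x / (1 + x^2)\<close> satisfies
  \<open>q^2 + x * q <= 1\<close>, so it lies below the positive root \<open>mills_root x\<close>.
  This weaker classical bound has the factor \<open>1 + x^2\<close> that the derivative of
  \<open>x * f x\<close> produces for a solution f of Stein's equation.\<close>

lemma mills_ratio_ge': "x * \<phi> x \<le> (1 + x\<^sup>2) * upper_integral \<phi> x"
proof (cases "x \<le> 0")
  case True
  have "0 \<le> upper_integral \<phi> x" by (simp add: set_lebesgue_integral_def)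
  then show ?thesis using True
    by (meson add_nonneg_nonneg mult_nonneg_nonneg mult_nonpos_nonneg normal_density_nonneg order_trans zero_le_one zero_le_power2)
next
  case False
  let ?r = "mills_root x"
  have "x \<le> (1 + x\<^sup>2) * ?r"
  proof (rule ccontr)
    assume "\<not> ?thesis"
    then have less: "?r * (1 + x\<^sup>2) < x" by (simp add: mult.commute)
    have p: "1 + x\<^sup>2 > 0" by (simp add: add_pos_nonneg)
    have r: "?r < x / (1 + x\<^sup>2)" using less p by (simp add: field_simps)
    have "?r\<^sup>2 < (x / (1 + x\<^sup>2))\<^sup>2" using r mills_root_pos[of x] by (intro power_strict_mono) auto
    moreover have "x * ?r < x * (x / (1 + x\<^sup>2))" using r False by (intro mult_strict_left_mono) auto
    ultimately have "1 < (x / (1 + x\<^sup>2))\<^sup>2 + x * (x / (1 + x\<^sup>2))"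
      using mills_root_eq[of x] by linarith
    also have "\<dots> = (x\<^sup>2 + x\<^sup>2 * (1 + x\<^sup>2)) / (1 + x\<^sup>2)\<^sup>2"
    proof -
      have "(x / p)\<^sup>2 + x * (x / p) = (x\<^sup>2 + x\<^sup>2 * p) / p\<^sup>2" if "p \<noteq> 0" for p
        using that by (simp add: field_simps power2_eq_square)
      then show ?thesis using p by simp
    qed
    also have "\<dots> \<le> 1"
    proof -
      have "x\<^sup>2 + x\<^sup>2 * (1 + x\<^sup>2) \<le> (1 + x\<^sup>2)\<^sup>2" by (simp add: power2_eq_square algebra_simps)
      moreover have "(1 + x\<^sup>2)\<^sup>2 > 0" using p by simp
      ultimately show ?thesis by (simp only: divide_le_eq_1) simp
    qed
    finally show False by simp
  qed
  then have "x * \<phi> x \<le> (1 + x\<^sup>2) * (?r * \<phi> x)"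
    by (metis mult.assoc mult_right_mono normal_density_nonneg)
  also have "\<dots> \<le> (1 + x\<^sup>2) * upper_integral \<phi> x"
    by (intro mult_left_mono mills_ratio_ge) simp
  finally show ?thesis .
qed

section \<open>The solution of Stein's equation and its regularity\<close>

definition stein_fun :: "(real \<Rightarrow> real) \<Rightarrow> real \<Rightarrow> real" where
  "stein_fun h x = lower_integral (\<lambda>y. (h y - (\<integral>z. h z * \<phi> z \<partial>lborel)) * \<phi> y) x / \<phi> x"

text \<open>Stein's equation is the definition here; what remains to be proved is that this is the
  derivative of \<open>stein_fun h\<close>. The solution comes from variation of constants with the
  integral started at minus infinity. Subtracting the Gaussian mean of \<open>h\<close> makes it
  equal to minus the integral over the right half line, which keeps the quotient by the density
  under control on both sides.\<close>

definition stein_deriv :: "(real \<Rightarrow> real) \<Rightarrow> real \<Rightarrow> real" where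
  "stein_deriv h x = h x - (\<integral>z. h z * \<phi> z \<partial>lborel) + x * stein_fun h x"

lemma stein_fun_has_derivative:
  assumes cont: "continuous_on UNIV h" and int: "integrable lborel (\<lambda>y. h y * \<phi> y)"
  shows "(stein_fun h has_real_derivative stein_deriv h x) (at x)"
proof -
  let ?c = "\<integral>z. h z * \<phi> z \<partial>lborel"
  have i: "integrable lborel (\<lambda>y. (h y - ?c) * \<phi> y)"
    unfolding left_diff_distrib by (intro Bochner_Integration.integrable_diff int) simp
  have p: "\<phi> x > 0" by (simp add: normal_density_pos)
  show ?thesis
    unfolding stein_fun_def[abs_def] stein_deriv_def
    by (rule derivative_eq_intros lower_integral_has_real_derivative i refl
        continuous_intros continuous_normal_density cont)+
      (use p in \<open>auto simp: field_simps power2_eq_square\<close>)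
qed

text \<open>For nondecreasing \<open>h\<close>, the integrals over both half lines bound the solution from above.\<close>

lemma stein_fun_mono:
  assumes cont: "continuous_on UNIV h" and int: "integrable lborel (\<lambda>y. h y * \<phi> y)" and "mono h"
  shows "stein_fun h x \<le> 0" and "x \<le> y \<Longrightarrow> y * stein_fun h y \<le> x * stein_fun h x"
proof -
  let ?c = "\<integral>z. h z * \<phi> z \<partial>lborel"
  let ?f = "stein_fun h"
  let ?g = "\<lambda>y. (h y - ?c) * \<phi> y"
  have i: "integrable lborel ?g"
    unfolding left_diff_distrib by (intro Bochner_Integration.integrable_diff int) simp
  have si: "set_integrable lborel S ?g" "set_integrable lborel S (\<lambda>y. C * \<phi> y)" if "S \<in> sets borel" for S C
    by (rule integrable_imp_set_integrable; use i that in simp)+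
  have "(\<integral>y. ?g y \<partial>lborel) = 0"
    unfolding left_diff_distrib using int by (subst Bochner_Integration.integral_diff) auto
  then have lu: "lower_integral ?g x = - upper_integral ?g x" for x
    using integral_eq_lower_plus_upper[OF i, of x] by simp
  have p: "\<phi> x > 0" for x by (simp add: normal_density_pos)
  have U: "0 \<le> upper_integral \<phi> x" for x by (simp add: set_lebesgue_integral_def)
  have b1: "?f x * \<phi> x \<le> (h x - ?c) * upper_integral \<phi> (- x)" for x
  proof -
    have "lower_integral ?g x \<le> lower_integral (\<lambda>y. (h x - ?c) * \<phi> y) x"
      by (intro set_integral_mono si) (auto intro!: mult_right_mono monoD[OF \<open>mono h\<close>])
    then show ?thesis using p[of x] by (simp add: stein_fun_def upper_integral_normal_uminus)
  qed
  have b2: "?f x * \<phi> x \<le> - (h x - ?c) * upper_integral \<phi> x" for x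
  proof -
    have "upper_integral (\<lambda>y. (h x - ?c) * \<phi> y) x \<le> upper_integral ?g x"
      by (intro set_integral_mono si) (auto intro!: mult_right_mono monoD[OF \<open>mono h\<close>])
    then have "(h x - ?c) * upper_integral \<phi> x \<le> upper_integral ?g x" by simp
    moreover have "?f x * \<phi> x = - upper_integral ?g x"
      using p[of x] by (simp only: stein_fun_def lu) simp
    moreover have "- (h x - ?c) * upper_integral \<phi> x = - ((h x - ?c) * upper_integral \<phi> x)"
      by (rule mult_minus_left)
    ultimately show ?thesis by (simp only: neg_le_iff_le)
  qed
  \<comment> \<open>The left side is the derivative of \<open>x * f x\<close>. Where
    \<open>h x\<close> is at least the mean, the bound from the right half line meets the Mills
    estimate at \<open>x\<close>; where it is below, the bound from the left meets the estimate at
    \<open>- x\<close>.\<close>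
  have key: "(1 + x\<^sup>2) * ?f x + x * (h x - ?c) \<le> 0" for x
  proof (cases "h x \<ge> ?c")
    case True
    have "(1 + x\<^sup>2) * (?f x * \<phi> x) \<le> (1 + x\<^sup>2) * (- (h x - ?c) * upper_integral \<phi> x)"
      by (intro mult_left_mono b2) simp
    also have "\<dots> = - ((h x - ?c) * ((1 + x\<^sup>2) * upper_integral \<phi> x))" by (simp add: algebra_simps)
    also have "\<dots> \<le> - ((h x - ?c) * (x * \<phi> x))"
      using True by (intro le_imp_neg_le mult_left_mono mills_ratio_ge') simp
    finally have "((1 + x\<^sup>2) * ?f x + x * (h x - ?c)) * \<phi> x \<le> 0" by (simp add: algebra_simps)
    then show ?thesis using p[of x] by (simp add: mult_le_0_iff)
  next
    case False
    have "\<phi> (- x) = \<phi> x" by (simp add: std_normal_density_def)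
    then have m: "- x * \<phi> x \<le> (1 + x\<^sup>2) * upper_integral \<phi> (- x)"
      using mills_ratio_ge'[of "- x"] by simp
    have "(1 + x\<^sup>2) * (?f x * \<phi> x) \<le> (1 + x\<^sup>2) * ((h x - ?c) * upper_integral \<phi> (- x))"
      by (intro mult_left_mono b1) simp
    also have "\<dots> = - ((?c - h x) * ((1 + x\<^sup>2) * upper_integral \<phi> (- x)))" by (simp add: algebra_simps)
    also have "\<dots> \<le> - ((?c - h x) * (- x * \<phi> x))"
      using False by (intro le_imp_neg_le mult_left_mono m) simp
    finally have "((1 + x\<^sup>2) * ?f x + x * (h x - ?c)) * \<phi> x \<le> 0" by (simp add: algebra_simps)
    then show ?thesis using p[of x] by (simp add: mult_le_0_iff)
  qed
  show "?f x \<le> 0"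
  proof (cases "h x \<ge> ?c")
    case True
    then have "- (h x - ?c) * upper_integral \<phi> x \<le> 0" using U[of x] by (simp add: mult_nonpos_nonneg)
    then have "?f x * \<phi> x \<le> 0" using b2[of x] by linarith
    then show ?thesis using p[of x] by (simp add: mult_le_0_iff)
  next
    case False
    then have "(h x - ?c) * upper_integral \<phi> (- x) \<le> 0" using U[of "- x"] by (simp add: mult_nonpos_nonneg)
    then have "?f x * \<phi> x \<le> 0" using b1[of x] by linarith
    then show ?thesis using p[of x] by (simp add: mult_le_0_iff)
  qed
  show "y * ?f y \<le> x * ?f x" if "x \<le> y"
  proof (rule DERIV_nonpos_imp_nonincreasing[OF that])
    fix z
    have "((\<lambda>x. x * ?f x) has_real_derivative (1 + z\<^sup>2) * ?f z + z * (h z - ?c)) (at z)"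
      by (rule derivative_eq_intros stein_fun_has_derivative cont int refl)+
        (simp add: stein_deriv_def algebra_simps power2_eq_square)
    then show "\<exists>d. ((\<lambda>x. x * ?f x) has_real_derivative d) (at z) \<and> d \<le> 0"
      using key by blast
  qed
qed

text \<open>The solution map is linear and sends the identity function to the constant -1. With
  \<open>s\<close> equal to 1 or -1 this reduces a Lipschitz \<open>h\<close> to nondecreasing
  functions.\<close>

lemma stein_fun_affine:
  assumes int: "integrable lborel (\<lambda>y. h y * \<phi> y)"
  shows "stein_fun (\<lambda>y. y + s * h y) x = s * stein_fun h x - 1"
proof -
  let ?c = "\<integral>z. h z * \<phi> z \<partial>lborel"
  have c: "(\<integral>z. (z + s * h z) * \<phi> z \<partial>lborel) = s * ?c"
    using int integrable_id_normal
    by (simp add: distrib_right Bochner_Integration.integral_add integral_id_normal mult.assoc)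
  have si: "set_integrable lborel {..x} (\<lambda>y. y * \<phi> y)" "set_integrable lborel {..x} (\<lambda>y. (h y - ?c) * \<phi> y)"
    unfolding left_diff_distrib using int
    by (auto intro!: integrable_imp_set_integrable Bochner_Integration.integrable_diff integrable_id_normal)
  have "lower_integral (\<lambda>y. (y + s * h y - s * ?c) * \<phi> y) x
      = lower_integral (\<lambda>y. y * \<phi> y + s * ((h y - ?c) * \<phi> y)) x"
    by (intro arg_cong[where f="\<lambda>g. lower_integral g x"]) (auto simp: algebra_simps)
  also have "\<dots> = - \<phi> x + s * lower_integral (\<lambda>y. (h y - ?c) * \<phi> y) x"
    using si by (simp add: set_integral_add lower_integral_id)
  finally show ?thesis
    unfolding stein_fun_def c using normal_density_pos[of 1 0 x] by (simp add: field_simps)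
qed

lemma lipschitz_one_real:
  fixes h :: "real \<Rightarrow> real"
  assumes "1-lipschitz_on UNIV h"
  shows "\<bar>h x - h y\<bar> \<le> \<bar>x - y\<bar>"
  using lipschitz_onD[OF assms, of x y] by (simp add: dist_real_def)

lemma integrable_lipschitz_normal:
  fixes h :: "real \<Rightarrow> real"
  assumes "1-lipschitz_on UNIV h"
  shows "integrable lborel (\<lambda>y. h y * \<phi> y)"
proof (rule Bochner_Integration.integrable_bound)
  show "integrable lborel (\<lambda>y. \<bar>h 0\<bar> * \<phi> y + \<phi> y * \<bar>y\<bar> ^ 1)"
    by (intro Bochner_Integration.integrable_add integrable_std_normal_moment_abs) auto
  have "continuous_on UNIV h" using assms by (rule lipschitz_on_continuous_on)
  then have "h \<in> borel_measurable borel" by (rule borel_measurable_continuous_onI)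
  then show "(\<lambda>y. h y * \<phi> y) \<in> borel_measurable lborel" by simp
  show "AE y in lborel. norm (h y * \<phi> y) \<le> norm (\<bar>h 0\<bar> * \<phi> y + \<phi> y * \<bar>y\<bar> ^ 1)"
  proof (intro AE_I2)
    fix y
    have "\<bar>h y\<bar> \<le> \<bar>h 0\<bar> + \<bar>y\<bar>" using lipschitz_one_real[OF assms, of y 0] by simp
    then have "\<bar>h y\<bar> * \<phi> y \<le> (\<bar>h 0\<bar> + \<bar>y\<bar>) * \<phi> y" by (rule mult_right_mono) simp
    then show "norm (h y * \<phi> y) \<le> norm (\<bar>h 0\<bar> * \<phi> y + \<phi> y * \<bar>y\<bar> ^ 1)"
      by (simp add: abs_mult algebra_simps)
  qed
qed

text \<open>
  Both \<open>y + h y\<close> and \<open>y - h y\<close> are nondecreasing, so \<open>x f(x)\<close> inherits the Lipschitz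
  constant of \<open>h\<close>.
\<close>

lemma stein_lipschitz:
  fixes h :: "real \<Rightarrow> real"
  assumes lip: "1-lipschitz_on UNIV h"
  shows "\<bar>stein_fun h x\<bar> \<le> 1" and "\<bar>stein_deriv h x - stein_deriv h y\<bar> \<le> 2 * \<bar>x - y\<bar>"
proof -
  have cont: "continuous_on UNIV h" using lip by (rule lipschitz_on_continuous_on)
  note int = integrable_lipschitz_normal[OF lip]
  let ?f = "stein_fun h"
  have bounds: "s * ?f x - 1 \<le> 0" "x \<le> y \<Longrightarrow> y * (s * ?f y - 1) \<le> x * (s * ?f x - 1)" if s: "s = 1 \<or> s = -1" for s x y
  proof -
    have 1: "continuous_on UNIV (\<lambda>y. y + s * h y)" by (intro continuous_intros cont)
    have 2: "integrable lborel (\<lambda>y. (y + s * h y) * \<phi> y)"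
      using int integrable_id_normal by (simp add: distrib_right mult.assoc)
    have 3: "mono (\<lambda>y. y + s * h y)"
    proof (rule monoI)
      fix x y :: real assume "x \<le> y"
      then show "x + s * h x \<le> y + s * h y" using lipschitz_one_real[OF lip, of x y] s by auto
    qed
    show "s * ?f x - 1 \<le> 0" "x \<le> y \<Longrightarrow> y * (s * ?f y - 1) \<le> x * (s * ?f x - 1)"
      using stein_fun_mono[OF 1 2 3] unfolding stein_fun_affine[OF int] by auto
  qed
  show "\<bar>?f x\<bar> \<le> 1" using bounds(1)[of 1 x] bounds(1)[of "-1" x] by auto
  have *: "\<bar>x * ?f x - y * ?f y\<bar> \<le> \<bar>x - y\<bar>" for x y
  proof -
    \<comment> \<open>The values \<open>s = 1\<close> and \<open>s = -1\<close> bound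
      \<open>y * f y - x * f x\<close> from above and from below by \<open>y - x\<close> in
      modulus.\<close>
    have "\<bar>x * ?f x - y * ?f y\<bar> \<le> \<bar>x - y\<bar>" if "x \<le> y" for x y
      using bounds(2)[of 1 x y] bounds(2)[of "-1" x y] that by (auto simp: algebra_simps abs_le_iff)
    then show ?thesis by (metis abs_minus_commute linear)
  qed
  show "\<bar>stein_deriv h x - stein_deriv h y\<bar> \<le> 2 * \<bar>x - y\<bar>"
  proof -
    have "stein_deriv h x - stein_deriv h y = (h x - h y) + (x * ?f x - y * ?f y)"
      unfolding stein_deriv_def by simp
    moreover have "\<bar>h x - h y + (x * ?f x - y * ?f y)\<bar> \<le> \<bar>x - y\<bar> + \<bar>x - y\<bar>"
      by (rule order_trans[OF abs_triangle_ineq add_mono[OF lipschitz_one_real[OF lip] *]])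
    ultimately show ?thesis by simp
  qed
qed

text \<open>Splitting the centred integral of \<open>h\<close> at \<open>x\<close> into a left part
  \<open>l\<close> and a right part \<open>\<rho>\<close> gives
  \<open>f' * \<phi> = - l * a - \<rho> * b\<close>. Here \<open>a\<close> and \<open>b\<close> are
  the means of the positive parts of N - x and x - N for a standard normal N, and the Lipschitz
  bound gives \<open>\<bar>l\<bar> \<le> b\<close> and \<open>\<bar>\<rho>\<bar> \<le> a\<close>. So
  the claim reduces to \<open>a * b \<le> \<phi> x / 2\<close>, an inequality without
  \<open>h\<close>.\<close>

lemma stein_deriv_bound:
  fixes h :: "real \<Rightarrow> real"
  assumes lip: "1-lipschitz_on UNIV h"
  shows "\<bar>stein_deriv h x\<bar> \<le> 1"
proof -
  note int = integrable_lipschitz_normal[OF lip]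
  let ?c = "\<integral>z. h z * \<phi> z \<partial>lborel"
  define g where "g y = (h y - h x) * \<phi> y" for y
  define l where "l = lower_integral g x"
  define \<rho> where "\<rho> = upper_integral g x"
  define Q where "Q = upper_integral \<phi> x"
  define a where "a = \<phi> x - x * Q"
  define b where "b = \<phi> x + x * (1 - Q)"
  have p: "\<phi> x > 0" for x by (simp add: normal_density_pos)
  have ig: "integrable lborel g"
    unfolding g_def left_diff_distrib by (intro Bochner_Integration.integrable_diff int) simp
  have si: "set_integrable lborel S g" "set_integrable lborel S \<phi>" "set_integrable lborel S (\<lambda>y. C * \<phi> y)"
      "set_integrable lborel S (\<lambda>y. y * \<phi> y)" if "S \<in> sets borel" for S C
    using ig that integrable_id_normal by (auto intro!: integrable_imp_set_integrable)
  have si': "set_integrable lborel S (\<lambda>y. (x - y) * \<phi> y)" "set_integrable lborel S (\<lambda>y. (y - x) * \<phi> y)" if "S \<in> sets borel" for S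
    unfolding left_diff_distrib using si that by auto
  have A: "lower_integral \<phi> x = 1 - Q" unfolding Q_def upper_integral_normal_eq by simp
  have "(\<integral>y. g y \<partial>lborel) = ?c - h x"
    unfolding g_def left_diff_distrib using int by (subst Bochner_Integration.integral_diff) auto
  then have c: "?c = h x + (l + \<rho>)"
    using integral_eq_lower_plus_upper[OF ig, of x] unfolding l_def \<rho>_def by simp
  have "lower_integral (\<lambda>y. (h y - ?c) * \<phi> y) x = lower_integral (\<lambda>y. g y - (l + \<rho>) * \<phi> y) x"
    unfolding c g_def by (intro arg_cong[where f="\<lambda>g. lower_integral g x"]) (auto simp: algebra_simps)
  also have "\<dots> = l - (l + \<rho>) * (1 - Q)"
    using si by (subst set_integral_diff) (auto simp: l_def A)
  finally have f: "stein_fun h x = (l - (l + \<rho>) * (1 - Q)) / \<phi> x"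
    by (simp add: stein_fun_def)
  have "stein_deriv h x * \<phi> x = - l * a - \<rho> * b"
    unfolding stein_deriv_def f c a_def b_def using p[of x] by (simp add: field_simps)
  then have d: "\<bar>stein_deriv h x\<bar> * \<phi> x \<le> \<bar>l\<bar> * \<bar>a\<bar> + \<bar>\<rho>\<bar> * \<bar>b\<bar>"
    using p[of x] abs_mult[of "stein_deriv h x" "\<phi> x"] abs_mult[of l a] abs_mult[of \<rho> b] by linarith
  have bnd: "\<bar>g y\<bar> \<le> \<bar>y - x\<bar> * \<phi> y" for y
    unfolding g_def abs_mult using lipschitz_one_real[OF lip, of y x] by (simp add: mult_right_mono)
  have bnd1: "\<bar>g y\<bar> \<le> (x - y) * \<phi> y" if "y \<le> x" for y
    using bnd[of y] that by simp
  have bnd2: "\<bar>g y\<bar> \<le> (y - x) * \<phi> y" if "x \<le> y" for y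
    using bnd[of y] that by simp
  have lb: "\<bar>l\<bar> \<le> b"
  proof -
    have "\<bar>l\<bar> \<le> lower_integral (\<lambda>y. \<bar>g y\<bar>) x"
      unfolding l_def using integral_abs_bound[of lborel "\<lambda>y. indicator {..x} y *\<^sub>R g y"]
      by (simp add: set_lebesgue_integral_def abs_mult)
    also have "\<dots> \<le> lower_integral (\<lambda>y. (x - y) * \<phi> y) x"
      by (intro set_integral_mono si' set_integrable_abs si) (use bnd1 in auto)
    also have "\<dots> = b"
      unfolding left_diff_distrib using si by (subst set_integral_diff) (auto simp: A b_def lower_integral_id)
    finally show ?thesis .
  qed
  have \<rho>b: "\<bar>\<rho>\<bar> \<le> a"
  proof -
    have "\<bar>\<rho>\<bar> \<le> upper_integral (\<lambda>y. \<bar>g y\<bar>) x"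
      unfolding \<rho>_def using integral_abs_bound[of lborel "\<lambda>y. indicator {x..} y *\<^sub>R g y"]
      by (simp add: set_lebesgue_integral_def abs_mult)
    also have "\<dots> \<le> upper_integral (\<lambda>y. (y - x) * \<phi> y) x"
      by (intro set_integral_mono si' set_integrable_abs si) (use bnd2 in auto)
    also have "\<dots> = a"
      unfolding left_diff_distrib using si by (subst set_integral_diff) (auto simp: a_def upper_integral_id Q_def)
    finally show ?thesis .
  qed
  have d2: "\<bar>stein_deriv h x\<bar> * \<phi> x \<le> 2 * (a * b)"
  proof -
    have "\<bar>l\<bar> * \<bar>a\<bar> \<le> b * a" "\<bar>\<rho>\<bar> * \<bar>b\<bar> \<le> a * b"
      using lb \<rho>b by (auto intro!: mult_mono)
    then show ?thesis using d by (simp add: mult.commute)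
  qed
  \<comment> \<open>Since \<open>b = a + x\<close>, this is the remaining inequality for
    \<open>x >= 0\<close>. Birnbaum's bound gives \<open>a' <= \<phi> t * r^2\<close> with r =
    \<open>mills_root t\<close>, and the density is at most 1/2.\<close>
  have main: "a' * (a' + t) \<le> \<phi> t / 2" if t: "0 \<le> t" and a': "0 \<le> a'" "a' = \<phi> t - t * upper_integral \<phi> t" for a' t
  proof -
    let ?r = "mills_root t"
    have rt: "t * ?r = 1 - ?r\<^sup>2" using mills_root_eq[of t] by simp
    have "t * (?r * \<phi> t) \<le> t * upper_integral \<phi> t"
      using t by (intro mult_left_mono mills_ratio_ge)
    then have "a' \<le> \<phi> t - (t * ?r) * \<phi> t" using a' by (simp add: mult.assoc)
    then have ar: "a' \<le> \<phi> t * ?r\<^sup>2" unfolding rt by (simp add: algebra_simps)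
    then have "a' * (a' + t) \<le> (\<phi> t * ?r\<^sup>2) * (\<phi> t * ?r\<^sup>2 + t)"
      using a' t by (intro mult_mono) auto
    also have "\<dots> = \<phi> t * (\<phi> t * ?r ^ 4 + ?r * (t * ?r))"
      by (simp add: power2_eq_square power4_eq_xxxx algebra_simps)
    also have "\<dots> \<le> \<phi> t * (1 / 2)"
    proof (intro mult_left_mono)
      have "\<phi> t * ?r ^ 4 + ?r * (t * ?r) \<le> 1 / 2 * ?r ^ 4 + ?r * (1 - ?r\<^sup>2)"
        unfolding rt using normal_density_le_half[of t] by (intro add_mono mult_right_mono order_refl) auto
      \<comment> \<open>The gap to 1/2 factors, so its sign follows from r lying between 0 and
        1.\<close>
      also have "\<dots> = 1 / 2 - (1 - ?r) ^ 3 * (1 + ?r) / 2"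
        by (simp add: power2_eq_square power3_eq_cube power4_eq_xxxx field_simps)
      also have "\<dots> \<le> 1 / 2"
        using mills_root_le_1[OF t] mills_root_pos[of t] by simp
      finally show "\<phi> t * ?r ^ 4 + ?r * (t * ?r) \<le> 1 / 2" .
    qed simp
    finally show ?thesis by simp
  qed
  have "a * b \<le> \<phi> x / 2"
  proof (cases "0 \<le> x")
    case True
    have "b = a + x" unfolding a_def b_def by (simp add: algebra_simps)
    then show ?thesis using main[of x a] True \<rho>b by (simp add: a_def Q_def)
  next
    \<comment> \<open>Reflection at the origin exchanges the roles of \<open>a\<close> and
      \<open>b\<close>.\<close>
    case False
    have e: "\<phi> (- x) = \<phi> x" by (simp add: std_normal_density_def)
    have "a = b + - x" unfolding a_def b_def by (simp add: algebra_simps)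
    moreover have "b = \<phi> (- x) - (- x) * upper_integral \<phi> (- x)"
      unfolding upper_integral_normal_uminus A e b_def by simp
    ultimately show ?thesis using main[of "- x" b] False lb e by (simp add: mult.commute)
  qed
  then have "\<bar>stein_deriv h x\<bar> * \<phi> x \<le> 1 * \<phi> x" using d2 by linarith
  then show ?thesis using p[of x] by simp
qed

text \<open>f' is only Lipschitz, so no second derivative is at hand. Adding or subtracting the
  remainder from \<open>(z - x)^2\<close> gives a function whose derivative has the sign of
  \<open>z - x\<close>, because f' varies by at most \<open>2 * \<bar>z - x\<bar>\<close>; its
  minimum is therefore 0, attained at \<open>x\<close>.\<close>

lemma stein_taylor:
  fixes h :: "real \<Rightarrow> real"
  assumes lip: "1-lipschitz_on UNIV h"
  shows "\<bar>stein_fun h y - stein_fun h x - stein_deriv h x * (y - x)\<bar> \<le> (y - x)\<^sup>2"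
proof -
  have cont: "continuous_on UNIV h" using lip by (rule lipschitz_on_continuous_on)
  note D = stein_fun_has_derivative[OF cont integrable_lipschitz_normal[OF lip]]
  have L: "\<bar>stein_deriv h z - stein_deriv h x\<bar> \<le> 2 * \<bar>z - x\<bar>" for z
    using stein_lipschitz(2)[OF lip] .
  define G where "G s z = (z - x)\<^sup>2 + s * (stein_fun h z - stein_fun h x - stein_deriv h x * (z - x))" for s z
  have dG: "(G s has_real_derivative 2 * (z - x) + s * (stein_deriv h z - stein_deriv h x)) (at z)" for s z
    unfolding G_def by (rule derivative_eq_intros D refl)+ simp
  have "0 \<le> G s y" if s: "s = 1 \<or> s = -1" for s
  proof (cases "x \<le> y")
    case True
    have "G s x \<le> G s y"
    proof (rule DERIV_nonneg_imp_nondecreasing[OF True])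
      fix z assume "x \<le> z" "z \<le> y"
      then show "\<exists>d. (G s has_real_derivative d) (at z) \<and> 0 \<le> d"
        using dG[of s z] L[of z] s by (intro exI conjI) (auto simp: abs_le_iff)
    qed
    then show ?thesis by (simp add: G_def)
  next
    case False
    have "G s x \<le> G s y"
    proof (rule DERIV_nonpos_imp_nonincreasing[of y x])
      fix z assume "y \<le> z" "z \<le> x"
      then show "\<exists>d. (G s has_real_derivative d) (at z) \<and> d \<le> 0"
        using dG[of s z] L[of z] s by (intro exI conjI) (auto simp: abs_le_iff)
    qed (use False in simp)
    then show ?thesis by (simp add: G_def)
  qed
  from this[of 1] this[of "-1"] show ?thesis unfolding G_def by auto
qed

section \<open>Square-integrable functionals\<close>

abbreviation unif :: "real measure" where "unif \<equiv> uniform_measure lborel {-1..1}"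

lemma prob_space_unif: "prob_space unif"
  by (rule prob_space_uniform_measure) auto

lemma sets_unif [measurable_cong]: "sets unif = sets borel"
  by simp

interpretation unif: prob_space unif by (rule prob_space_unif)

interpretation path: product_prob_space "\<lambda>_::nat. unif" UNIV by unfold_locales

lemma prob_space_path_law: "prob_space path_law"
  unfolding path_law_def by (rule path.prob_space_axioms)

interpretation P: prob_space path_law by (rule prob_space_path_law)

lemma sets_path_law [measurable_cong]: "sets path_law = sets (\<Pi>\<^sub>M k\<in>UNIV. (borel :: real measure))"
  unfolding path_law_def by (intro sets_PiM_cong) auto

lemma space_path_law [simp]: "space path_law = UNIV"
  unfolding path_law_def by (simp add: space_PiM)

lemma measure_path_law_UNIV [simp]: "measure path_law UNIV = 1"
  using P.prob_space by simp

section \<open>Inner product on the square-integrable functionals\<close>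

definition ip :: "((nat \<Rightarrow> real) \<Rightarrow> real) \<Rightarrow> ((nat \<Rightarrow> real) \<Rightarrow> real) \<Rightarrow> real" where
  "ip G H = (\<integral>u. G u * H u \<partial>path_law)"

lemma L2_measurable [measurable_dest]: "G \<in> L2_Omega \<Longrightarrow> G \<in> borel_measurable path_law"
  by (simp add: L2_Omega_def)

lemma L2_integrable_square: "G \<in> L2_Omega \<Longrightarrow> integrable path_law (\<lambda>u. (G u)\<^sup>2)"
  by (simp add: L2_Omega_def)

lemma L2_integrable: "G \<in> L2_Omega \<Longrightarrow> integrable path_law G"
  by (rule P.square_integrable_imp_integrable) (auto simp: L2_Omega_def)

lemma L2_integrable_mult:
  assumes "G \<in> L2_Omega" "H \<in> L2_Omega"
  shows "integrable path_law (\<lambda>u. G u * H u)"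
proof (rule Bochner_Integration.integrable_bound)
  show "integrable path_law (\<lambda>u. (G u)\<^sup>2 + (H u)\<^sup>2)"
    using assms by (auto intro: L2_integrable_square)
  show "(\<lambda>u. G u * H u) \<in> borel_measurable path_law" using assms by measurable
  have "\<bar>G u * H u\<bar> \<le> (G u)\<^sup>2 + (H u)\<^sup>2" for u
  proof -
    have "0 \<le> (\<bar>G u\<bar> - \<bar>H u\<bar>)\<^sup>2" by simp
    then have "2 * (\<bar>G u\<bar> * \<bar>H u\<bar>) \<le> (G u)\<^sup>2 + (H u)\<^sup>2" by (simp add: power2_diff)
    moreover have "0 \<le> \<bar>G u\<bar> * \<bar>H u\<bar>" by simp
    ultimately show ?thesis by (simp only: abs_mult)
  qed
  then show "AE u in path_law. norm (G u * H u) \<le> norm ((G u)\<^sup>2 + (H u)\<^sup>2)" by simp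
qed

lemma L2_add: "G \<in> L2_Omega \<Longrightarrow> H \<in> L2_Omega \<Longrightarrow> (\<lambda>u. G u + H u) \<in> L2_Omega"
  using L2_integrable_mult[of G H] L2_integrable_square[of G] L2_integrable_square[of H]
  by (auto simp: L2_Omega_def power2_sum mult.assoc)

lemma L2_scale: "G \<in> L2_Omega \<Longrightarrow> (\<lambda>u. c * G u) \<in> L2_Omega"
  by (auto simp: L2_Omega_def power_mult_distrib)

lemma L2_diff: "G \<in> L2_Omega \<Longrightarrow> H \<in> L2_Omega \<Longrightarrow> (\<lambda>u. G u - H u) \<in> L2_Omega"
  using L2_add[of G "\<lambda>u. (-1) * H u"] L2_scale[of H "-1"] by simp

lemma L2_const: "(\<lambda>_. c) \<in> L2_Omega"
  by (simp add: L2_Omega_def)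

lemma L2_sum: "(\<And>i. i \<in> A \<Longrightarrow> G i \<in> L2_Omega) \<Longrightarrow> (\<lambda>u. \<Sum>i\<in>A. G i u) \<in> L2_Omega"
  by (induction A rule: infinite_finite_induct) (auto intro: L2_add L2_const)

lemma L2_bounded:
  assumes "G \<in> borel_measurable path_law" "\<And>u. \<bar>G u\<bar> \<le> c"
  shows "G \<in> L2_Omega"
proof -
  have "(G u)\<^sup>2 \<le> c\<^sup>2" for u using assms(2)[of u] by (simp add: abs_le_square_iff[symmetric])
  then show ?thesis unfolding L2_Omega_def using assms(1)
    by (auto intro!: P.integrable_const_bound[of _ "c\<^sup>2"])
qed

lemma ip_commute: "ip G H = ip H G"
  unfolding ip_def by (simp add: mult.commute)

lemma ip_add_left: "G \<in> L2_Omega \<Longrightarrow> G' \<in> L2_Omega \<Longrightarrow> H \<in> L2_Omega \<Longrightarrow>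
    ip (\<lambda>u. G u + G' u) H = ip G H + ip G' H"
  unfolding ip_def distrib_right by (intro Bochner_Integration.integral_add L2_integrable_mult)

lemma ip_diff_left: "G \<in> L2_Omega \<Longrightarrow> G' \<in> L2_Omega \<Longrightarrow> H \<in> L2_Omega \<Longrightarrow>
    ip (\<lambda>u. G u - G' u) H = ip G H - ip G' H"
  unfolding ip_def left_diff_distrib by (intro Bochner_Integration.integral_diff L2_integrable_mult)

lemma ip_diff_right: "G \<in> L2_Omega \<Longrightarrow> G' \<in> L2_Omega \<Longrightarrow> H \<in> L2_Omega \<Longrightarrow>
    ip H (\<lambda>u. G u - G' u) = ip H G - ip H G'"
  using ip_diff_left[of G G' H] by (simp add: ip_commute)

lemma ip_add_right: "G \<in> L2_Omega \<Longrightarrow> G' \<in> L2_Omega \<Longrightarrow> H \<in> L2_Omega \<Longrightarrow>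
    ip H (\<lambda>u. G u + G' u) = ip H G + ip H G'"
  using ip_add_left[of G G' H] by (simp add: ip_commute)

lemma ip_scale_left: "ip (\<lambda>u. c * G u) H = c * ip G H"
  unfolding ip_def by (simp add: mult.assoc)

lemma ip_scale_right: "ip H (\<lambda>u. c * G u) = c * ip H G"
  using ip_scale_left[of c G H] by (simp add: ip_commute)

lemma ip_sum_left: "(\<And>i. i \<in> A \<Longrightarrow> G i \<in> L2_Omega) \<Longrightarrow> H \<in> L2_Omega \<Longrightarrow>
    ip (\<lambda>u. \<Sum>i\<in>A. G i u) H = (\<Sum>i\<in>A. ip (G i) H)"
  unfolding ip_def sum_distrib_right by (intro Bochner_Integration.integral_sum L2_integrable_mult)

lemma ip_sum_right: "(\<And>i. i \<in> A \<Longrightarrow> G i \<in> L2_Omega) \<Longrightarrow> H \<in> L2_Omega \<Longrightarrow>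
    ip H (\<lambda>u. \<Sum>i\<in>A. G i u) = (\<Sum>i\<in>A. ip H (G i))"
  using ip_sum_left[of A G H] by (simp add: ip_commute)

lemma ip_cong_AE:
  assumes "G \<in> L2_Omega" "G' \<in> L2_Omega" "H \<in> L2_Omega" "AE u in path_law. G u = G' u"
  shows "ip G H = ip G' H"
  unfolding ip_def
  by (rule integral_cong_AE) (use assms in \<open>auto elim!: eventually_mono\<close>)

lemma ip_self_nonneg: "0 \<le> ip G G"
  unfolding ip_def by simp

lemma nn_integral_square: "G \<in> L2_Omega \<Longrightarrow> (\<integral>\<^sup>+u. ennreal ((G u)\<^sup>2) \<partial>path_law) = ennreal (ip G G)"
  unfolding ip_def using L2_integrable_square[of G]
  by (subst nn_integral_eq_integral) (auto simp: power2_eq_square)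

lemma L2_I_nn:
  assumes [measurable]: "G \<in> borel_measurable path_law"
    and "(\<integral>\<^sup>+u. ennreal ((G u)\<^sup>2) \<partial>path_law) < \<infinity>"
  shows "G \<in> L2_Omega"
  unfolding L2_Omega_def using assms by (auto intro!: integrableI_bounded)

lemma ip_le_half: "G \<in> L2_Omega \<Longrightarrow> H \<in> L2_Omega \<Longrightarrow> 2 * \<bar>ip G H\<bar> \<le> ip G G + ip H H"
proof -
  assume *: "G \<in> L2_Omega" "H \<in> L2_Omega"
  have 1: "0 \<le> ip (\<lambda>u. G u - H u) (\<lambda>u. G u - H u)" by (rule ip_self_nonneg)
  have 2: "0 \<le> ip (\<lambda>u. G u + H u) (\<lambda>u. G u + H u)" by (rule ip_self_nonneg)
  have "ip (\<lambda>u. G u - H u) (\<lambda>u. G u - H u) = ip G G + ip H H - 2 * ip G H"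
    using * by (simp add: ip_diff_left ip_diff_right L2_diff ip_commute[of H G])
  moreover have "ip (\<lambda>u. G u + H u) (\<lambda>u. G u + H u) = ip G G + ip H H + 2 * ip G H"
    using * by (simp add: ip_add_left ip_add_right L2_add ip_commute[of H G])
  ultimately show ?thesis using 1 2 by linarith
qed

lemma ip_Cauchy_Schwarz:
  assumes G: "G \<in> L2_Omega" and H: "H \<in> L2_Omega"
  shows "\<bar>ip G H\<bar> \<le> sqrt (ip G G) * sqrt (ip H H)"
proof -
  have q: "2 * t * \<bar>ip G H\<bar> \<le> ip G G + t\<^sup>2 * ip H H" if "t > 0" for t
    using ip_le_half[OF G L2_scale[OF H, of t]] that
    by (simp add: ip_scale_left ip_scale_right abs_mult power2_eq_square mult.assoc)
  let ?a = "sqrt (ip G G)" and ?b = "sqrt (ip H H)"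
  have a: "?a\<^sup>2 = ip G G" "0 \<le> ?a" and b: "?b\<^sup>2 = ip H H" "0 \<le> ?b"
    by (simp_all add: ip_self_nonneg)
  \<comment> \<open>Scaling \<open>H\<close> by the ratio of the two norms balances the two squares;
    adding \<open>e\<close> to both norms keeps the ratio defined when a norm is 0, and
    \<open>e\<close> then tends to 0.\<close>
  have "\<bar>ip G H\<bar> \<le> (?a + e) * (?b + e)" if e: "e > 0" for e
  proof -
    have p: "?a + e > 0" "?b + e > 0" using a(2) b(2) e by linarith+
    let ?t = "(?a + e) / (?b + e)"
    have "2 * ?t * \<bar>ip G H\<bar> \<le> ip G G + ?t\<^sup>2 * ip H H" using p by (intro q) simp
    also have "\<dots> \<le> (?a + e)\<^sup>2 + ?t\<^sup>2 * (?b + e)\<^sup>2"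
    proof (intro add_mono mult_left_mono)
      show "ip G G \<le> (?a + e)\<^sup>2" using power_mono[of ?a "?a + e" 2] a e by linarith
      show "ip H H \<le> (?b + e)\<^sup>2" using power_mono[of ?b "?b + e" 2] b e by linarith
    qed simp
    also have "?t\<^sup>2 * (?b + e)\<^sup>2 = (?a + e)\<^sup>2" using p by (simp add: power_divide)
    finally have "2 * (?t * \<bar>ip G H\<bar>) \<le> 2 * (?a + e)\<^sup>2" by (simp only: mult.assoc mult_2 distrib_right)
    then have "?t * \<bar>ip G H\<bar> \<le> (?a + e)\<^sup>2" by (rule mult_left_le_imp_le) simp
    moreover have "X \<le> A * B" if "A / B * X \<le> A\<^sup>2" "A > 0" "B > 0" for A B X :: real
    proof -
      have "A * (X / B) \<le> A * A" using that(1) by (simp add: power2_eq_square)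
      then have "X / B \<le> A" using that(2) by (rule mult_left_le_imp_le)
      then show ?thesis using that(3) by (simp add: field_simps)
    qed
    ultimately show ?thesis using p by blast
  qed
  then have "\<forall>\<^sub>F e in at_right 0. \<bar>ip G H\<bar> \<le> (?a + e) * (?b + e)"
    using eventually_at_right_less[of 0] by (rule eventually_mono[rotated])
  moreover have "((\<lambda>e. (?a + e) * (?b + e)) \<longlongrightarrow> (?a + 0) * (?b + 0)) (at_right 0)"
    by (intro tendsto_intros)
  ultimately show ?thesis
    using tendsto_lowerbound[of "\<lambda>e. (?a + e) * (?b + e)" _ "at_right 0"] by simp
qed

lemma ip_self_zero_AE:
  assumes G: "G \<in> L2_Omega" and "ip G G = 0"
  shows "AE u in path_law. G u = 0"
proof -
  have "AE u in path_law. (G u)\<^sup>2 = 0"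
    using assms L2_integrable_square[OF G]
    by (subst integral_nonneg_eq_0_iff_AE[symmetric]) (auto simp: ip_def power2_eq_square)
  then show ?thesis by simp
qed

section \<open>Squared distances, limits and completeness\<close>

definition sqdist :: "((nat \<Rightarrow> real) \<Rightarrow> real) \<Rightarrow> ((nat \<Rightarrow> real) \<Rightarrow> real) \<Rightarrow> real" where
  "sqdist G H = ip (\<lambda>u. G u - H u) (\<lambda>u. G u - H u)"

lemma sqdist_nonneg: "0 \<le> sqdist G H"
  unfolding sqdist_def by (rule ip_self_nonneg)

lemma sqdist_expand: "G \<in> L2_Omega \<Longrightarrow> H \<in> L2_Omega \<Longrightarrow> sqdist G H = ip G G - 2 * ip G H + ip H H"
  unfolding sqdist_def by (simp add: ip_diff_left ip_diff_right L2_diff ip_commute[of H G])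

lemma sqdist_commute: "sqdist G H = sqdist H G"
  unfolding sqdist_def ip_def by (simp add: algebra_simps)

text \<open>With squared distances the triangle inequality becomes
  \<open>(s + t)^2 <= 2 * s^2 + 2 * t^2\<close>; the factor 2 is harmless in limits.\<close>

lemma sqdist_triangle:
  assumes "F \<in> L2_Omega" "G \<in> L2_Omega" "H \<in> L2_Omega"
  shows "sqdist F H \<le> 2 * sqdist F G + 2 * sqdist G H"
proof -
  have "sqdist F H \<le> (\<integral>u. 2 * ((F u - G u) * (F u - G u)) + 2 * ((G u - H u) * (G u - H u)) \<partial>path_law)"
    unfolding sqdist_def ip_def
  proof (rule integral_mono)
    fix u
    have "0 \<le> ((F u - G u) - (G u - H u))\<^sup>2" by simp
    then show "(F u - H u) * (F u - H u) \<le> 2 * ((F u - G u) * (F u - G u)) + 2 * ((G u - H u) * (G u - H u))"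
      by (simp add: power2_eq_square algebra_simps)
  qed (use assms in \<open>intro Bochner_Integration.integrable_add integrable_mult_right L2_integrable_mult L2_diff; simp\<close>)+
  also have "\<dots> = 2 * sqdist F G + 2 * sqdist G H"
    unfolding sqdist_def ip_def using assms
    by (subst Bochner_Integration.integral_add) (auto intro!: L2_integrable_mult L2_diff)
  finally show ?thesis .
qed

lemma sqdist_AE:
  assumes "G \<in> L2_Omega" "H \<in> L2_Omega" "sqdist G H = 0"
  shows "AE u in path_law. G u = H u"
  using ip_self_zero_AE[OF L2_diff[OF assms(1,2)]] assms(3) by (simp add: sqdist_def)

lemma nn_integral_sqdist:
  "G \<in> L2_Omega \<Longrightarrow> H \<in> L2_Omega \<Longrightarrow> (\<integral>\<^sup>+u. ennreal ((G u - H u)\<^sup>2) \<partial>path_law) = ennreal (sqdist G H)"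
  unfolding sqdist_def by (rule nn_integral_square) (rule L2_diff)

lemma L2_tendsto_iff:
  assumes "\<And>j. G j \<in> L2_Omega" "F \<in> L2_Omega"
  shows "L2_tendsto path_law G F \<longleftrightarrow> (\<lambda>j. sqdist (G j) F) \<longlonglongrightarrow> 0"
  unfolding L2_tendsto_def nn_integral_sqdist[OF assms]
  using tendsto_ennreal_iff[of "\<lambda>j. sqdist (G j) F" sequentially 0] by (simp add: sqdist_nonneg)

lemma sqdist_tendsto_ip:
  assumes G: "\<And>j. G j \<in> L2_Omega" and F: "F \<in> L2_Omega" and H: "H \<in> L2_Omega"
    and lim: "(\<lambda>j. sqdist (G j) F) \<longlonglongrightarrow> 0"
  shows "(\<lambda>j. ip (G j) H) \<longlonglongrightarrow> ip F H"
proof -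
  have "(\<lambda>j. ip (G j) H - ip F H) \<longlonglongrightarrow> 0"
  proof (rule Lim_null_comparison)
    show "\<forall>\<^sub>F j in sequentially. norm (ip (G j) H - ip F H) \<le> sqrt (sqdist (G j) F) * sqrt (ip H H)"
      using ip_Cauchy_Schwarz[OF L2_diff[OF G F] H] G F H
      by (intro always_eventually allI) (simp add: sqdist_def ip_diff_left[OF G F H, symmetric])
    show "(\<lambda>j. sqrt (sqdist (G j) F) * sqrt (ip H H)) \<longlonglongrightarrow> 0"
      using tendsto_mult_left_zero[OF tendsto_real_sqrt[OF lim, simplified]] by simp
  qed
  then show ?thesis by (simp add: LIM_zero_iff)
qed

lemma sqdist_limit_unique:
  assumes G: "\<And>j. G j \<in> L2_Omega" and F: "F \<in> L2_Omega" "F' \<in> L2_Omega"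
    and lim: "(\<lambda>j. sqdist (G j) F) \<longlonglongrightarrow> 0" "(\<lambda>j. sqdist (G j) F') \<longlonglongrightarrow> 0"
  shows "AE u in path_law. F u = F' u"
proof (rule sqdist_AE[OF F])
  have "(\<lambda>j. 2 * sqdist (G j) F + 2 * sqdist (G j) F') \<longlonglongrightarrow> 2 * 0 + 2 * 0"
    by (intro tendsto_intros lim)
  moreover have "sqdist F F' \<le> 2 * sqdist (G j) F + 2 * sqdist (G j) F'" for j
    using sqdist_triangle[OF F(1) G F(2)] by (simp add: sqdist_commute[of F])
  ultimately have "sqdist F F' \<le> 0"
    using LIMSEQ_le_const[of _ 0 "sqdist F F'"] by auto
  then show "sqdist F F' = 0" using sqdist_nonneg[of F F'] by linarith
qed

text \<open>Riesz-Fischer. A subsequence with geometrically small increments converges almost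
  everywhere, because the L1 norms of its increments are summable. Fatou's lemma then bounds the
  distance of the whole sequence to that pointwise limit.\<close>

lemma L2_complete:
  assumes G: "\<And>j. G j \<in> L2_Omega"
    and Cauchy: "\<And>e. e > 0 \<Longrightarrow> \<exists>N. \<forall>i\<ge>N. \<forall>j\<ge>N. sqdist (G i) (G j) < e"
  shows "\<exists>Z\<in>L2_Omega. (\<lambda>j. sqdist (G j) Z) \<longlonglongrightarrow> 0"
proof -
  have [measurable]: "G j \<in> borel_measurable path_law" for j using G by measurable
  have "\<forall>n. \<exists>N. \<forall>i\<ge>N. \<forall>j\<ge>N. sqdist (G i) (G j) < (1/4) ^ n" by (intro allI Cauchy) simp
  then obtain R where R: "\<And>n i j. R n \<le> i \<Longrightarrow> R n \<le> j \<Longrightarrow> sqdist (G i) (G j) < (1/4) ^ n" by metis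
  \<comment> \<open>Summing the thresholds makes \<open>r n\<close> and \<open>r (Suc n)\<close>
    both exceed \<open>R n\<close>; the extra \<open>n\<close> makes the indices tend to
    infinity.\<close>
  define r where "r n = (\<Sum>k\<le>n. R k) + n" for n
  have "R n \<le> (\<Sum>k\<le>m. R k)" if "n \<le> m" for n m
    using that by (intro member_le_sum) auto
  then have rR: "R n \<le> r n" "R n \<le> r (Suc n)" "n \<le> r n" for n
    unfolding r_def by (simp_all only: trans_le_add1 le_add2 order_refl le_SucI)
  define \<Delta> where "\<Delta> n u = G (r (Suc n)) u - G (r n) u" for n u
  have [measurable]: "\<Delta> n \<in> borel_measurable path_law" for n unfolding \<Delta>_def by measurable
  have bound: "(\<integral>\<^sup>+u. ennreal \<bar>\<Delta> n u\<bar> \<partial>path_law) \<le> ennreal ((1/2) ^ n)" for n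
  proof -
    have L: "(\<lambda>u. \<bar>\<Delta> n u\<bar>) \<in> L2_Omega"
      using L2_diff[OF G G, of "r (Suc n)" "r n"] by (auto simp: L2_Omega_def \<Delta>_def)
    have "ip (\<lambda>u. \<bar>\<Delta> n u\<bar>) (\<lambda>_. 1) \<le> sqrt (ip (\<lambda>u. \<bar>\<Delta> n u\<bar>) (\<lambda>u. \<bar>\<Delta> n u\<bar>)) * sqrt (ip (\<lambda>_. 1) (\<lambda>_. 1))"
      using ip_Cauchy_Schwarz[OF L L2_const[of 1]] by linarith
    also have "ip (\<lambda>u. \<bar>\<Delta> n u\<bar>) (\<lambda>u. \<bar>\<Delta> n u\<bar>) = sqdist (G (r (Suc n))) (G (r n))"
      by (simp add: sqdist_def \<Delta>_def ip_def)
    also have "sqrt (sqdist (G (r (Suc n))) (G (r n))) \<le> sqrt (((1/2) ^ n)\<^sup>2)"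
      using R[OF rR(2) rR(1), of n] by (intro real_sqrt_le_mono) (simp add: power_even_eq[symmetric] power_mult[symmetric] power_mult_distrib[symmetric] power2_eq_square)
    finally have "(\<integral>u. \<bar>\<Delta> n u\<bar> \<partial>path_law) \<le> (1/2) ^ n"
      by (simp add: ip_def P.prob_space)
    then show ?thesis
      using L2_integrable[OF L] by (subst nn_integral_eq_integral) (auto intro: ennreal_leI)
  qed
  have "(\<integral>\<^sup>+u. (\<Sum>n. ennreal \<bar>\<Delta> n u\<bar>) \<partial>path_law) = (\<Sum>n. \<integral>\<^sup>+u. ennreal \<bar>\<Delta> n u\<bar> \<partial>path_law)"
    by (rule nn_integral_suminf) measurable
  also have "\<dots> \<le> (\<Sum>n. ennreal ((1/2) ^ n))" by (intro suminf_le bound) auto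
  also have "\<dots> = ennreal (\<Sum>n. (1/2) ^ n)" by (intro suminf_ennreal2) (auto simp: summable_geometric)
  finally have "(\<integral>\<^sup>+u. (\<Sum>n. ennreal \<bar>\<Delta> n u\<bar>) \<partial>path_law) < \<infinity>" by (rule order.strict_trans1) simp
  then have "AE u in path_law. (\<Sum>n. ennreal \<bar>\<Delta> n u\<bar>) \<noteq> \<infinity>"
    by (intro nn_integral_noteq_infinite) auto
  then have conv: "AE u in path_law. convergent (\<lambda>n. G (r n) u)"
  proof eventually_elim
    fix u assume "(\<Sum>n. ennreal \<bar>\<Delta> n u\<bar>) \<noteq> \<infinity>"
    then have "summable (\<lambda>n. \<bar>\<Delta> n u\<bar>)"
      by (intro summable_suminf_not_top) (auto simp: top_ennreal_def)
    then have "summable (\<lambda>n. \<Delta> n u)" by (rule summable_rabs_cancel)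
    then have "convergent (\<lambda>N. \<Sum>n<N. \<Delta> n u)" by (simp add: summable_iff_convergent)
    then have "convergent (\<lambda>N. G (r N) u - G (r 0) u)"
      unfolding \<Delta>_def by (simp add: sum_lessThan_telescope[of "\<lambda>n. G (r n) u"])
    then have "convergent (\<lambda>N. (G (r N) u - G (r 0) u) + G (r 0) u)"
      by (rule convergent_add) (rule convergent_const)
    then show "convergent (\<lambda>N. G (r N) u)" by simp
  qed
  define Z where "Z u = lim (\<lambda>n. G (r n) u)" for u
  have [measurable]: "Z \<in> borel_measurable path_law" unfolding Z_def by measurable
  have fatou: "(\<integral>\<^sup>+u. ennreal ((G i u - Z u)\<^sup>2) \<partial>path_law) \<le> ennreal e"
    if N: "\<forall>i\<ge>N. \<forall>j\<ge>N. sqdist (G i) (G j) < e" and "i \<ge> N" for i N e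
  proof -
    have "(\<integral>\<^sup>+u. ennreal ((G i u - Z u)\<^sup>2) \<partial>path_law)
        = (\<integral>\<^sup>+u. liminf (\<lambda>n. ennreal ((G i u - G (r n) u)\<^sup>2)) \<partial>path_law)"
    proof (rule nn_integral_cong_AE)
      show "AE u in path_law. ennreal ((G i u - Z u)\<^sup>2) = liminf (\<lambda>n. ennreal ((G i u - G (r n) u)\<^sup>2))"
        using conv
      proof eventually_elim
        fix u assume "convergent (\<lambda>n. G (r n) u)"
        then have "(\<lambda>n. G (r n) u) \<longlonglongrightarrow> Z u" by (simp add: Z_def convergent_LIMSEQ_iff)
        then have "(\<lambda>n. ennreal ((G i u - G (r n) u)\<^sup>2)) \<longlonglongrightarrow> ennreal ((G i u - Z u)\<^sup>2)"
          by (intro tendsto_intros tendsto_ennrealI)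
        then show "ennreal ((G i u - Z u)\<^sup>2) = liminf (\<lambda>n. ennreal ((G i u - G (r n) u)\<^sup>2))"
          by (intro lim_imp_Liminf[symmetric]) auto
      qed
    qed
    also have "\<dots> \<le> liminf (\<lambda>n. \<integral>\<^sup>+u. ennreal ((G i u - G (r n) u)\<^sup>2) \<partial>path_law)"
      by (rule nn_integral_liminf) measurable
    also have "\<dots> \<le> liminf (\<lambda>n. ennreal e)"
    proof (rule Liminf_mono)
      show "\<forall>\<^sub>F n in sequentially. (\<integral>\<^sup>+u. ennreal ((G i u - G (r n) u)\<^sup>2) \<partial>path_law) \<le> ennreal e"
        unfolding nn_integral_sqdist[OF G G] eventually_sequentially
        using N \<open>i \<ge> N\<close> rR(3) by (intro exI[of _ N] allI impI ennreal_leI less_imp_le) (meson order_trans)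
    qed
    finally show ?thesis by (simp add: Liminf_const)
  qed
  have Z: "Z \<in> L2_Omega"
  proof -
    obtain N where N: "\<forall>i\<ge>N. \<forall>j\<ge>N. sqdist (G i) (G j) < 1" using Cauchy[of 1] by auto
    have "(\<integral>\<^sup>+u. ennreal ((G N u - Z u)\<^sup>2) \<partial>path_law) < \<infinity>"
      using fatou[OF N order_refl] by (rule order.strict_trans1) simp
    then have "(\<lambda>u. G N u - Z u) \<in> L2_Omega" by (intro L2_I_nn) auto
    from L2_diff[OF G[of N] this] show ?thesis by simp
  qed
  have "(\<lambda>j. sqdist (G j) Z) \<longlonglongrightarrow> 0"
  proof (rule LIMSEQ_I)
    fix e :: real assume "e > 0"
    then obtain N where N: "\<forall>i\<ge>N. \<forall>j\<ge>N. sqdist (G i) (G j) < e / 2" using Cauchy[of "e/2"] by auto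
    have "norm (sqdist (G i) Z - 0) < e" if "i \<ge> N" for i
      using fatou[OF N that] \<open>e > 0\<close> sqdist_nonneg[of "G i" Z] unfolding nn_integral_sqdist[OF G Z]
      by (simp add: ennreal_le_iff)
    then show "\<exists>N. \<forall>i\<ge>N. norm (sqdist (G i) Z - 0) < e" by blast
  qed
  with Z show ?thesis by blast
qed

section \<open>Resampling and the Hoeffding decomposition\<close>

lemma measurable_path_law:
  assumes "\<And>i. (\<lambda>x. f x i) \<in> borel_measurable N"
  shows "f \<in> measurable N path_law"
proof -
  have "f \<in> measurable N (\<Pi>\<^sub>M k\<in>UNIV. (borel :: real measure))"
    by (rule measurable_PiM_single') (use assms in auto)
  then show ?thesis using measurable_cong_sets[OF refl sets_path_law] by blast
qed

lemma measurable_path_component [measurable (raw)]: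
  assumes [measurable]: "f \<in> measurable N path_law"
  shows "(\<lambda>x. f x i) \<in> borel_measurable N"
proof -
  have "(\<lambda>u :: nat \<Rightarrow> real. u i) \<in> borel_measurable path_law" by measurable
  from measurable_compose[OF assms this] show ?thesis .
qed

section \<open>Mixing two independent paths and conditioning on coordinates\<close>

definition mix :: "nat set \<Rightarrow> (nat \<Rightarrow> real) \<Rightarrow> (nat \<Rightarrow> real) \<Rightarrow> nat \<Rightarrow> real" where
  "mix A u v = (\<lambda>i. if i \<in> A then u i else v i)"

lemma measurable_mix [measurable (raw)]:
  assumes [measurable]: "f \<in> measurable N path_law" "g \<in> measurable N path_law"
  shows "(\<lambda>x. mix A (f x) (g x)) \<in> measurable N path_law"
  by (rule measurable_path_law) (simp add: mix_def)

lemma mix_assoc: "mix B (mix A u v) w = mix (A \<inter> B) u (mix B v w)"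
  unfolding mix_def by auto

interpretation PP: pair_prob_space path_law path_law ..

text \<open>A cylinder set over \<open>J\<close> pulls back to a rectangle: its factors in
  \<open>J \<inter> A\<close> constrain the first path and those in \<open>J - A\<close> the second,
  and the product of the two probabilities reassembles.\<close>

lemma distr_mix: "distr (path_law \<Otimes>\<^sub>M path_law) path_law (\<lambda>(u, v). mix A u v) = path_law"
  unfolding path_law_def
proof (rule path.PiM_eq)
  let ?S = "\<Pi>\<^sub>M k\<in>(UNIV :: nat set). unif"
  let ?D = "distr (?S \<Otimes>\<^sub>M ?S) ?S (\<lambda>(u, v). mix A u v)"
  fix J E assume J: "finite J" "J \<subseteq> (UNIV :: nat set)" "\<And>j. j \<in> J \<Longrightarrow> E j \<in> sets unif"
  let ?emb = "prod_emb UNIV (\<lambda>_. unif)"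
  let ?X = "?emb J (\<Pi>\<^sub>E j\<in>J. E j)"
  have meas: "(\<lambda>(u, v). mix A u v) \<in> measurable (?S \<Otimes>\<^sub>M ?S) ?S"
    using measurable_mix[of fst "path_law \<Otimes>\<^sub>M path_law" snd A] by (simp add: path_law_def split_beta')
  have "(\<lambda>(u, v). mix A u v) -` ?X \<inter> space (?S \<Otimes>\<^sub>M ?S) =
      ?emb (J \<inter> A) (\<Pi>\<^sub>E j\<in>J \<inter> A. E j) \<times> ?emb (J - A) (\<Pi>\<^sub>E j\<in>J - A. E j)"
    by (auto simp: space_pair_measure space_PiM prod_emb_def PiE_iff mix_def split: if_splits)
  then have "emeasure ?D ?X = emeasure (?S \<Otimes>\<^sub>M ?S) (?emb (J \<inter> A) (\<Pi>\<^sub>E j\<in>J \<inter> A. E j) \<times> ?emb (J - A) (\<Pi>\<^sub>E j\<in>J - A. E j))"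
    using J by (subst emeasure_distr[OF meas]) (auto intro!: sets_PiM_I)
  also have "\<dots> = emeasure ?S (?emb (J \<inter> A) (\<Pi>\<^sub>E j\<in>J \<inter> A. E j)) * emeasure ?S (?emb (J - A) (\<Pi>\<^sub>E j\<in>J - A. E j))"
    using J by (intro path.P.emeasure_pair_measure_Times sets_PiM_I) auto
  also have "\<dots> = (\<Prod>j\<in>J \<inter> A. emeasure unif (E j)) * (\<Prod>j\<in>J - A. emeasure unif (E j))"
    using J by (subst (1 2) path.emeasure_PiM_emb) auto
  also have "\<dots> = (\<Prod>j\<in>J. emeasure unif (E j))"
    using J(1) prod.Int_Diff[of J "\<lambda>j. emeasure unif (E j)" A] by simp
  finally show "emeasure ?D ?X = (\<Prod>j\<in>J. emeasure unif (E j))" .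
qed simp

lemma nn_integral_mix:
  assumes [measurable]: "K \<in> borel_measurable path_law"
  shows "(\<integral>\<^sup>+u. (\<integral>\<^sup>+v. K (mix A u v) \<partial>path_law) \<partial>path_law) = (\<integral>\<^sup>+u. K u \<partial>path_law)"
proof -
  have "(\<integral>\<^sup>+u. K u \<partial>path_law) = (\<integral>\<^sup>+u. K u \<partial>distr (path_law \<Otimes>\<^sub>M path_law) path_law (\<lambda>(u, v). mix A u v))"
    unfolding distr_mix ..
  also have "\<dots> = (\<integral>\<^sup>+x. K (case x of (u, v) \<Rightarrow> mix A u v) \<partial>(path_law \<Otimes>\<^sub>M path_law))"
    by (rule nn_integral_distr) measurable
  also have "\<dots> = (\<integral>\<^sup>+u. (\<integral>\<^sup>+v. K (mix A u v) \<partial>path_law) \<partial>path_law)"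
    by (subst P.nn_integral_fst[symmetric]) auto
  finally show ?thesis ..
qed

text \<open>A version of the conditional expectation given the coordinates in \<open>A\<close> that
  is defined at every path and depends exactly on those coordinates; the kernels of the chaos
  decomposition are evaluated pointwise and rely on this. Where the section is not integrable the
  value is 0.\<close>

definition cexp :: "nat set \<Rightarrow> ((nat \<Rightarrow> real) \<Rightarrow> real) \<Rightarrow> (nat \<Rightarrow> real) \<Rightarrow> real" where
  "cexp A G u = (\<integral>v. G (mix A u v) \<partial>path_law)"

lemma cexp_measurable [measurable]:
  assumes [measurable]: "G \<in> borel_measurable path_law"
  shows "cexp A G \<in> borel_measurable path_law"
  unfolding cexp_def[abs_def] by measurable

lemma cexp_cong_on: "(\<And>i. i \<in> A \<Longrightarrow> u i = u' i) \<Longrightarrow> cexp A G u = cexp A G u'"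
proof -
  assume "\<And>i. i \<in> A \<Longrightarrow> u i = u' i"
  then have "mix A u = mix A u'" by (auto simp: mix_def fun_eq_iff)
  then show ?thesis by (simp add: cexp_def)
qed

lemma cexp_mix: "cexp A G (mix A u v) = cexp A G u"
  by (rule cexp_cong_on) (simp add: mix_def)

lemma integrable_mix:
  assumes "integrable path_law K"
  shows "AE u in path_law. integrable path_law (\<lambda>v. K (mix A u v))"
    and "integrable path_law (cexp A K)" and "(\<integral>u. cexp A K u \<partial>path_law) = (\<integral>u. K u \<partial>path_law)"
proof -
  have [measurable]: "K \<in> borel_measurable path_law" using assms by auto
  have "integrable (distr (path_law \<Otimes>\<^sub>M path_law) path_law (\<lambda>(u, v). mix A u v)) K"
    unfolding distr_mix by fact
  then have *: "integrable (path_law \<Otimes>\<^sub>M path_law) (\<lambda>(u, v). K (mix A u v))"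
    by (subst (asm) integrable_distr_eq) (auto simp: split_beta')
  show "AE u in path_law. integrable path_law (\<lambda>v. K (mix A u v))"
    using PP.AE_integrable_fst'[OF *] by simp
  show "integrable path_law (cexp A K)"
    unfolding cexp_def[abs_def] using PP.integrable_fst'[OF *] by simp
  have "(\<integral>u. K u \<partial>path_law) = (\<integral>u. K u \<partial>distr (path_law \<Otimes>\<^sub>M path_law) path_law (\<lambda>(u, v). mix A u v))"
    unfolding distr_mix ..
  also have "\<dots> = (\<integral>x. (case x of (u, v) \<Rightarrow> K (mix A u v)) \<partial>(path_law \<Otimes>\<^sub>M path_law))"
    by (subst integral_distr) (auto simp: split_beta')
  also have "\<dots> = (\<integral>u. cexp A K u \<partial>path_law)"
    unfolding cexp_def using PP.integral_fst'[OF *] by simp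
  finally show "(\<integral>u. cexp A K u \<partial>path_law) = (\<integral>u. K u \<partial>path_law)" ..
qed

lemma square_integral_le:
  assumes [measurable]: "g \<in> borel_measurable path_law"
  shows "ennreal ((\<integral>v. g v \<partial>path_law)\<^sup>2) \<le> (\<integral>\<^sup>+v. ennreal ((g v)\<^sup>2) \<partial>path_law)"
proof (cases "(\<integral>\<^sup>+v. ennreal ((g v)\<^sup>2) \<partial>path_law) < \<infinity>")
  case True
  then have g: "g \<in> L2_Omega" by (intro L2_I_nn) auto
  have "\<bar>\<integral>v. g v \<partial>path_law\<bar> \<le> sqrt (ip g g)"
    using ip_Cauchy_Schwarz[OF g L2_const[of 1]] by (simp add: ip_def)
  then have "\<bar>\<integral>v. g v \<partial>path_law\<bar>\<^sup>2 \<le> (sqrt (ip g g))\<^sup>2" by (intro power_mono) auto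
  then have "(\<integral>v. g v \<partial>path_law)\<^sup>2 \<le> ip g g" by (simp add: ip_self_nonneg)
  then show ?thesis unfolding nn_integral_square[OF g] by (rule ennreal_leI)
next
  case False
  then show ?thesis by (simp add: not_less top_unique)
qed

lemma cexp_L2: assumes G: "G \<in> L2_Omega" shows "cexp A G \<in> L2_Omega"
proof (rule L2_I_nn)
  have [measurable]: "G \<in> borel_measurable path_law" using G by measurable
  show "cexp A G \<in> borel_measurable path_law" by measurable
  have "(\<integral>\<^sup>+u. ennreal ((cexp A G u)\<^sup>2) \<partial>path_law) \<le> (\<integral>\<^sup>+u. (\<integral>\<^sup>+v. ennreal ((G (mix A u v))\<^sup>2) \<partial>path_law) \<partial>path_law)"
    unfolding cexp_def by (intro nn_integral_mono square_integral_le) measurable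
  also have "\<dots> = (\<integral>\<^sup>+u. ennreal ((G u)\<^sup>2) \<partial>path_law)" by (rule nn_integral_mix) measurable
  also have "\<dots> < \<infinity>" using nn_integral_square[OF G] by simp
  finally show "(\<integral>\<^sup>+u. ennreal ((cexp A G u)\<^sup>2) \<partial>path_law) < \<infinity>" .
qed

text \<open>Resampling outside \<open>A\<close> leaves \<open>cexp A G\<close> unchanged, so
  integrating over those coordinates first replaces \<open>H\<close> by its conditional expectation.
  Symmetry then makes \<open>cexp A\<close> self-adjoint.\<close>

lemma ip_cexp_cexp:
  assumes G: "G \<in> L2_Omega" and H: "H \<in> L2_Omega"
  shows "ip (cexp A G) H = ip (cexp A G) (cexp A H)"
proof -
  have "ip (cexp A G) H = (\<integral>u. cexp A (\<lambda>u. cexp A G u * H u) u \<partial>path_law)"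
    unfolding ip_def by (rule integrable_mix(3)[symmetric]) (intro L2_integrable_mult cexp_L2 G H)
  also have "\<dots> = (\<integral>u. cexp A G u * cexp A H u \<partial>path_law)"
    unfolding cexp_def[of A "\<lambda>u. cexp A G u * H u"] cexp_mix by (simp add: cexp_def[of A H])
  finally show ?thesis by (simp add: ip_def)
qed

lemma ip_cexp: "G \<in> L2_Omega \<Longrightarrow> H \<in> L2_Omega \<Longrightarrow> ip (cexp A G) H = ip G (cexp A H)"
  using ip_cexp_cexp[of G H A] ip_cexp_cexp[of H G A] by (simp add: ip_commute)

text \<open>Two successive resamplings resample everything outside \<open>A \<inter> B\<close>. The
  null set that is excluded is the one where the section of \<open>G\<close> fails to be integrable
  and the integrals take their default value.\<close>

lemma cexp_cexp_AE:
  assumes "G \<in> L2_Omega"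
  shows "AE u in path_law. cexp A (cexp B G) u = cexp (A \<inter> B) G u"
  using integrable_mix(1)[OF L2_integrable[OF assms], of "A \<inter> B"]
proof eventually_elim
  fix u assume int: "integrable path_law (\<lambda>v. G (mix (A \<inter> B) u v))"
  have "cexp A (cexp B G) u = (\<integral>v. cexp B (\<lambda>z. G (mix (A \<inter> B) u z)) v \<partial>path_law)"
    unfolding cexp_def mix_assoc ..
  also have "\<dots> = (\<integral>z. G (mix (A \<inter> B) u z) \<partial>path_law)" by (rule integrable_mix(3)[OF int])
  finally show "cexp A (cexp B G) u = cexp (A \<inter> B) G u" by (simp add: cexp_def)
qed

lemma ip_cexp_Int:
  assumes G: "G \<in> L2_Omega" and H: "H \<in> L2_Omega"
  shows "ip (cexp A G) (cexp B H) = ip (cexp (A \<inter> B) G) H"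
proof -
  have "ip (cexp A G) (cexp B H) = ip (cexp B (cexp A G)) H"
    using ip_cexp[OF cexp_L2[OF G] H] by simp
  also have "\<dots> = ip (cexp (B \<inter> A) G) H"
    by (rule ip_cong_AE) (auto intro: cexp_L2 G H cexp_cexp_AE)
  finally show ?thesis by (simp add: Int_commute)
qed

text \<open>The alternating sum is the product of the operators $\mathrm{Id} - E_k$ for $k \in K$, expanded.\<close>

definition hoeff :: "nat set \<Rightarrow> ((nat \<Rightarrow> real) \<Rightarrow> real) \<Rightarrow> (nat \<Rightarrow> real) \<Rightarrow> real" where
  "hoeff K G u = (-1) ^ card K * (\<Sum>J\<in>Pow K. (-1) ^ card J * cexp J G u)"

lemma hoeff_L2: "G \<in> L2_Omega \<Longrightarrow> hoeff K G \<in> L2_Omega"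
  unfolding hoeff_def[abs_def] by (intro L2_scale L2_sum cexp_L2)

lemma hoeff_cong_on: "(\<And>i. i \<in> K \<Longrightarrow> u i = u' i) \<Longrightarrow> hoeff K G u = hoeff K G u'"
  unfolding hoeff_def by (intro arg_cong2[where f="(*)"] sum.cong refl cexp_cong_on) auto

lemma ip_hoeff_left:
  assumes "G \<in> L2_Omega" "H \<in> L2_Omega"
  shows "ip (hoeff K G) H = (-1) ^ card K * (\<Sum>J\<in>Pow K. (-1) ^ card J * ip (cexp J G) H)"
  unfolding hoeff_def[abs_def] using assms
  by (simp add: ip_scale_left ip_sum_left L2_scale cexp_L2)

lemma ip_hoeff:
  assumes "G \<in> L2_Omega" "H \<in> L2_Omega"
  shows "ip (hoeff K G) H = ip G (hoeff K H)"
  using assms ip_hoeff_left[of G H K] ip_hoeff_left[of H G K]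
  by (simp add: ip_commute[of G] ip_cexp[of G H])

text \<open>Subsets without \<open>k\<close> and the same subsets with \<open>k\<close> added carry
  opposite signs and equal values, so they cancel in pairs.\<close>

lemma alternating_sum_Pow_zero:
  fixes c :: "nat set \<Rightarrow> real"
  assumes "finite K" "k \<in> K" "\<And>J. c (insert k J) = c J"
  shows "(\<Sum>J\<in>Pow K. (-1) ^ card J * c J) = 0"
proof -
  have K: "K = insert k (K - {k})" using assms by auto
  let ?K = "K - {k}"
  have inj: "inj_on (insert k) (Pow ?K)" by (auto simp: inj_on_def)
  have "(\<Sum>J\<in>Pow K. (-1) ^ card J * c J) = (\<Sum>J\<in>Pow ?K \<union> insert k ` Pow ?K. (-1) ^ card J * c J)"
    by (subst K) (simp only: Pow_insert)
  also have "\<dots> = (\<Sum>J\<in>Pow ?K. (-1) ^ card J * c J) + (\<Sum>J\<in>insert k ` Pow ?K. (-1) ^ card J * c J)"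
    using assms(1) by (intro sum.union_disjoint) auto
  also have "(\<Sum>J\<in>insert k ` Pow ?K. (-1) ^ card J * c J) = (\<Sum>J\<in>Pow ?K. - ((-1) ^ card J * c J))"
    unfolding sum.reindex[OF inj] o_def
  proof (intro sum.cong refl)
    fix J assume "J \<in> Pow ?K"
    then have "finite J" "k \<notin> J" using assms(1) finite_subset by auto
    then show "(-1) ^ card (insert k J) * c (insert k J) = - ((-1) ^ card J * c J)"
      by (simp add: assms(3))
  qed
  finally show ?thesis by (simp add: sum_negf)
qed

text \<open>If some \<open>k\<close> in \<open>K\<close> lies outside \<open>B\<close>, adding
  \<open>k\<close> to \<open>J\<close> does not change \<open>J \<inter> B\<close>, and the
  alternating sum cancels. Conditioning thus keeps precisely the components inside
  \<open>B\<close>.\<close>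

lemma ip_hoeff_cexp:
  assumes G: "G \<in> L2_Omega" and H: "H \<in> L2_Omega" and K: "finite K"
  shows "ip (hoeff K G) (cexp B H) = (if K \<subseteq> B then ip (hoeff K G) H else 0)"
proof (cases "K \<subseteq> B")
  case True
  then have "J \<inter> B = J" if "J \<in> Pow K" for J using that by auto
  then show ?thesis using True G H
    by (simp add: ip_hoeff_left cexp_L2 ip_cexp_Int)
next
  case False
  then obtain k where k: "k \<in> K" "k \<notin> B" by auto
  have "ip (hoeff K G) (cexp B H) = (-1) ^ card K * (\<Sum>J\<in>Pow K. (-1) ^ card J * ip (cexp (J \<inter> B) G) H)"
    using G H by (simp add: ip_hoeff_left cexp_L2 ip_cexp_Int)
  also have "(\<Sum>J\<in>Pow K. (-1) ^ card J * ip (cexp (J \<inter> B) G) H) = 0"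
    by (rule alternating_sum_Pow_zero[OF K k(1)]) (use k in simp)
  finally show ?thesis using False by simp
qed

text \<open>Expanding the component on \<open>J\<close>, only subsets of \<open>J\<close> that
  contain \<open>K\<close> contribute, which forces \<open>K \<subseteq> J\<close>; exchanging the
  roles forces equality. For \<open>K = J\<close> the single subset \<open>J\<close> survives, with
  its sign squared.\<close>

lemma ip_hoeff_hoeff:
  assumes G: "G \<in> L2_Omega" and H: "H \<in> L2_Omega" and K: "finite K" and J: "finite J"
  shows "ip (hoeff K G) (hoeff J H) = (if K = J then ip (hoeff K G) H else 0)"
proof -
  have *: "ip (hoeff K G) (hoeff J H) = (-1) ^ card J * (\<Sum>I\<in>Pow J. (-1) ^ card I * (if K \<subseteq> I then ip (hoeff K G) H else 0))"
    if "G \<in> L2_Omega" "H \<in> L2_Omega" "finite K" "finite J" for G H K J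
    using that ip_hoeff_left[of H "hoeff K G" J] hoeff_L2[of G K]
    by (simp add: ip_commute[of "hoeff J H"] ip_commute[of "cexp _ _"] ip_hoeff_cexp)
  have zero: "ip (hoeff K G) (hoeff J H) = 0"
    if "G \<in> L2_Omega" "H \<in> L2_Omega" "finite K" "finite J" "\<not> K \<subseteq> J" for G H K J
  proof -
    have "\<not> K \<subseteq> I" if "I \<in> Pow J" for I using that \<open>\<not> K \<subseteq> J\<close> by auto
    then show ?thesis using *[OF that(1-4)] by simp
  qed
  consider "K = J" | "\<not> K \<subseteq> J" | "\<not> J \<subseteq> K" by auto
  then show ?thesis
  proof cases
    case 1
    have "(\<Sum>I\<in>Pow J. (-1) ^ card I * (if K \<subseteq> I then ip (hoeff K G) H else 0))
        = (\<Sum>I\<in>{J}. (-1) ^ card I * (if K \<subseteq> I then ip (hoeff K G) H else 0))"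
      using J 1 by (intro sum.mono_neutral_right) auto
    then show ?thesis using *[OF assms] 1 by (simp add: power_mult_distrib[symmetric] mult.assoc[symmetric])
  next
    case 2 then show ?thesis using zero[OF assms] by auto
  next
    case 3 then show ?thesis using zero[OF H G J K] by (auto simp: ip_commute)
  qed
qed

text \<open>Moebius inversion over the subsets of \<open>A\<close>; it holds at every path and not
  merely almost everywhere.\<close>

lemma sum_hoeff:
  assumes "finite A"
  shows "(\<Sum>K\<in>Pow A. hoeff K G u) = cexp A G u"
  using inclusion_exclusion_symmetric[of "\<lambda>K. \<Sum>J\<in>Pow K. (-1) ^ card J * cexp J G u" "\<lambda>J. cexp J G u" A] assms
  by (simp add: hoeff_def)

lemma cexp_eq_sum_hoeff: "finite A \<Longrightarrow> cexp A G = (\<lambda>u. \<Sum>K\<in>Pow A. hoeff K G u)"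
  by (simp add: sum_hoeff)

lemma hoeff_empty: "hoeff {} G u = (\<integral>u. G u \<partial>path_law)"
  unfolding hoeff_def cexp_def mix_def by simp

text \<open>Invariance of \<open>S\<close> under changing all coordinates from \<open>n\<close> on
  says that \<open>S\<close> depends on the first \<open>n\<close> coordinates. Such sets contain an
  intersection-stable generator, and orthogonality to \<open>D\<close> passes to complements and
  disjoint unions, hence to all measurable sets.\<close>

lemma zero_if_orthogonal_to_cylinders:
  assumes D: "D \<in> L2_Omega"
    and orth: "\<And>S n. S \<in> sets path_law \<Longrightarrow> (\<And>u v. mix {..<n} u v \<in> S \<longleftrightarrow> u \<in> S) \<Longrightarrow> ip D (indicator S) = 0"
  shows "AE u in path_law. D u = 0"
proof -
  have [measurable]: "D \<in> borel_measurable path_law" using D by measurable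
  let ?G = "prod_algebra UNIV (\<lambda>_::nat. unif)"
  have P: "path_law = PiM UNIV (\<lambda>_. unif)" by (simp add: path_law_def)
  have sets_eq: "sets path_law = sigma_sets UNIV ?G"
    unfolding P sets_PiM by simp
  have indL2: "indicator S \<in> L2_Omega" if "S \<in> sets path_law" for S
    by (rule L2_bounded[of _ 1]) (use that in \<open>auto simp: indicator_def\<close>)
  have int: "integrable path_law (\<lambda>u. D u * indicator S u)" if "S \<in> sets path_law" for S
    by (rule L2_integrable_mult[OF D indL2[OF that]])
  have all: "ip D (indicator S) = 0" if "S \<in> sigma_sets UNIV ?G" for S
  proof (rule sigma_sets_induct_disjoint[OF Int_stable_prod_algebra _ that])
    show "?G \<subseteq> Pow UNIV" by simp
  next
    fix S assume S: "S \<in> ?G"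
    then obtain J E where JE: "S = prod_emb UNIV (\<lambda>_. unif) J (\<Pi>\<^sub>E j\<in>J. E j)" "finite J"
      by (auto simp: prod_algebra_def)
    then obtain n where n: "J \<subseteq> {..<n}" by (meson finite_nat_iff_bounded)
    have "S \<in> sets path_law" using S sets_eq by auto
    then show "ip D (indicator S) = 0"
      by (rule orth[of _ n]) (use n in \<open>auto simp: JE(1) prod_emb_def PiE_iff mix_def\<close>)
  next
    show "ip D (indicator {}) = 0" by (simp add: ip_def)
  next
    fix S assume S: "S \<in> sigma_sets UNIV ?G" and IH: "ip D (indicator S) = 0"
    have "ip D (indicator UNIV) = 0" by (rule orth[of _ 0]) (auto simp: sets.top[of path_law, simplified])
    then have total: "(\<integral>u. D u \<partial>path_law) = 0" by (simp add: ip_def)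
    have "ip D (indicator (UNIV - S)) = (\<integral>u. D u - D u * indicator S u \<partial>path_law)"
      unfolding ip_def by (intro Bochner_Integration.integral_cong) (auto simp: indicator_def)
    also have "\<dots> = 0 - ip D (indicator S)"
      using int[of S] S L2_integrable[OF D] by (subst Bochner_Integration.integral_diff) (auto simp: total ip_def sets_eq)
    finally show "ip D (indicator (UNIV - S)) = 0" using IH by simp
  next
    fix A :: "nat \<Rightarrow> _" assume disj: "disjoint_family A" and A: "range A \<subseteq> sigma_sets UNIV ?G"
      and IH: "\<And>i. ip D (indicator (A i)) = 0"
    have m: "A i \<in> sets path_law" for i using A by (auto simp: sets_eq)
    then have U: "\<Union>(range A) \<in> sets path_law" by auto
    have "ip D (indicator (\<Union>i. A i)) = (LINT u:(\<Union>i. A i)|path_law. D u)"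
      by (simp add: ip_def set_lebesgue_integral_def mult.commute)
    also have "\<dots> = (\<Sum>i. (LINT u:A i|path_law. D u))"
    proof (rule lebesgue_integral_countable_add)
      show "set_integrable path_law (\<Union>i. A i) D"
        using U by (intro integrable_imp_set_integrable L2_integrable D)
    qed (use disj m in \<open>auto simp: disjoint_family_on_def\<close>)
    also have "(\<lambda>i. (LINT u:A i|path_law. D u)) = (\<lambda>i. ip D (indicator (A i)))"
      by (simp add: ip_def set_lebesgue_integral_def mult.commute)
    finally show "ip D (indicator (\<Union>(range A))) = 0" using IH by simp
  qed
  \<comment> \<open>Testing against the set where \<open>s * D\<close> is positive; the signs 1 and
    -1 together give \<open>D = 0\<close>.\<close>
  have pos: "AE u in path_law. s * D u \<le> 0" for s
  proof -
    let ?S = "{u. s * D u > 0}"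
    have S: "?S \<in> sets path_law"
      using measurable_sets[of "\<lambda>u. s * D u" path_law borel "{0<..}"] by (simp add: vimage_def)
    then have "ip D (indicator ?S) = 0" using all sets_eq by auto
    then have "(\<integral>u. s * (D u * indicator ?S u) \<partial>path_law) = 0" by (simp add: ip_def)
    then have "AE u in path_law. s * (D u * indicator ?S u) = 0"
      using int[OF S] by (subst (asm) integral_nonneg_eq_0_iff_AE) (auto simp: indicator_def)
    then show ?thesis by eventually_elim (auto simp: indicator_def split: if_splits)
  qed
  from pos[of 1] pos[of "-1"] show ?thesis by eventually_elim auto
qed


section \<open>Convergence of the Hoeffding expansion and Parseval's identity\<close>

lemma ip_cexp_eq_sum_hoeff:
  assumes "G \<in> L2_Omega" "H \<in> L2_Omega" "finite A"
  shows "ip (cexp A G) H = (\<Sum>K\<in>Pow A. ip (hoeff K G) H)"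
  unfolding cexp_eq_sum_hoeff[OF assms(3)] by (rule ip_sum_left) (auto intro: hoeff_L2 assms)

lemma ip_hoeff_self:
  "G \<in> L2_Omega \<Longrightarrow> finite K \<Longrightarrow> ip (hoeff K G) (hoeff K G) = ip (hoeff K G) G"
  by (simp add: ip_hoeff_hoeff)

lemma ip_hoeff_nonneg: "G \<in> L2_Omega \<Longrightarrow> finite K \<Longrightarrow> 0 \<le> ip (hoeff K G) G"
  using ip_self_nonneg[of "hoeff K G"] by (simp add: ip_hoeff_self)

lemma cexp_contraction:
  assumes "G \<in> L2_Omega" shows "ip (cexp A G) G \<le> ip G G"
proof -
  have "0 \<le> sqdist (cexp A G) G" by (rule sqdist_nonneg)
  then show ?thesis using assms ip_cexp_cexp[OF assms assms, of A] by (simp add: sqdist_expand cexp_L2)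
qed

lemma sqdist_cexp:
  assumes "G \<in> L2_Omega" "A \<subseteq> B"
  shows "sqdist (cexp B G) (cexp A G) = ip (cexp B G) G - ip (cexp A G) G"
proof -
  have "B \<inter> A = A" using assms by auto
  then show ?thesis
    using assms by (simp add: sqdist_expand cexp_L2 ip_cexp_Int)
qed

text \<open>Martingale convergence in L2. The numbers \<open>ip (cexp {..<N} G) G\<close> increase
  and are bounded, and squared distances between the projections are their differences, so the
  sequence is Cauchy. Its limit has the same integrals as \<open>G\<close> over every set depending
  on finitely many coordinates.\<close>

lemma cexp_tendsto:
  assumes G: "G \<in> L2_Omega"
  shows "(\<lambda>N. sqdist (cexp {..<N} G) G) \<longlonglongrightarrow> 0"
proof -
  let ?E = "\<lambda>N. cexp {..<N} G"
  let ?e = "\<lambda>N. ip (?E N) G"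
  have mono: "?e N \<le> ?e M" if "N \<le> M" for N M
    using sqdist_cexp[OF G, of "{..<N}" "{..<M}"] sqdist_nonneg[of "?E M" "?E N"] that by simp
  have "convergent ?e"
    using mono cexp_contraction[OF G] by (intro Bseq_monoseq_convergent BseqI'[of _ "ip G G"])
      (auto simp: monoseq_def abs_le_iff intro: order_trans[OF _ ip_self_nonneg] simp: ip_cexp_cexp[OF G G] ip_self_nonneg)
  then have C: "Cauchy ?e" by (rule convergent_Cauchy)
  have "\<exists>N. \<forall>i\<ge>N. \<forall>j\<ge>N. sqdist (?E i) (?E j) < e" if e: "e > 0" for e
  proof -
    obtain N where N: "\<And>i j. i \<ge> N \<Longrightarrow> j \<ge> N \<Longrightarrow> \<bar>?e i - ?e j\<bar> < e"
      using CauchyD[OF C e] by (auto simp: real_norm_def)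
    have "sqdist (?E i) (?E j) < e" if "i \<ge> N" "j \<ge> N" for i j
    proof -
      have "sqdist (?E i) (?E j) = \<bar>?e i - ?e j\<bar>"
      proof (cases "j \<le> i")
        case True
        then show ?thesis using sqdist_cexp[OF G, of "{..<j}" "{..<i}"] mono[of j i] by auto
      next
        case False
        then show ?thesis using sqdist_cexp[OF G, of "{..<i}" "{..<j}"] mono[of i j] by (auto simp: sqdist_commute)
      qed
      then show ?thesis using N[OF that] by simp
    qed
    then show ?thesis by blast
  qed
  from L2_complete[OF cexp_L2[OF G] this] obtain Z where
    Z: "Z \<in> L2_Omega" and lim: "(\<lambda>N. sqdist (?E N) Z) \<longlonglongrightarrow> 0" by auto
  have "AE u in path_law. Z u - G u = 0"
  proof (rule zero_if_orthogonal_to_cylinders)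
    show "(\<lambda>u. Z u - G u) \<in> L2_Omega" by (intro L2_diff Z G)
    fix S n assume S: "S \<in> sets path_law" and cyl: "\<And>u v. mix {..<n} u v \<in> S \<longleftrightarrow> u \<in> S"
    let ?I = "indicator S :: _ \<Rightarrow> real"
    have I: "?I \<in> L2_Omega"
      by (rule L2_bounded[of _ 1]) (use S in \<open>auto simp: indicator_def\<close>)
    have "mix {..<N} u v \<in> S \<longleftrightarrow> u \<in> S" if "n \<le> N" for N u v
    proof -
      have "mix {..<n} (mix {..<N} u v) u = u" using that by (auto simp: mix_def)
      then show ?thesis using cyl by metis
    qed
    then have "cexp {..<N} ?I = ?I" if "n \<le> N" for N
      using that by (auto simp: cexp_def fun_eq_iff indicator_def)
    then have "ip (?E N) ?I = ip G ?I" if "n \<le> N" for N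
      using that by (simp add: ip_cexp[OF G I])
    then have "(\<lambda>N. ip (?E N) ?I) \<longlonglongrightarrow> ip G ?I"
      by (intro tendsto_eventually) (auto simp: eventually_sequentially)
    moreover have "(\<lambda>N. ip (?E N) ?I) \<longlonglongrightarrow> ip Z ?I"
      by (rule sqdist_tendsto_ip[OF cexp_L2[OF G] Z I lim])
    ultimately have "ip Z ?I = ip G ?I" by (rule LIMSEQ_unique[rotated])
    then show "ip (\<lambda>u. Z u - G u) ?I = 0" by (simp add: ip_diff_left Z G I)
  qed
  then have ae: "AE u in path_law. Z u = G u" by simp
  have "sqdist (?E N) Z = sqdist (?E N) G" for N
    unfolding sqdist_def ip_def
    by (rule integral_cong_AE) (use ae Z G cexp_L2[OF G] in \<open>auto elim!: eventually_mono\<close>)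
  then show ?thesis using lim by simp
qed

text \<open>Evaluates an unconditional sum over finite sets along the sequence of all subsets of
  \<open>{..<N}\<close>, for which the partial sums are conditional expectations.\<close>

lemma filterlim_Pow_lessThan:
  "filterlim (\<lambda>N::nat. Pow {..<N}) (finite_subsets_at_top {K. finite K}) sequentially"
  unfolding filterlim_finite_subsets_at_top
proof (intro allI impI)
  fix X :: "nat set set" assume X: "finite X \<and> X \<subseteq> {K. finite K}"
  then have "finite (\<Union>X)" by auto
  then obtain n where "\<Union>X \<subseteq> {..<n}" by (meson finite_nat_iff_bounded)
  then have "X \<subseteq> Pow {..<N}" if "N \<ge> n" for N using that by fastforce
  then show "\<forall>\<^sub>F N in sequentially. finite (Pow {..<N}) \<and> X \<subseteq> Pow {..<N} \<and> Pow {..<N} \<subseteq> {K. finite K}"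
    unfolding eventually_sequentially by (intro exI[of _ n]) (auto intro: finite_subset)
qed

lemma sum_hoeff_tendsto:
  assumes "G \<in> L2_Omega" "H \<in> L2_Omega"
  shows "(\<lambda>N. \<Sum>K\<in>Pow {..<N}. ip (hoeff K G) H) \<longlonglongrightarrow> ip G H"
  using sqdist_tendsto_ip[OF cexp_L2[OF assms(1)] assms cexp_tendsto[OF assms(1)]]
  by (simp add: ip_cexp_eq_sum_hoeff assms)

lemma Bessel:
  assumes G: "G \<in> L2_Omega" and X: "finite X" "X \<subseteq> {K. finite K}"
  shows "(\<Sum>K\<in>X. ip (hoeff K G) G) \<le> ip G G"
proof -
  have "finite (\<Union>X)" using X by auto
  then obtain n where "\<Union>X \<subseteq> {..<n}" by (meson finite_nat_iff_bounded)
  then have "(\<Sum>K\<in>X. ip (hoeff K G) G) \<le> (\<Sum>K\<in>Pow {..<n}. ip (hoeff K G) G)"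
    using finite_subset by (intro sum_mono2 ip_hoeff_nonneg G) fastforce+
  also have "\<dots> = ip (cexp {..<n} G) G" by (simp add: ip_cexp_eq_sum_hoeff G)
  also have "\<dots> \<le> ip G G" by (rule cexp_contraction[OF G])
  finally show ?thesis .
qed

lemma abs_ip_hoeff_le:
  assumes "G \<in> L2_Omega" "H \<in> L2_Omega" "finite K"
  shows "\<bar>ip (hoeff K G) H\<bar> \<le> ip (hoeff K G) G + ip (hoeff K H) H"
proof -
  have "ip (hoeff K G) H = ip (hoeff K G) (hoeff K H)" using assms by (simp add: ip_hoeff_hoeff)
  then show ?thesis
    using ip_le_half[OF hoeff_L2 hoeff_L2, of G H K K] assms ip_hoeff_nonneg[of G K] ip_hoeff_nonneg[of H K]
    by (simp add: ip_hoeff_self)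
qed

text \<open>Absolute summability comes from Bessel's inequality for both functionals; it is what
  later permits regrouping the sum by the elements of the sets \<open>K\<close>. The value is then
  found along the subsets of \<open>{..<N}\<close>.\<close>

lemma Parseval:
  assumes G: "G \<in> L2_Omega" and H: "H \<in> L2_Omega"
  shows "(\<lambda>K. norm (ip (hoeff K G) H)) summable_on {K. finite K}"
    and "((\<lambda>K. ip (hoeff K G) H) has_sum ip G H) {K. finite K}"
proof -
  show *: "(\<lambda>K. norm (ip (hoeff K G) H)) summable_on {K. finite K}"
  proof (rule nonneg_bdd_above_summable_on)
    show "bdd_above (sum (\<lambda>K. norm (ip (hoeff K G) H)) ` {X. X \<subseteq> {K. finite K} \<and> finite X})"
    proof (rule bdd_aboveI2)
      fix X assume X: "X \<in> {X. X \<subseteq> {K::nat set. finite K} \<and> finite X}"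
      have "(\<Sum>K\<in>X. norm (ip (hoeff K G) H)) \<le> (\<Sum>K\<in>X. ip (hoeff K G) G + ip (hoeff K H) H)"
        using X by (intro sum_mono) (auto intro!: abs_ip_hoeff_le G H)
      also have "\<dots> \<le> ip G G + ip H H"
        unfolding sum.distrib using X by (intro add_mono Bessel G H) auto
      finally show "(\<Sum>K\<in>X. norm (ip (hoeff K G) H)) \<le> ip G G + ip H H" .
    qed
  qed simp
  have s: "(\<lambda>K. ip (hoeff K G) H) summable_on {K. finite K}" using abs_summable_summable[OF *] .
  let ?I = "infsum (\<lambda>K. ip (hoeff K G) H) {K. finite K}"
  have hs: "((\<lambda>K. ip (hoeff K G) H) has_sum ?I) {K. finite K}" using s by simp
  then have "((\<lambda>N. \<Sum>K\<in>Pow {..<N}. ip (hoeff K G) H) \<longlongrightarrow> ?I) sequentially"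
    unfolding has_sum_def by (rule filterlim_compose) (rule filterlim_Pow_lessThan)
  then have "?I = ip G H" using sum_hoeff_tendsto[OF G H] by (rule LIMSEQ_unique)
  then show "((\<lambda>K. ip (hoeff K G) H) has_sum ip G H) {K. finite K}" using hs by simp
qed

section \<open>Decomposing the half line into cells\<close>

text \<open>
  Clamping to \<open>[-1,1]\<close> does not change anything almost surely, but makes the cell
  coordinates measurable maps into the half line.
\<close>

definition trim :: "real \<Rightarrow> real" where "trim x = max (-1) (min 1 x)"

lemma trim_eq: "\<bar>x\<bar> \<le> 1 \<Longrightarrow> trim x = x"
  unfolding trim_def by auto

lemma trim_bounds: "-1 \<le> trim x" "trim x \<le> 1"
  unfolding trim_def by auto

lemma measurable_trim [measurable]: "trim \<in> borel_measurable borel"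
  unfolding trim_def[abs_def] by measurable

lemma space_halfline: "space halfline = {0..}"
  unfolding halfline_def by (simp add: space_restrict_space)

lemma cell_point_measurable [measurable (raw)]:
  assumes [measurable]: "h \<in> borel_measurable N" "k \<in> measurable N (count_space UNIV)"
  shows "(\<lambda>x. 2 * real (k x) + 1 + trim (h x)) \<in> measurable N halfline"
  unfolding halfline_def
proof (rule measurable_restrict_space2)
  have "0 \<le> 2 * real (k x) + 1 + trim (h x)" for x using trim_bounds[of "h x"] by simp
  then show "(\<lambda>x. 2 * real (k x) + 1 + trim (h x)) \<in> space N \<rightarrow> {0..}" by auto
qed measurable

lemma AE_unif: "AE w in unif. \<bar>w\<bar> < 1"
proof -
  have "AE w in lborel. w \<noteq> 1 \<and> w \<noteq> -1"
    using AE_lborel_singleton[of 1] AE_lborel_singleton[of "-1"] by eventually_elim auto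
  then show ?thesis
    by (subst AE_uniform_measure) (auto simp: abs_less_iff elim!: eventually_mono)
qed

lemma nn_integral_unif:
  assumes [measurable]: "g \<in> borel_measurable borel"
  shows "2 * (\<integral>\<^sup>+w. g w \<partial>unif) = (\<integral>\<^sup>+w. g w * indicator {-1..1} w \<partial>lborel)"
  using ennreal_mult_divide_eq[of 2 "\<integral>\<^sup>+w. g w * indicator {-1..1} w \<partial>lborel"]
  by (subst nn_integral_uniform_measure) (simp_all add: ennreal_times_divide mult.commute)

lemma Union_cells: "(\<Union>k. {2 * real k..<2 * real k + 2}) = {0..}"
proof (intro set_eqI iffI)
  fix x :: real assume "x \<in> {0..}"
  then have "2 * real (nat \<lfloor>x / 2\<rfloor>) \<le> x \<and> x < 2 * real (nat \<lfloor>x / 2\<rfloor>) + 2"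
    by (simp add: of_nat_nat) linarith
  then show "x \<in> (\<Union>k. {2 * real k..<2 * real k + 2})" by auto
qed auto

lemma disjoint_cells: "disjoint_family (\<lambda>k. {2 * real k..<2 * real k + 2})"
  unfolding disjoint_family_on_def by (auto simp: not_less)

lemma indicator_cells:
  "(\<Sum>k. indicator {2 * real k..<2 * real k + 2} x) = (indicator {0..} x :: ennreal)"
  using suminf_indicator[OF disjoint_cells, of x] by (simp add: Union_cells)

text \<open>Half-open cells partition the half line, and on each of them Lebesgue measure is twice
  the law of the offset from the centre. The closed interval underlying \<open>unif\<close> differs
  by a null point.\<close>

lemma nn_integral_halfline:
  assumes g: "g \<in> borel_measurable halfline"
  shows "(\<integral>\<^sup>+x. g x \<partial>halfline) = (\<Sum>k. 2 * (\<integral>\<^sup>+w. g (2 * real k + 1 + trim w) \<partial>unif))"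
proof -
  let ?G = "\<lambda>x. g x * indicator {0..} x"
  have G [measurable]: "?G \<in> borel_measurable borel"
    using g unfolding halfline_def by (subst (asm) borel_measurable_restrict_space_iff_ennreal) auto
  have "(\<integral>\<^sup>+x. g x \<partial>halfline) = (\<integral>\<^sup>+x. ?G x \<partial>lborel)"
    unfolding halfline_def by (rule nn_integral_restrict_space) auto
  also have "\<dots> = (\<integral>\<^sup>+x. (\<Sum>k. ?G x * indicator {2 * real k..<2 * real k + 2} x) \<partial>lborel)"
    unfolding ennreal_suminf_cmult indicator_cells by (intro nn_integral_cong) (simp add: indicator_def)
  also have "\<dots> = (\<Sum>k. \<integral>\<^sup>+x. ?G x * indicator {2 * real k..<2 * real k + 2} x \<partial>lborel)"
    by (rule nn_integral_suminf, rule borel_measurable_times_ennreal) (use G in simp_all)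
  also have "(\<lambda>k. \<integral>\<^sup>+x. ?G x * indicator {2 * real k..<2 * real k + 2} x \<partial>lborel)
      = (\<lambda>k. 2 * (\<integral>\<^sup>+w. g (2 * real k + 1 + trim w) \<partial>unif))"
  proof
    fix k
    have m: "(\<lambda>w. g (2 * real k + 1 + trim w)) \<in> borel_measurable borel"
      by (rule measurable_compose[OF _ g]) measurable
    have "(\<integral>\<^sup>+x. ?G x * indicator {2 * real k..<2 * real k + 2} x \<partial>lborel)
       = (\<integral>\<^sup>+w. ?G (2 * real k + 1 + 1 * w) * indicator {2 * real k..<2 * real k + 2} (2 * real k + 1 + 1 * w) \<partial>lborel)"
      by (subst nn_integral_real_affine[where c=1 and t="2 * real k + 1"]) auto
    also have "\<dots> = (\<integral>\<^sup>+w. g (2 * real k + 1 + trim w) * indicator {-1..1} w \<partial>lborel)"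
    proof (rule nn_integral_cong_AE)
      show "AE w in lborel. ?G (2 * real k + 1 + 1 * w) * indicator {2 * real k..<2 * real k + 2} (2 * real k + 1 + 1 * w)
          = g (2 * real k + 1 + trim w) * indicator {-1..1} w"
        using AE_lborel_singleton[of 1] by eventually_elim (auto simp: indicator_def trim_def)
    qed
    also have "\<dots> = 2 * (\<integral>\<^sup>+w. g (2 * real k + 1 + trim w) \<partial>unif)"
      using m by (rule nn_integral_unif[symmetric])
    finally show "(\<integral>\<^sup>+x. ?G x * indicator {2 * real k..<2 * real k + 2} x \<partial>lborel)
      = 2 * (\<integral>\<^sup>+w. g (2 * real k + 1 + trim w) \<partial>unif)" .
  qed
  finally show ?thesis .
qed

lemma sigma_finite_halfline: "sigma_finite_measure halfline"
  unfolding halfline_def by (rule sigma_finite_measure_restrict_space) (auto intro: sigma_finite_lborel)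

interpretation halfline: product_sigma_finite "\<lambda>_::nat. halfline"
  by (simp add: product_sigma_finite_def sigma_finite_halfline)

section \<open>Lebesgue measure on powers of the half line in terms of cells and offsets\<close>

lemma measurable_fun_upd_path [measurable (raw)]:
  assumes [measurable]: "f \<in> measurable N path_law" "g \<in> borel_measurable N"
  shows "(\<lambda>x. (f x)(k := g x)) \<in> measurable N path_law"
  by (rule measurable_path_law) (simp add: fun_upd_def)

lemma distr_resample: "distr (unif \<Otimes>\<^sub>M path_law) path_law (\<lambda>(w, u). u(k := w)) = path_law"
  using distr_pair_PiM_eq_PiM[of UNIV "\<lambda>_. unif" k] unfolding path_law_def
  by (simp add: prob_space_unif insert_absorb)

lemma nn_integral_resample:
  assumes [measurable]: "K \<in> borel_measurable path_law"
  shows "(\<integral>\<^sup>+u. (\<integral>\<^sup>+w. K (u(k := w)) \<partial>unif) \<partial>path_law) = (\<integral>\<^sup>+u. K u \<partial>path_law)"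
proof -
  interpret pair_sigma_finite unif path_law ..
  have "(\<integral>\<^sup>+u. K u \<partial>path_law) = (\<integral>\<^sup>+u. K u \<partial>distr (unif \<Otimes>\<^sub>M path_law) path_law (\<lambda>(w, u). u(k := w)))"
    unfolding distr_resample ..
  also have "\<dots> = (\<integral>\<^sup>+x. K (case x of (w, u) \<Rightarrow> u(k := w)) \<partial>(unif \<Otimes>\<^sub>M path_law))"
    by (rule nn_integral_distr) measurable
  also have "\<dots> = (\<integral>\<^sup>+u. (\<integral>\<^sup>+w. K (u(k := w)) \<partial>unif) \<partial>path_law)"
    by (subst nn_integral_snd[symmetric]) auto
  finally show ?thesis ..
qed

text \<open>The offset at position \<open>i\<close> is coordinate \<open>i\<close> of
  \<open>v\<close>, not coordinate \<open>\<kappa> i\<close>. Two positions in the same cell thus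
  get independent offsets, as Lebesgue measure demands.\<close>

definition cell_point :: "nat set \<Rightarrow> (nat \<Rightarrow> nat) \<Rightarrow> (nat \<Rightarrow> real) \<Rightarrow> nat \<Rightarrow> real" where
  "cell_point I \<kappa> v = (\<lambda>i\<in>I. 2 * real (\<kappa> i) + 1 + trim (v i))"

abbreviation half_pow :: "nat set \<Rightarrow> (nat \<Rightarrow> real) measure" where
  "half_pow I \<equiv> PiM I (\<lambda>_. halfline)"

lemma measurable_half_pow_component:
  assumes "i \<in> I" shows "(\<lambda>x. x i) \<in> borel_measurable (half_pow I)"
proof -
  have "(\<lambda>x. x) \<in> borel_measurable halfline"
    unfolding halfline_def by (rule measurable_restrict_space1) simp
  from measurable_compose[OF measurable_component_singleton[OF assms] this] show ?thesis by simp
qed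

lemma measurable_cell_point [measurable (raw)]:
  assumes [measurable]: "h \<in> measurable N path_law"
  shows "(\<lambda>x. cell_point I \<kappa> (h x)) \<in> measurable N (half_pow I)"
  unfolding cell_point_def by measurable

lemma cell_point_upd:
  assumes "j \<notin> I"
  shows "(cell_point I \<kappa> v)(j := 2 * real k + 1 + trim w) = cell_point (insert j I) (\<kappa>(j := k)) (v(j := w))"
  using assms unfolding cell_point_def by (auto simp: fun_eq_iff restrict_def)

text \<open>Induction on the index set: the new variable is split into a cell and a uniform offset,
  and a pair of a map on \<open>I\<close> and a new cell is the same as a map on
  \<open>insert j I\<close>.\<close>

lemma nn_integral_half_pow:
  assumes "finite I" "g \<in> borel_measurable (half_pow I)"
  shows "(\<integral>\<^sup>+x. g x \<partial>half_pow I) =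
    2 ^ card I * (\<integral>\<^sup>+\<kappa>. (\<integral>\<^sup>+v. g (cell_point I \<kappa> v) \<partial>path_law) \<partial>count_space (I \<rightarrow>\<^sub>E UNIV))"
  using assms
proof (induction I arbitrary: g rule: finite_induct)
  case empty
  have "cell_point {} \<kappa> v = (\<lambda>_. undefined)" for \<kappa> v by (simp add: cell_point_def restrict_def)
  then show ?case
    by (simp add: PiM_empty nn_integral_count_space_finite P.emeasure_space_1[simplified])
next
  case (insert j I)
  note [measurable] = insert.prems
  let ?Q = "\<lambda>\<kappa>. \<integral>\<^sup>+v. g (cell_point (insert j I) \<kappa> v) \<partial>path_law"
  have upd [measurable]: "(\<lambda>(x, y). x(j := y)) \<in> measurable (half_pow I \<Otimes>\<^sub>M halfline) (half_pow (insert j I))"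
    by (rule measurable_add_dim)
  have g2 [measurable]: "(\<lambda>(x, y). g (x(j := y))) \<in> borel_measurable (half_pow I \<Otimes>\<^sub>M halfline)"
    using measurable_compose[OF upd insert.prems] by (simp add: split_beta')
  have sec: "(\<lambda>y. g (x(j := y))) \<in> borel_measurable halfline" if "x \<in> space (half_pow I)" for x
    using measurable_Pair2[OF g2 that] by simp
  have cnt: "countable (I \<rightarrow>\<^sub>E (UNIV :: nat set))" "countable (insert j I \<rightarrow>\<^sub>E (UNIV :: nat set))"
    using insert.hyps by (auto intro!: countable_PiE)
  let ?g' = "\<lambda>x. \<Sum>k. 2 * (\<integral>\<^sup>+w. g (x(j := 2 * real k + 1 + trim w)) \<partial>unif)"
  have g'k: "(\<lambda>x. \<integral>\<^sup>+w. g (x(j := 2 * real k + 1 + trim w)) \<partial>unif) \<in> borel_measurable (half_pow I)" for k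
  proof -
    have 1: "(\<lambda>(x, w). (x, 2 * real k + 1 + trim w)) \<in> measurable (half_pow I \<Otimes>\<^sub>M unif) (half_pow I \<Otimes>\<^sub>M halfline)"
      by measurable
    have "(\<lambda>(x, w). g (x(j := 2 * real k + 1 + trim w))) \<in> borel_measurable (half_pow I \<Otimes>\<^sub>M unif)"
      using measurable_compose[OF 1 g2] by (simp add: split_beta')
    then show ?thesis by measurable
  qed
  have "(\<integral>\<^sup>+x. g x \<partial>half_pow (insert j I)) = (\<integral>\<^sup>+x. (\<integral>\<^sup>+y. g (x(j := y)) \<partial>halfline) \<partial>half_pow I)"
    by (rule halfline.product_nn_integral_insert) (use insert in auto)
  also have "\<dots> = (\<integral>\<^sup>+x. ?g' x \<partial>half_pow I)"
    by (intro nn_integral_cong nn_integral_halfline sec)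
  also have "\<dots> = 2 ^ card I * (\<integral>\<^sup>+\<kappa>. (\<integral>\<^sup>+v. ?g' (cell_point I \<kappa> v) \<partial>path_law) \<partial>count_space (I \<rightarrow>\<^sub>E UNIV))"
    by (rule insert.IH) (use g'k in measurable)
  also have "(\<lambda>\<kappa>. \<integral>\<^sup>+v. ?g' (cell_point I \<kappa> v) \<partial>path_law) = (\<lambda>\<kappa>. 2 * (\<integral>\<^sup>+k. ?Q (\<kappa>(j := k)) \<partial>count_space UNIV))"
  proof
    fix \<kappa>
    have "(\<integral>\<^sup>+v. ?g' (cell_point I \<kappa> v) \<partial>path_law)
        = (\<integral>\<^sup>+v. (\<Sum>k. 2 * (\<integral>\<^sup>+w. g (cell_point (insert j I) (\<kappa>(j := k)) (v(j := w))) \<partial>unif)) \<partial>path_law)"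
      by (simp only: cell_point_upd[OF insert.hyps(2)])
    also have "\<dots> = (\<Sum>k. 2 * (\<integral>\<^sup>+v. (\<integral>\<^sup>+w. g (cell_point (insert j I) (\<kappa>(j := k)) (v(j := w))) \<partial>unif) \<partial>path_law))"
      by (subst nn_integral_suminf) (auto simp: nn_integral_cmult)
    \<comment> \<open>The fresh offset \<open>w\<close> is absorbed as coordinate \<open>j\<close>
      of the path: resampling one coordinate preserves the law.\<close>
    also have "\<dots> = (\<Sum>k. 2 * ?Q (\<kappa>(j := k)))"
      by (subst nn_integral_resample[of "\<lambda>v. g (cell_point (insert j I) (\<kappa>(j := _)) v)"]) auto
    finally show "(\<integral>\<^sup>+v. ?g' (cell_point I \<kappa> v) \<partial>path_law) = 2 * (\<integral>\<^sup>+k. ?Q (\<kappa>(j := k)) \<partial>count_space UNIV)"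
      by (simp add: nn_integral_count_space_nat)
  qed
  also have "(\<integral>\<^sup>+\<kappa>. 2 * (\<integral>\<^sup>+k. ?Q (\<kappa>(j := k)) \<partial>count_space UNIV) \<partial>count_space (I \<rightarrow>\<^sub>E UNIV))
      = 2 * (\<integral>\<^sup>+\<kappa>. (\<integral>\<^sup>+k. ?Q (\<kappa>(j := k)) \<partial>count_space UNIV) \<partial>count_space (I \<rightarrow>\<^sub>E UNIV))"
    by (rule nn_integral_cmult) simp
  also have "(\<integral>\<^sup>+\<kappa>. (\<integral>\<^sup>+k. ?Q (\<kappa>(j := k)) \<partial>count_space UNIV) \<partial>count_space (I \<rightarrow>\<^sub>E UNIV))
      = (\<integral>\<^sup>+x. ?Q ((fst x)(j := snd x)) \<partial>(count_space (I \<rightarrow>\<^sub>E UNIV) \<Otimes>\<^sub>M count_space (UNIV :: nat set)))"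
  proof -
    interpret C: sigma_finite_measure "count_space (UNIV :: nat set)"
      by (rule sigma_finite_measure_count_space)
    show ?thesis using cnt
      by (subst C.nn_integral_fst[symmetric]) (auto simp: pair_measure_countable)
  qed
  also have "\<dots> = (\<integral>\<^sup>+x. ?Q ((fst x)(j := snd x)) \<partial>count_space ((I \<rightarrow>\<^sub>E UNIV) \<times> (UNIV :: nat set)))"
    using cnt by (simp add: pair_measure_countable)
  also have "\<dots> = (\<integral>\<^sup>+\<kappa>. ?Q \<kappa> \<partial>count_space (insert j I \<rightarrow>\<^sub>E UNIV))"
  proof (rule nn_integral_bij_count_space)
    show "bij_betw (\<lambda>x. (fst x)(j := snd x)) ((I \<rightarrow>\<^sub>E UNIV) \<times> (UNIV :: nat set)) (insert j I \<rightarrow>\<^sub>E UNIV)"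
    proof (rule bij_betw_byWitness[where f'="\<lambda>\<kappa>. (restrict \<kappa> I, \<kappa> j)"])
      show "\<forall>x\<in>(I \<rightarrow>\<^sub>E UNIV) \<times> UNIV. (restrict ((fst x)(j := snd x)) I, ((fst x)(j := snd x)) j) = x"
        using insert.hyps by (auto simp: fun_eq_iff restrict_def PiE_iff extensional_def)
      show "\<forall>\<kappa>\<in>insert j I \<rightarrow>\<^sub>E UNIV. (fst (restrict \<kappa> I, \<kappa> j))(j := snd (restrict \<kappa> I, \<kappa> j)) = \<kappa>"
        by (auto simp: fun_eq_iff restrict_def PiE_iff extensional_def)
      show "(\<lambda>x. (fst x)(j := snd x)) ` ((I \<rightarrow>\<^sub>E UNIV) \<times> (UNIV :: nat set)) \<subseteq> (insert j I \<rightarrow>\<^sub>E UNIV)"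
        by (intro image_subsetI PiE_I) (auto dest: PiE_arb)
      show "(\<lambda>\<kappa>. (restrict \<kappa> I, \<kappa> j)) ` (insert j I \<rightarrow>\<^sub>E (UNIV :: nat set)) \<subseteq> (I \<rightarrow>\<^sub>E UNIV) \<times> UNIV"
        by (intro image_subsetI) simp
    qed
  qed
  finally show ?case using insert.hyps by (simp add: mult_ac)
qed


text \<open>The formula for nonnegative integrands, applied to indicators, identifies the measures
  themselves, so that integrals of signed functions can be transported as well.\<close>

lemma half_pow_eq:
  assumes I: "finite I"
  shows "half_pow I = density (distr (count_space (I \<rightarrow>\<^sub>E UNIV) \<Otimes>\<^sub>M path_law) (half_pow I)
      (\<lambda>(\<kappa>, v). cell_point I \<kappa> v)) (\<lambda>_. ennreal (2 ^ card I))"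
    and "(\<lambda>(\<kappa>, v). cell_point I \<kappa> v) \<in> measurable (count_space (I \<rightarrow>\<^sub>E UNIV) \<Otimes>\<^sub>M path_law) (half_pow I)"
proof -
  show m: "(\<lambda>(\<kappa>, v). cell_point I \<kappa> v) \<in> measurable (count_space (I \<rightarrow>\<^sub>E UNIV) \<Otimes>\<^sub>M path_law) (half_pow I)"
    using I by (intro measurable_pair_measure_countable1 countable_PiE) auto
  show "half_pow I = density (distr (count_space (I \<rightarrow>\<^sub>E UNIV) \<Otimes>\<^sub>M path_law) (half_pow I)
      (\<lambda>(\<kappa>, v). cell_point I \<kappa> v)) (\<lambda>_. ennreal (2 ^ card I))" (is "_ = density ?D _")
  proof (rule measure_eqI)
    fix A assume A: "A \<in> sets (half_pow I)"
    have "emeasure (half_pow I) A = (\<integral>\<^sup>+x. indicator A x \<partial>half_pow I)"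
      using A by simp
    also have "\<dots> = 2 ^ card I * (\<integral>\<^sup>+\<kappa>. (\<integral>\<^sup>+v. indicator A (cell_point I \<kappa> v) \<partial>path_law) \<partial>count_space (I \<rightarrow>\<^sub>E UNIV))"
      by (rule nn_integral_half_pow[OF I]) (use A in measurable)
    also have "(\<integral>\<^sup>+\<kappa>. (\<integral>\<^sup>+v. indicator A (cell_point I \<kappa> v) \<partial>path_law) \<partial>count_space (I \<rightarrow>\<^sub>E UNIV))
        = (\<integral>\<^sup>+x. indicator A (case x of (\<kappa>, v) \<Rightarrow> cell_point I \<kappa> v) \<partial>(count_space (I \<rightarrow>\<^sub>E UNIV) \<Otimes>\<^sub>M path_law))"
      using measurable_compose[OF m, of "indicator A" borel] A
      by (subst P.nn_integral_fst[symmetric]) auto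
    also have "\<dots> = (\<integral>\<^sup>+x. indicator A x \<partial>?D)"
      by (rule nn_integral_distr[OF m, symmetric]) (use A in simp)
    also have "\<dots> = emeasure ?D A" using A by simp
    finally show "emeasure (half_pow I) A = emeasure (density ?D (\<lambda>_. ennreal (2 ^ card I))) A"
      using A by (simp add: emeasure_density nn_integral_cmult_indicator ennreal_power[symmetric])
  qed simp
qed

lemma integral_half_pow:
  fixes g :: "(nat \<Rightarrow> real) \<Rightarrow> real"
  assumes I: "finite I" and g: "integrable (half_pow I) g"
  shows "((\<lambda>\<kappa>. \<integral>v. g (cell_point I \<kappa> v) \<partial>path_law) has_sum ((\<integral>x. g x \<partial>half_pow I) / 2 ^ card I)) (I \<rightarrow>\<^sub>E UNIV)"
proof -
  let ?C = "count_space (I \<rightarrow>\<^sub>E (UNIV :: nat set))"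
  let ?T = "\<lambda>(\<kappa>, v). cell_point I \<kappa> v"
  let ?D = "distr (?C \<Otimes>\<^sub>M path_law) (half_pow I) ?T"
  note T = half_pow_eq(2)[OF I] and eq = half_pow_eq(1)[OF I]
  have gm [measurable]: "g \<in> borel_measurable (half_pow I)" using g by auto
  have cnt: "countable (I \<rightarrow>\<^sub>E (UNIV :: nat set))" using I by (auto intro!: countable_PiE)
  interpret C: sigma_finite_measure ?C by (rule sigma_finite_measure_count_space_countable[OF cnt])
  interpret CP: pair_sigma_finite ?C path_law ..
  have gD: "g \<in> borel_measurable ?D" by simp
  have "integrable (density ?D (\<lambda>_. ennreal (2 ^ card I))) g" using g eq by simp
  then have "integrable ?D (\<lambda>x. 2 ^ card I *\<^sub>R g x)"
    by (subst (asm) integrable_density[OF gD]) auto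
  then have "integrable ?D g" by simp
  then have int: "integrable (?C \<Otimes>\<^sub>M path_law) (\<lambda>x. g (?T x))"
    by (subst (asm) integrable_distr_eq[OF T gm])
  have "(\<integral>x. g x \<partial>half_pow I) = (\<integral>x. g x \<partial>density ?D (\<lambda>_. ennreal (2 ^ card I)))"
    using eq by simp
  also have "\<dots> = 2 ^ card I * (\<integral>x. g x \<partial>?D)"
    by (subst integral_density[OF gD]) auto
  also have "(\<integral>x. g x \<partial>?D) = (\<integral>x. g (?T x) \<partial>(?C \<Otimes>\<^sub>M path_law))"
    by (rule integral_distr[OF T gm])
  also have "\<dots> = (\<integral>\<kappa>. (\<integral>v. g (cell_point I \<kappa> v) \<partial>path_law) \<partial>?C)"
    using CP.integral_fst'[OF int] by simp
  finally have e: "(\<integral>x. g x \<partial>half_pow I) / 2 ^ card I = (\<integral>\<kappa>. (\<integral>v. g (cell_point I \<kappa> v) \<partial>path_law) \<partial>?C)"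
    by simp
  have "integrable ?C (\<lambda>\<kappa>. \<integral>v. g (cell_point I \<kappa> v) \<partial>path_law)"
    using CP.integrable_fst'[OF int] by simp
  then have "Infinite_Set_Sum.abs_summable_on (\<lambda>\<kappa>. \<integral>v. g (cell_point I \<kappa> v) \<partial>path_law) (I \<rightarrow>\<^sub>E UNIV)"
    by (simp add: Infinite_Set_Sum.abs_summable_on_def)
  then have abs: "Infinite_Sum.abs_summable_on (\<lambda>\<kappa>. \<integral>v. g (cell_point I \<kappa> v) \<partial>path_law) (I \<rightarrow>\<^sub>E UNIV)"
    by (simp only: abs_summable_equivalent)
  have "(\<integral>\<kappa>. (\<integral>v. g (cell_point I \<kappa> v) \<partial>path_law) \<partial>?C) = infsum (\<lambda>\<kappa>. \<integral>v. g (cell_point I \<kappa> v) \<partial>path_law) (I \<rightarrow>\<^sub>E UNIV)"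
    using infsetsum_infsum[OF abs[unfolded abs_summable_equivalent]] by (simp add: infsetsum_def)
  then show ?thesis
    unfolding e using has_sum_infsum[OF abs_summable_summable[OF abs]] by simp
qed

text \<open>Distinct coordinates of the path are again independent and uniform. This is the passage
  from offsets indexed by position to offsets read at the cell a position belongs to.\<close>

lemma distr_reindex:
  assumes "inj_on l I"
  shows "distr path_law (PiM I (\<lambda>_. borel)) (\<lambda>v. \<lambda>i\<in>I. v (l i)) = distr path_law (PiM I (\<lambda>_. borel)) (\<lambda>v. \<lambda>i\<in>I. v i)"
proof -
  have *: "distr path_law (PiM I (\<lambda>_. borel)) (\<lambda>v. \<lambda>i\<in>I. v (l i)) = PiM I (\<lambda>_. unif)" if "inj_on l I" for l :: "nat \<Rightarrow> nat"
  proof -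
    have "distr path_law (PiM I (\<lambda>_. borel)) (\<lambda>v. \<lambda>i\<in>I. v (l i)) = distr path_law (PiM I (\<lambda>_. unif)) (\<lambda>v. \<lambda>i\<in>I. v (l i))"
      by (rule distr_cong) (auto intro!: sets_PiM_cong)
    also have "\<dots> = PiM I (\<lambda>_. unif)"
      unfolding path_law_def by (rule distr_PiM_reindex) (auto simp: prob_space_unif that)
    finally show ?thesis .
  qed
  show ?thesis using *[OF assms] *[of id] by simp
qed

lemma measurable_proj_path: "(\<lambda>v. \<lambda>i\<in>I. v (l i)) \<in> measurable path_law (PiM I (\<lambda>_. borel))"
  by measurable

lemma nn_integral_reindex:
  assumes "inj_on l I" "h \<in> borel_measurable (PiM I (\<lambda>_. borel))"
  shows "(\<integral>\<^sup>+v. h (\<lambda>i\<in>I. v (l i)) \<partial>path_law) = (\<integral>\<^sup>+v. h (\<lambda>i\<in>I. v i) \<partial>path_law)"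
  using nn_integral_distr[OF measurable_proj_path[where I=I and l=l], of h] assms(2)
    nn_integral_distr[OF measurable_proj_path[where I=I and l="\<lambda>i. i"], of h] distr_reindex[OF assms(1)]
  by simp

lemma integral_reindex:
  fixes h :: "(nat \<Rightarrow> real) \<Rightarrow> real"
  assumes "inj_on l I" "h \<in> borel_measurable (PiM I (\<lambda>_. borel))"
  shows "(\<integral>v. h (\<lambda>i\<in>I. v (l i)) \<partial>path_law) = (\<integral>v. h (\<lambda>i\<in>I. v i) \<partial>path_law)"
  using integral_distr[OF measurable_proj_path[where I=I and l=l] assms(2)]
    integral_distr[OF measurable_proj_path[where I=I and l="\<lambda>i. i"] assms(2)] distr_reindex[OF assms(1)]
  by simp

section \<open>Kernels at the random points of a path\<close>

definition inj_maps :: "nat \<Rightarrow> (nat \<Rightarrow> nat) set" where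
  "inj_maps n = {\<kappa> \<in> {..<n} \<rightarrow>\<^sub>E UNIV. inj_on \<kappa> {..<n}}"

lemma countable_inj_maps: "countable (inj_maps n)"
  unfolding inj_maps_def by (rule countable_subset[OF _ countable_PiE[of "{..<n}" "\<lambda>_. UNIV :: nat set"]]) auto

text \<open>The kernel at the random points of the cells \<open>\<kappa> i\<close>: up to trimming,
  the summand with r = n in the explicit formula for the multiple integral.\<close>

definition kfun :: "nat \<Rightarrow> ((nat \<Rightarrow> real) \<Rightarrow> real) \<Rightarrow> (nat \<Rightarrow> nat) \<Rightarrow> (nat \<Rightarrow> real) \<Rightarrow> real" where
  "kfun n f \<kappa> u = f (\<lambda>i\<in>{..<n}. 2 * real (\<kappa> i) + 1 + trim (u (\<kappa> i)))"

lemma AE_path: "AE u in path_law. \<forall>i. \<bar>u i\<bar> < 1"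
proof -
  have "AE u in path_law. \<bar>u i\<bar> < 1" for i
    unfolding path_law_def by (rule path.AE_component) (auto intro: AE_unif)
  then show ?thesis by (simp add: AE_all_countable)
qed

text \<open>Strict inequalities determine the cell of each coordinate. On the boundary two
  neighbouring closed cells overlap, and a point with a repeated \<open>\<kappa> i\<close> could
  still belong to \<open>Delta n\<close>.\<close>

lemma not_Delta:
  assumes "x \<in> {..<n} \<rightarrow>\<^sub>E UNIV" "\<not> inj_on \<kappa> {..<n}" "\<And>i. i < n \<Longrightarrow> \<bar>x i - (2 * real (\<kappa> i) + 1)\<bar> < 1"
  shows "x \<notin> Delta n"
proof
  assume "x \<in> Delta n"
  then obtain k where k: "inj_on k {..<n}" "\<And>i. i < n \<Longrightarrow> x i \<in> {2 * real (k i)..2 * real (k i) + 2}"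
    unfolding Delta_def by (auto simp: PiE_iff)
  have "k i = \<kappa> i" if "i < n" for i
  proof -
    have "2 * real (k i) < 2 * real (\<kappa> i) + 2" "2 * real (\<kappa> i) < 2 * real (k i) + 2"
      using k(2)[OF that] assms(3)[OF that] by auto
    then show ?thesis by linarith
  qed
  then have "inj_on \<kappa> {..<n}" using k(1) by (metis inj_on_cong lessThan_iff)
  then show False using assms(2) by simp
qed

lemma L2_hat_measurable: "f \<in> L2_hat n \<Longrightarrow> f \<in> borel_measurable (half_pow {..<n})"
  unfolding L2_hat_def Rplus_pow_def by simp

lemma measurable_kfun':
  assumes "f \<in> borel_measurable (half_pow {..<n})"
  shows "kfun n f \<kappa> \<in> borel_measurable path_law"
proof -
  have "(\<lambda>u. \<lambda>i\<in>{..<n}. 2 * real (\<kappa> i) + 1 + trim (u (\<kappa> i))) \<in> measurable path_law (half_pow {..<n})"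
    by measurable
  from measurable_compose[OF this assms] show ?thesis
    unfolding kfun_def[abs_def] .
qed

lemma measurable_kfun [measurable]: "f \<in> L2_hat n \<Longrightarrow> kfun n f \<kappa> \<in> borel_measurable path_law"
  by (intro measurable_kfun' L2_hat_measurable)

lemma L2_hat_off_Delta:
  assumes "f \<in> L2_hat n" "x \<in> space (half_pow {..<n})" "x \<notin> Delta n"
  shows "f x = 0"
  using assms unfolding L2_hat_def Rplus_pow_def by auto

text \<open>Choices of cells with a repetition put almost every point off \<open>Delta n\<close>,
  where \<open>q (f x) = q 0 = 0\<close>. For distinct cells the offsets may be reread at the
  coordinates \<open>\<kappa> i\<close>. Membership in \<open>L2_hat n\<close> is not presupposed
  because this formula serves to establish it for \<open>chaos_kernel\<close>.\<close>

lemma nn_integral_kernel':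
  assumes fm [measurable]: "f \<in> borel_measurable (half_pow {..<n})"
    and off: "\<And>x. x \<in> space (half_pow {..<n}) \<Longrightarrow> x \<notin> Delta n \<Longrightarrow> f x = 0"
    and q [measurable]: "q \<in> borel_measurable borel" and q0: "q 0 = (0 :: ennreal)"
  shows "(\<integral>\<^sup>+x. q (f x) \<partial>Rplus_pow n) = 2 ^ n * (\<integral>\<^sup>+\<kappa>. (\<integral>\<^sup>+u. q (kfun n f \<kappa> u) \<partial>path_law) \<partial>count_space (inj_maps n))"
proof -
  let ?Q = "\<lambda>\<kappa>. \<integral>\<^sup>+v. q (f (cell_point {..<n} \<kappa> v)) \<partial>path_law"
  have zero: "?Q \<kappa> = 0" if "\<not> inj_on \<kappa> {..<n}" for \<kappa>
  proof -
    have "AE v in path_law. q (f (cell_point {..<n} \<kappa> v)) = 0"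
      using AE_path
    proof eventually_elim
      fix v :: "nat \<Rightarrow> real" assume v: "\<forall>i. \<bar>v i\<bar> < 1"
      have "cell_point {..<n} \<kappa> v \<in> space (half_pow {..<n})"
        using measurable_space[OF measurable_cell_point[of "\<lambda>x. x" path_law "{..<n}" \<kappa>], of v] by simp
      moreover have "cell_point {..<n} \<kappa> v \<notin> Delta n"
        using v by (intro not_Delta[OF _ that]) (auto simp: cell_point_def trim_eq less_imp_le)
      ultimately show "q (f (cell_point {..<n} \<kappa> v)) = 0"
        using off q0 by simp
    qed
    then show ?thesis by (subst nn_integral_0_iff_AE) auto
  qed
  have inj: "?Q \<kappa> = (\<integral>\<^sup>+u. q (kfun n f \<kappa> u) \<partial>path_law)" if "inj_on \<kappa> {..<n}" for \<kappa>
  proof -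
    let ?h = "\<lambda>y. q (f (\<lambda>i\<in>{..<n}. 2 * real (\<kappa> i) + 1 + trim (y i)))"
    have "(\<lambda>y. \<lambda>i\<in>{..<n}. 2 * real (\<kappa> i) + 1 + trim (y i)) \<in> measurable (PiM {..<n} (\<lambda>_. borel)) (half_pow {..<n})"
      by measurable
    from measurable_compose[OF measurable_compose[OF this fm] q]
    have "?h \<in> borel_measurable (PiM {..<n} (\<lambda>_. borel))" .
    from nn_integral_reindex[OF that this] show ?thesis
      by (simp add: kfun_def cell_point_def cong: restrict_cong)
  qed
  have "(\<integral>\<^sup>+x. q (f x) \<partial>Rplus_pow n) = 2 ^ n * (\<integral>\<^sup>+\<kappa>. ?Q \<kappa> \<partial>count_space ({..<n} \<rightarrow>\<^sub>E UNIV))"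
    unfolding Rplus_pow_def using nn_integral_half_pow[of "{..<n}" "\<lambda>x. q (f x)"] by simp
  also have "(\<integral>\<^sup>+\<kappa>. ?Q \<kappa> \<partial>count_space ({..<n} \<rightarrow>\<^sub>E UNIV)) = (\<integral>\<^sup>+\<kappa>. ?Q \<kappa> \<partial>count_space (inj_maps n))"
    by (rule nn_integral_count_space_eq) (auto simp: inj_maps_def zero)
  also have "\<dots> = (\<integral>\<^sup>+\<kappa>. (\<integral>\<^sup>+u. q (kfun n f \<kappa> u) \<partial>path_law) \<partial>count_space (inj_maps n))"
    by (rule nn_integral_cong, rule inj) (simp add: inj_maps_def)
  finally show ?thesis .
qed


lemma nn_integral_kernel:
  assumes f: "f \<in> L2_hat n" and "q \<in> borel_measurable borel" and "q 0 = (0 :: ennreal)"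
  shows "(\<integral>\<^sup>+x. q (f x) \<partial>Rplus_pow n) = 2 ^ n * (\<integral>\<^sup>+\<kappa>. (\<integral>\<^sup>+u. q (kfun n f \<kappa> u) \<partial>path_law) \<partial>count_space (inj_maps n))"
  using nn_integral_kernel'[OF L2_hat_measurable[OF f] L2_hat_off_Delta[OF f] assms(2,3)] .

section \<open>Multiple integrals of integrable kernels\<close>

lemma has_sum_finite_sum:
  fixes f :: "'i \<Rightarrow> 'b \<Rightarrow> real"
  assumes "finite T" "\<And>i. i \<in> T \<Longrightarrow> (f i has_sum s i) A"
  shows "((\<lambda>x. \<Sum>i\<in>T. f i x) has_sum (\<Sum>i\<in>T. s i)) A"
  using assms by (induction T rule: finite_induct) (auto intro!: has_sum_add)

lemma summable_on_if_nn_integral_count_space: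
  fixes W :: "'b \<Rightarrow> real"
  assumes "(\<integral>\<^sup>+\<kappa>. ennreal \<bar>W \<kappa>\<bar> \<partial>count_space A) < \<infinity>"
  shows "(\<lambda>\<kappa>. norm (W \<kappa>)) summable_on A" and "W summable_on A"
proof -
  have "integrable (count_space A) W"
    by (rule integrableI_bounded) (use assms in auto)
  then have "Infinite_Set_Sum.abs_summable_on W A"
    by (simp add: Infinite_Set_Sum.abs_summable_on_def)
  then show *: "(\<lambda>\<kappa>. norm (W \<kappa>)) summable_on A"
    using abs_summable_equivalent by blast
  show "W summable_on A" by (rule abs_summable_summable[OF *])
qed

section \<open>Fixing the first arguments of a kernel and integrating over the others\<close>

definition join :: "nat \<Rightarrow> nat \<Rightarrow> (nat \<Rightarrow> nat) \<Rightarrow> (nat \<Rightarrow> nat) \<Rightarrow> nat \<Rightarrow> nat" where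
  "join n r k l = (\<lambda>i\<in>{..<n}. if i < r then k i else l i)"

text \<open>The choices of cells for the integration variables that avoid each other and the cells
  already occupied by \<open>k\<close>; all other choices integrate to 0 because kernels vanish off
  the diagonal-free region \<open>Delta n\<close>.\<close>

definition completions :: "nat \<Rightarrow> nat \<Rightarrow> (nat \<Rightarrow> nat) \<Rightarrow> (nat \<Rightarrow> nat) set" where
  "completions n r k = {l \<in> {r..<n} \<rightarrow>\<^sub>E UNIV. inj_on (join n r k l) {..<n}}"

lemma join_inj_maps: "l \<in> completions n r k \<Longrightarrow> join n r k l \<in> inj_maps n"
  unfolding completions_def inj_maps_def by (simp add: join_def[of n r k l])

lemma bij_betw_join:
  assumes "r \<le> n"
  shows "bij_betw (\<lambda>(k, l). join n r k l) (Sigma (inj_maps r) (completions n r)) (inj_maps n)"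
proof (rule bij_betw_byWitness[where f'="\<lambda>\<kappa>. (restrict \<kappa> {..<r}, restrict \<kappa> {r..<n})"])
  show "\<forall>x\<in>Sigma (inj_maps r) (completions n r).
      (restrict (case x of (k, l) \<Rightarrow> join n r k l) {..<r}, restrict (case x of (k, l) \<Rightarrow> join n r k l) {r..<n}) = x"
  proof (intro ballI, elim SigmaE)
    fix x k l assume k: "k \<in> inj_maps r" and l: "l \<in> completions n r k" and x: "x = (k, l)"
    have "restrict (join n r k l) {..<r} i = k i" for i
      using k assms PiE_arb[of k "{..<r}" "\<lambda>_. UNIV" i]
      by (cases "i < r") (simp_all add: join_def inj_maps_def)
    moreover have "restrict (join n r k l) {r..<n} i = l i" for i
      using l assms PiE_arb[of l "{r..<n}" "\<lambda>_. UNIV" i]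
      by (cases "i \<in> {r..<n}") (simp_all add: join_def completions_def)
    ultimately show "(restrict (case x of (k, l) \<Rightarrow> join n r k l) {..<r}, restrict (case x of (k, l) \<Rightarrow> join n r k l) {r..<n}) = x"
      unfolding x by auto
  qed
  have join_restrict: "join n r (restrict \<kappa> {..<r}) (restrict \<kappa> {r..<n}) = \<kappa>" if "\<kappa> \<in> inj_maps n" for \<kappa>
  proof
    fix i show "join n r (restrict \<kappa> {..<r}) (restrict \<kappa> {r..<n}) i = \<kappa> i"
      using that assms PiE_arb[of \<kappa> "{..<n}" "\<lambda>_. UNIV" i]
      by (cases "i < n") (simp_all add: join_def inj_maps_def)
  qed
  then show "\<forall>\<kappa>\<in>inj_maps n. (case (restrict \<kappa> {..<r}, restrict \<kappa> {r..<n}) of (k, l) \<Rightarrow> join n r k l) = \<kappa>"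
    by simp
  show "(\<lambda>(k, l). join n r k l) ` Sigma (inj_maps r) (completions n r) \<subseteq> inj_maps n"
    using join_inj_maps by auto
  show "(\<lambda>\<kappa>. (restrict \<kappa> {..<r}, restrict \<kappa> {r..<n})) ` inj_maps n \<subseteq> Sigma (inj_maps r) (completions n r)"
  proof safe
    fix \<kappa> assume \<kappa>: "\<kappa> \<in> inj_maps n"
    then have inj: "inj_on \<kappa> {..<n}" by (simp add: inj_maps_def)
    then have "inj_on \<kappa> {..<r}" by (rule inj_on_subset) (use assms in auto)
    then have "inj_on (restrict \<kappa> {..<r}) {..<r}" by (simp add: inj_on_def)
    then show "restrict \<kappa> {..<r} \<in> inj_maps r" by (simp add: inj_maps_def)
    show "restrict \<kappa> {r..<n} \<in> completions n r (restrict \<kappa> {..<r})"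
      using inj by (simp add: completions_def join_restrict[OF \<kappa>])
  qed
qed

text \<open>The integrand of one inner integral in the explicit formula. Offsets strictly inside the
  cells make trimming invisible and determine the cells of the fixed arguments.\<close>

locale partial_evaluation =
  fixes n r :: nat and f :: "(nat \<Rightarrow> real) \<Rightarrow> real" and u :: "nat \<Rightarrow> real" and k :: "nat \<Rightarrow> nat"
  assumes r: "r \<le> n" and f: "f \<in> L2_hat n" and u: "\<And>i. \<bar>u i\<bar> < 1"
begin

definition g :: "(nat \<Rightarrow> real) \<Rightarrow> real" where
  "g y = f (\<lambda>i\<in>{..<n}. if i < r then 2 * real (k i) + 1 + u (k i) else y i)"

lemma measurable_completed: "(\<lambda>y. \<lambda>i\<in>{..<n}. if i < r then 2 * real (k i) + 1 + u (k i) else y i)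
    \<in> measurable (half_pow {r..<n}) (half_pow {..<n})"
proof (rule measurable_restrict)
  fix i assume i: "i \<in> {..<n}"
  show "(\<lambda>y. if i < r then 2 * real (k i) + 1 + u (k i) else y i) \<in> measurable (half_pow {r..<n}) halfline"
  proof (cases "i < r")
    case True
    have "0 \<le> 2 * real (k i) + 1 + u (k i)" using u[of "k i"] by (simp add: abs_less_iff)
    then show ?thesis using True by (simp add: space_halfline)
  next
    case False
    then show ?thesis using i by (simp add: measurable_component_singleton)
  qed
qed

lemma measurable_g [measurable]: "g \<in> borel_measurable (half_pow {r..<n})"
  unfolding g_def[abs_def] by (rule measurable_compose[OF measurable_completed L2_hat_measurable[OF f]])

lemma zero_if_not_inj:
  assumes "\<not> inj_on (join n r k l) {..<n}"
  shows "AE v in path_law. g (cell_point {r..<n} l v) = 0"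
  using AE_path
proof eventually_elim
  fix v :: "nat \<Rightarrow> real" assume v: "\<forall>i. \<bar>v i\<bar> < 1"
  let ?x = "\<lambda>i\<in>{..<n}. if i < r then 2 * real (k i) + 1 + u (k i) else cell_point {r..<n} l v i"
  have "cell_point {r..<n} l v \<in> space (half_pow {r..<n})"
    using measurable_space[OF measurable_cell_point[of "\<lambda>x. x" path_law "{r..<n}" l], of v] by simp
  then have "?x \<in> space (half_pow {..<n})"
    using measurable_space[OF measurable_completed] by simp
  moreover have "?x \<notin> Delta n"
    using v u by (intro not_Delta[OF _ assms]) (auto simp: cell_point_def trim_eq less_imp_le join_def)
  ultimately show "g (cell_point {r..<n} l v) = 0"
    unfolding g_def by (rule L2_hat_off_Delta[OF f])
qed

definition h :: "(nat \<Rightarrow> nat) \<Rightarrow> (nat \<Rightarrow> real) \<Rightarrow> real" where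
  "h l y = g (\<lambda>i\<in>{r..<n}. 2 * real (l i) + 1 + trim (y i))"

lemma measurable_h [measurable]: "h l \<in> borel_measurable (PiM {r..<n} (\<lambda>_. borel))"
proof -
  have "(\<lambda>y. \<lambda>i\<in>{r..<n}. 2 * real (l i) + 1 + trim (y i)) \<in> measurable (PiM {r..<n} (\<lambda>_. borel)) (half_pow {r..<n})"
    by measurable
  from measurable_compose[OF this measurable_g] show ?thesis unfolding h_def[abs_def] .
qed

lemma g_eq_h: "g (cell_point {r..<n} l v) = h l (\<lambda>i\<in>{r..<n}. v i)"
  unfolding h_def cell_point_def by (intro arg_cong[where f=g]) auto

text \<open>Injectivity separates the cells of the first \<open>r\<close> positions, where
  \<open>mix\<close> keeps \<open>u\<close>, from the remaining cells \<open>l i\<close>, where it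
  reads the independent path \<open>v\<close>.\<close>

lemma kfun_eq_h:
  assumes inj: "inj_on (join n r k l) {..<n}"
  shows "kfun n f (join n r k l) (mix (join n r k l ` {..<r}) u v) = h l (\<lambda>i\<in>{r..<n}. v (l i))"
  unfolding h_def g_def kfun_def
proof (intro arg_cong[where f=f] restrict_ext)
  fix i assume i: "i \<in> {..<n}"
  have "join n r k l i \<in> join n r k l ` {..<r} \<longleftrightarrow> i < r"
    using inj i r by (subst inj_on_image_mem_iff[OF inj]) auto
  then show "2 * real (join n r k l i) + 1 + trim (mix (join n r k l ` {..<r}) u v (join n r k l i)) =
      (if i < r then 2 * real (k i) + 1 + u (k i)
       else (\<lambda>i\<in>{r..<n}. 2 * real (l i) + 1 + trim ((\<lambda>i\<in>{r..<n}. v (l i)) i)) i)"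
    using i u[of "k i"] by (auto simp: mix_def join_def trim_eq less_imp_le)
qed

lemma completion_inj_on:
  assumes "inj_on (join n r k l) {..<n}" shows "inj_on l {r..<n}"
proof (rule inj_onI)
  fix i j assume ij: "i \<in> {r..<n}" "j \<in> {r..<n}" "l i = l j"
  then have "join n r k l i = join n r k l j" by (simp add: join_def)
  then show "i = j" using inj_onD[OF assms] ij by auto
qed

text \<open>Integrating out the remaining variables within fixed distinct cells is conditioning on
  the first \<open>r\<close> cells. As \<open>l\<close> is injective, offsets taken at positions and
  at cells have the same law.\<close>

lemma integral_g_cell:
  assumes inj: "inj_on (join n r k l) {..<n}"
  shows "(\<integral>v. g (cell_point {r..<n} l v) \<partial>path_law) = cexp (join n r k l ` {..<r}) (kfun n f (join n r k l)) u"
  unfolding cexp_def kfun_eq_h[OF inj] g_eq_h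
  by (rule integral_reindex[OF completion_inj_on[OF inj] measurable_h, symmetric])

lemma nn_integral_g_cell:
  assumes inj: "inj_on (join n r k l) {..<n}"
  shows "(\<integral>\<^sup>+v. ennreal \<bar>g (cell_point {r..<n} l v)\<bar> \<partial>path_law)
    = (\<integral>\<^sup>+v. ennreal \<bar>kfun n f (join n r k l) (mix (join n r k l ` {..<r}) u v)\<bar> \<partial>path_law)"
  unfolding kfun_eq_h[OF inj] g_eq_h
  by (rule nn_integral_reindex[OF completion_inj_on[OF inj], of "\<lambda>y. ennreal \<bar>h l y\<bar>", symmetric]) measurable

text \<open>Each of the \<open>n - r\<close> integration variables contributes a factor 2 when
  decomposed into cells, hence the division by \<open>2 ^ (n - r)\<close>. The finiteness hypothesis
  provides integrability of \<open>g\<close> for this particular path.\<close>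

lemma has_sum_g:
  assumes k: "k \<in> inj_maps r"
    and fin: "(\<integral>\<^sup>+\<kappa>. (\<integral>\<^sup>+v. ennreal \<bar>kfun n f \<kappa> (mix (\<kappa> ` {..<r}) u v)\<bar> \<partial>path_law) \<partial>count_space (inj_maps n)) < \<infinity>"
  shows "((\<lambda>l. cexp (join n r k l ` {..<r}) (kfun n f (join n r k l)) u) has_sum
      ((\<integral>y. g y \<partial>half_pow {r..<n}) / 2 ^ (n - r))) (completions n r k)"
proof -
  let ?A = "\<lambda>\<kappa>. \<integral>\<^sup>+v. ennreal \<bar>kfun n f \<kappa> (mix (\<kappa> ` {..<r}) u v)\<bar> \<partial>path_law"
  let ?B = "\<lambda>l. \<integral>\<^sup>+v. ennreal \<bar>g (cell_point {r..<n} l v)\<bar> \<partial>path_law"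
  have z: "?B l = 0" if "\<not> inj_on (join n r k l) {..<n}" for l
    using zero_if_not_inj[OF that] by (subst nn_integral_0_iff_AE) auto
  have ji: "join n r k ` completions n r k \<subseteq> inj_maps n"
    using join_inj_maps by blast
  have jinj: "inj_on (join n r k) (completions n r k)"
  proof (rule inj_onI)
    fix l l' assume "l \<in> completions n r k" "l' \<in> completions n r k" "join n r k l = join n r k l'"
    then show "l = l'"
      using inj_onD[OF bij_betw_imp_inj_on[OF bij_betw_join[OF r]], of "(k, l)" "(k, l')"] k by simp
  qed
  have expand: "(\<integral>\<^sup>+y. ennreal \<bar>g y\<bar> \<partial>half_pow {r..<n}) = 2 ^ (n - r) * (\<integral>\<^sup>+l. ?B l \<partial>count_space ({r..<n} \<rightarrow>\<^sub>E UNIV))"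
    by (subst nn_integral_half_pow) auto
  have "(\<integral>\<^sup>+l. ?B l \<partial>count_space ({r..<n} \<rightarrow>\<^sub>E UNIV)) = (\<integral>\<^sup>+l. ?B l \<partial>count_space (completions n r k))"
    by (rule nn_integral_count_space_eq) (auto simp: completions_def z)
  also have "\<dots> = (\<integral>\<^sup>+l. ?A (join n r k l) \<partial>count_space (completions n r k))"
    by (rule nn_integral_cong) (simp add: nn_integral_g_cell completions_def)
  also have "\<dots> = (\<integral>\<^sup>+\<kappa>. ?A \<kappa> \<partial>count_space (join n r k ` completions n r k))"
    by (rule nn_integral_bij_count_space) (use jinj in \<open>simp add: bij_betw_def\<close>)
  also have "\<dots> \<le> (\<integral>\<^sup>+\<kappa>. ?A \<kappa> \<partial>count_space (inj_maps n))"
    using ji by (simp add: nn_integral_count_space_indicator nn_integral_mono indicator_def subset_iff)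
  also note fin
  finally have "(\<integral>\<^sup>+y. ennreal \<bar>g y\<bar> \<partial>half_pow {r..<n}) < \<infinity>"
    unfolding expand by (simp add: ennreal_mult_less_top power_less_top_ennreal)
  then have int: "integrable (half_pow {r..<n}) g"
    by (intro integrableI_bounded) auto
  have "((\<lambda>l. \<integral>v. g (cell_point {r..<n} l v) \<partial>path_law) has_sum ((\<integral>y. g y \<partial>half_pow {r..<n}) / 2 ^ (n - r))) ({r..<n} \<rightarrow>\<^sub>E UNIV)"
    using integral_half_pow[OF _ int] by simp
  also have "?this \<longleftrightarrow> ?thesis"
  proof (rule has_sum_cong_neutral)
    fix l assume "l \<in> ({r..<n} \<rightarrow>\<^sub>E UNIV) - completions n r k"
    then have "\<not> inj_on (join n r k l) {..<n}" by (auto simp: completions_def)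
    from integral_cong_AE[OF _ _ zero_if_not_inj[OF this]]
    show "(\<integral>v. g (cell_point {r..<n} l v) \<partial>path_law) = 0" by simp
  qed (auto simp: completions_def integral_g_cell)
  finally show ?thesis .
qed

end

text \<open>A sum over injective maps of all \<open>n\<close> positions is regrouped according to
  their restriction to the first \<open>r\<close> positions.\<close>

lemma infsum_partial_integrals:
  assumes r: "r \<le> n" and f: "f \<in> L2_hat n" and u: "\<And>i. \<bar>u i\<bar> < 1"
    and fin: "(\<integral>\<^sup>+\<kappa>. (\<integral>\<^sup>+v. ennreal \<bar>kfun n f \<kappa> (mix (\<kappa> ` {..<r}) u v)\<bar> \<partial>path_law) \<partial>count_space (inj_maps n)) < \<infinity>"
    and sm: "((\<lambda>\<kappa>. cexp (\<kappa> ` {..<r}) (kfun n f \<kappa>) u) has_sum s) (inj_maps n)"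
  shows "(\<Sum>\<^sub>\<infinity>k\<in>{k \<in> {..<r} \<rightarrow>\<^sub>E UNIV. inj_on k {..<r}}.
     \<integral>y. f (\<lambda>i\<in>{..<n}. if i < r then 2 * real (k i) + 1 + u (k i) else y i) \<partial>half_pow {r..<n}) = 2 ^ (n - r) * s"
proof -
  have pe: "partial_evaluation n r f u" using r f u by unfold_locales
  let ?G = "\<lambda>k. \<integral>y. partial_evaluation.g n r f u k y \<partial>half_pow {r..<n}"
  have "((\<lambda>(k, l). cexp (join n r k l ` {..<r}) (kfun n f (join n r k l)) u) has_sum s) (Sigma (inj_maps r) (completions n r))"
    using sm has_sum_reindex_bij_betw[OF bij_betw_join[OF r], of "\<lambda>\<kappa>. cexp (\<kappa> ` {..<r}) (kfun n f \<kappa>) u" s]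
    by (simp add: split_beta')
  then have "((\<lambda>k. ?G k / 2 ^ (n - r)) has_sum s) (inj_maps r)"
    by (rule has_sum_SigmaD) (use partial_evaluation.has_sum_g[OF pe _ fin] in simp)
  then have "((\<lambda>k. 2 ^ (n - r) * (?G k / 2 ^ (n - r))) has_sum 2 ^ (n - r) * s) (inj_maps r)"
    by (rule has_sum_cmult_right)
  then have "infsum ?G (inj_maps r) = 2 ^ (n - r) * s"
    by (simp add: infsumI)
  then show ?thesis
    unfolding partial_evaluation.g_def[OF pe] inj_maps_def .
qed

lemma L2_hat_symmetric:
  assumes "f \<in> L2_hat n" "\<pi> permutes {..<n}" "x \<in> space (half_pow {..<n})"
  shows "f (x \<circ> \<pi>) = f x"
  using assms unfolding L2_hat_def Rplus_pow_def by blast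

lemma kfun_permute:
  assumes f: "f \<in> L2_hat n" and \<pi>: "\<pi> permutes {..<n}"
  shows "kfun n f (\<kappa> \<circ> \<pi>) = kfun n f \<kappa>"
proof
  fix u
  let ?x = "\<lambda>i\<in>{..<n}. 2 * real (\<kappa> i) + 1 + trim (u (\<kappa> i))"
  have "(\<lambda>u. \<lambda>i\<in>{..<n}. 2 * real (\<kappa> i) + 1 + trim (u (\<kappa> i))) \<in> measurable path_law (half_pow {..<n})"
    by measurable
  from measurable_space[OF this] have "?x \<in> space (half_pow {..<n})" by simp
  then have "f (?x \<circ> \<pi>) = f ?x" by (rule L2_hat_symmetric[OF f \<pi>])
  moreover have "?x \<circ> \<pi> = (\<lambda>i\<in>{..<n}. 2 * real ((\<kappa> \<circ> \<pi>) i) + 1 + trim (u ((\<kappa> \<circ> \<pi>) i)))"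
    using permutes_in_image[OF \<pi>] permutes_not_in[OF \<pi>] by (auto simp: fun_eq_iff)
  ultimately show "kfun n f (\<kappa> \<circ> \<pi>) u = kfun n f \<kappa> u" by (simp add: kfun_def)
qed

text \<open>Symmetry of a kernel lets an arbitrary set of positions be replaced by an initial
  segment of the same size. The permutation is glued from a bijection onto \<open>R\<close> and one
  between the complements.\<close>

lemma ex_permutes_image:
  assumes R: "R \<subseteq> {..<n}"
  shows "\<exists>\<pi>. \<pi> permutes {..<n} \<and> \<pi> ` {..<card R} = R"
proof -
  have fin: "finite R" using R finite_subset by auto
  have le: "card R \<le> n" using card_mono[OF _ R] by simp
  obtain a where a: "bij_betw a {..<card R} R"
    using finite_same_card_bij[of "{..<card R}" R] fin by auto
  have "card ({..<n} - {..<card R}) = card ({..<n} - R)"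
    using R le fin by (simp add: card_Diff_subset)
  then obtain b where b: "bij_betw b ({..<n} - {..<card R}) ({..<n} - R)"
    using finite_same_card_bij[of "{..<n} - {..<card R}" "{..<n} - R"] by auto
  define \<pi> where "\<pi> i = (if i < card R then a i else if i < n then b i else i)" for i
  have 1: "bij_betw \<pi> {..<card R} R"
    using a by (rule bij_betw_cong[THEN iffD1, rotated]) (simp add: \<pi>_def)
  have 2: "bij_betw \<pi> ({..<n} - {..<card R}) ({..<n} - R)"
    using b by (rule bij_betw_cong[THEN iffD1, rotated]) (simp add: \<pi>_def)
  have "bij_betw \<pi> ({..<card R} \<union> ({..<n} - {..<card R})) (R \<union> ({..<n} - R))"
    by (rule bij_betw_combine[OF 1 2]) auto
  then have "bij_betw \<pi> {..<n} {..<n}"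
    using R le Un_Diff_cancel[of "{..<card R}" "{..<n}"] Un_Diff_cancel[of R "{..<n}"]
    by (simp add: Un_absorb1)
  then have "\<pi> permutes {..<n}" by (rule bij_imp_permutes) (use le in \<open>simp add: \<pi>_def\<close>)
  then show ?thesis using bij_betw_imp_surj_on[OF 1] by blast
qed

lemma bij_betw_comp_inj_maps:
  assumes \<pi>: "\<pi> permutes {..<n}"
  shows "bij_betw (\<lambda>\<kappa>. \<kappa> \<circ> \<pi>) (inj_maps n) (inj_maps n)"
proof -
  have *: "\<kappa> \<circ> \<pi> \<in> inj_maps n" if "\<kappa> \<in> inj_maps n" "\<pi> permutes {..<n}" for \<kappa> \<pi>
  proof -
    have "inj_on (\<kappa> \<circ> \<pi>) {..<n}"
      using that by (intro comp_inj_on) (auto simp: inj_maps_def permutes_image permutes_inj_on)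
    moreover have "\<kappa> \<circ> \<pi> \<in> {..<n} \<rightarrow>\<^sub>E UNIV"
      using that permutes_not_in[OF that(2)] by (auto simp: inj_maps_def PiE_iff extensional_def)
    ultimately show ?thesis by (simp add: inj_maps_def)
  qed
  show ?thesis
    by (rule bij_betw_byWitness[where f'="\<lambda>\<kappa>. \<kappa> \<circ> inv \<pi>"])
      (use * \<pi> permutes_inv[OF \<pi>] in \<open>auto simp: comp_assoc permutes_inv_o\<close>)
qed

lemma hoeff_image:
  assumes \<kappa>: "\<kappa> \<in> inj_maps n"
  shows "hoeff (\<kappa> ` {..<n}) G u = (\<Sum>R\<in>Pow {..<n}. (-1) ^ (n - card R) * cexp (\<kappa> ` R) G u)"
proof -
  have inj: "inj_on \<kappa> {..<n}" using \<kappa> by (simp add: inj_maps_def)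
  have "inj_on ((`) \<kappa>) (Pow {..<n})" using inj by (rule inj_on_image_Pow)
  moreover have "Pow (\<kappa> ` {..<n}) = (`) \<kappa> ` Pow {..<n}" by (rule image_Pow_surj[symmetric]) simp
  ultimately have "(\<Sum>J\<in>Pow (\<kappa> ` {..<n}). (-1) ^ card J * cexp J G u) = (\<Sum>R\<in>Pow {..<n}. (-1) ^ card (\<kappa> ` R) * cexp (\<kappa> ` R) G u)"
    by (simp add: sum.reindex)
  also have "\<dots> = (\<Sum>R\<in>Pow {..<n}. (-1) ^ card R * cexp (\<kappa> ` R) G u)"
    by (intro sum.cong refl) (use inj in \<open>auto simp: card_image inj_on_subset\<close>)
  finally have "hoeff (\<kappa> ` {..<n}) G u = (\<Sum>R\<in>Pow {..<n}. ((-1) ^ n * (-1) ^ card R) * cexp (\<kappa> ` R) G u)"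
    unfolding hoeff_def card_image[OF inj] by (simp add: sum_distrib_left mult.assoc)
  also have "\<dots> = (\<Sum>R\<in>Pow {..<n}. (-1) ^ (n - card R) * cexp (\<kappa> ` R) G u)"
  proof (intro sum.cong refl)
    fix R assume "R \<in> Pow {..<n}"
    then have "card R \<le> n" using card_mono[of "{..<n}" R] by simp
    then show "((-1) ^ n * (-1) ^ card R) * cexp (\<kappa> ` R) G u = (-1) ^ (n - card R) * cexp (\<kappa> ` R) G u"
      by (simp add: power_add[symmetric] neg_one_power_add_eq_neg_one_power_diff)
  qed
  finally show ?thesis .
qed

text \<open>The explicit formula is the expanded product of Id - E_k, summed over all choices of
  distinct cells. Its term of order r equals a sum of conditional expectations given the first r
  cells, the powers of 2 having cancelled. By symmetry every set of r positions gives the same sum,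
  and the binomial coefficient counts these sets. The rearrangements need absolute convergence,
  which holds for almost every path.\<close>

lemma mult_int_L1_has_sum:
  assumes f: "f \<in> L2_hat n" and int: "integrable (Rplus_pow n) f"
  shows "AE u in path_law. ((\<lambda>\<kappa>. hoeff (\<kappa> ` {..<n}) (kfun n f \<kappa>) u) has_sum mult_int_L1 n f u) (inj_maps n)"
proof -
  note [measurable] = measurable_kfun[OF f]
  let ?C = "count_space (inj_maps n)"
  let ?A = "\<lambda>R \<kappa> u. \<integral>\<^sup>+v. ennreal \<bar>kfun n f \<kappa> (mix (\<kappa> ` R) u v)\<bar> \<partial>path_law"
  interpret C: sigma_finite_measure ?C by (rule sigma_finite_measure_count_space_countable[OF countable_inj_maps])
  interpret CP: pair_sigma_finite ?C path_law ..
  have Am [measurable]: "?A R \<kappa> \<in> borel_measurable path_law" for R \<kappa> by measurable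
  have total: "(\<integral>\<^sup>+\<kappa>. (\<integral>\<^sup>+u. ennreal \<bar>kfun n f \<kappa> u\<bar> \<partial>path_law) \<partial>?C) < \<infinity>"
  proof -
    have "(\<integral>\<^sup>+x. ennreal \<bar>f x\<bar> \<partial>Rplus_pow n) < \<infinity>"
      using int by (simp add: integrable_iff_bounded)
    then have "2 ^ n * (\<integral>\<^sup>+\<kappa>. (\<integral>\<^sup>+u. ennreal \<bar>kfun n f \<kappa> u\<bar> \<partial>path_law) \<partial>?C) < \<infinity>"
      by (subst (asm) nn_integral_kernel[OF f, of "\<lambda>x. ennreal \<bar>x\<bar>"]) auto
    then show ?thesis by (auto simp: ennreal_mult_less_top)
  qed
  \<comment> \<open>Averaging over part of the coordinates preserves the total L1 norm, so Tonelli
    makes the sum finite almost everywhere.\<close>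
  have fin: "AE u in path_law. (\<integral>\<^sup>+\<kappa>. ?A R \<kappa> u \<partial>?C) < \<infinity>" for R
  proof -
    have pm: "(\<lambda>(\<kappa>, u). ?A R \<kappa> u) \<in> borel_measurable (?C \<Otimes>\<^sub>M path_law)"
      by (rule measurable_pair_measure_countable1[OF countable_inj_maps]) simp
    then have m2: "(\<lambda>u. \<integral>\<^sup>+\<kappa>. ?A R \<kappa> u \<partial>?C) \<in> borel_measurable path_law"
      using C.borel_measurable_nn_integral_fst[of "\<lambda>(u, \<kappa>). ?A R \<kappa> u"] measurable_pair_swap_iff[of "\<lambda>(\<kappa>, u). ?A R \<kappa> u"]
      by (simp add: split_beta')
    have "(\<integral>\<^sup>+u. (\<integral>\<^sup>+\<kappa>. ?A R \<kappa> u \<partial>?C) \<partial>path_law) = (\<integral>\<^sup>+\<kappa>. (\<integral>\<^sup>+u. ?A R \<kappa> u \<partial>path_law) \<partial>?C)"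
      using CP.Fubini'[OF pm] by simp
    also have "\<dots> = (\<integral>\<^sup>+\<kappa>. (\<integral>\<^sup>+u. ennreal \<bar>kfun n f \<kappa> u\<bar> \<partial>path_law) \<partial>?C)"
      by (rule nn_integral_cong, rule nn_integral_mix) measurable
    finally have "(\<integral>\<^sup>+u. (\<integral>\<^sup>+\<kappa>. ?A R \<kappa> u \<partial>?C) \<partial>path_law) \<noteq> \<infinity>" using total by simp
    from nn_integral_PInf_AE[OF m2 this] show ?thesis by (simp add: less_top)
  qed
  have "AE u in path_law. \<forall>R\<in>Pow {..<n}. (\<integral>\<^sup>+\<kappa>. ?A R \<kappa> u \<partial>?C) < \<infinity>"
    by (intro AE_finite_allI fin) auto
  with AE_path show ?thesis
  proof eventually_elim
    fix u :: "nat \<Rightarrow> real"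
    assume u: "\<forall>i. \<bar>u i\<bar> < 1" and finu: "\<forall>R\<in>Pow {..<n}. (\<integral>\<^sup>+\<kappa>. ?A R \<kappa> u \<partial>?C) < \<infinity>"
    define s where "s R = infsum (\<lambda>\<kappa>. cexp (\<kappa> ` R) (kfun n f \<kappa>) u) (inj_maps n)" for R
    have hs: "((\<lambda>\<kappa>. cexp (\<kappa> ` R) (kfun n f \<kappa>) u) has_sum s R) (inj_maps n)" if R: "R \<in> Pow {..<n}" for R
    proof -
      have "ennreal \<bar>cexp (\<kappa> ` R) (kfun n f \<kappa>) u\<bar> \<le> ?A R \<kappa> u" for \<kappa>
        unfolding cexp_def using integral_norm_bound_ennreal[of path_law "\<lambda>v. kfun n f \<kappa> (mix (\<kappa> ` R) u v)"]
        by (cases "integrable path_law (\<lambda>v. kfun n f \<kappa> (mix (\<kappa> ` R) u v))") (auto simp: not_integrable_integral_eq)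
      then have "(\<integral>\<^sup>+\<kappa>. ennreal \<bar>cexp (\<kappa> ` R) (kfun n f \<kappa>) u\<bar> \<partial>?C) \<le> (\<integral>\<^sup>+\<kappa>. ?A R \<kappa> u \<partial>?C)"
        by (intro nn_integral_mono)
      also have "\<dots> < \<infinity>" using finu R by blast
      finally show ?thesis unfolding s_def by (intro has_sum_infsum summable_on_if_nn_integral_count_space)
    qed
    \<comment> \<open>Composing with a permutation only reorders the injective maps and does not
      change the symmetric kernel.\<close>
    have s_card: "s R = s {..<card R}" if R: "R \<in> Pow {..<n}" for R
    proof -
      obtain \<pi> where \<pi>: "\<pi> permutes {..<n}" "\<pi> ` {..<card R} = R" using ex_permutes_image R by blast
      have "s {..<card R} = infsum (\<lambda>\<kappa>. cexp ((\<kappa> \<circ> \<pi>) ` {..<card R}) (kfun n f (\<kappa> \<circ> \<pi>)) u) (inj_maps n)"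
        unfolding s_def
        by (rule infsum_reindex_bij_betw[OF bij_betw_comp_inj_maps[OF \<pi>(1)], symmetric])
      then show ?thesis
        unfolding s_def kfun_permute[OF f \<pi>(1)] image_comp[symmetric] \<pi>(2) by simp
    qed
    have "mult_int_L1 n f u = (\<Sum>r\<le>n. (-1) ^ (n - r) / 2 ^ (n - r) * real (n choose r) * (2 ^ (n - r) * s {..<r}))"
      unfolding mult_int_L1_def
    proof (intro sum.cong refl arg_cong2[where f="(*)"])
      fix r assume "r \<in> {..n}"
      then have r: "r \<le> n" "{..<r} \<in> Pow {..<n}" by auto
      show "(\<Sum>\<^sub>\<infinity>k\<in>{k \<in> {..<r} \<rightarrow>\<^sub>E UNIV. inj_on k {..<r}}.
         \<integral>y. f (\<lambda>i\<in>{..<n}. if i < r then 2 * real (k i) + 1 + u (k i) else y i) \<partial>half_pow {r..<n}) = 2 ^ (n - r) * s {..<r}"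
        using u finu r by (intro infsum_partial_integrals f hs) auto
    qed
    also have "\<dots> = (\<Sum>r\<le>n. real (n choose r) * ((-1) ^ (n - r) * s {..<r}))"
      by (intro sum.cong refl) simp
    \<comment> \<open>The binomial coefficient is unfolded into the sets \<open>R\<close> of r
      positions, which is the shape of the Hoeffding expansion.\<close>
    also have "\<dots> = (\<Sum>r\<le>n. \<Sum>R\<in>{R \<in> Pow {..<n}. card R = r}. (-1) ^ (n - card R) * s R)"
    proof (intro sum.cong refl)
      fix r assume "r \<in> {..n}"
      have "(\<Sum>R\<in>{R \<in> Pow {..<n}. card R = r}. (-1) ^ (n - card R) * s R)
          = (\<Sum>R\<in>{R \<in> Pow {..<n}. card R = r}. (-1) ^ (n - r) * s {..<r})"
        using s_card by (intro sum.cong refl) auto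
      also have "\<dots> = real (n choose r) * ((-1) ^ (n - r) * s {..<r})"
        using n_subsets[of "{..<n}" r] by (simp add: Pow_def)
      finally show "real (n choose r) * ((-1) ^ (n - r) * s {..<r}) = (\<Sum>R\<in>{R \<in> Pow {..<n}. card R = r}. (-1) ^ (n - card R) * s R)" ..
    qed
    also have "\<dots> = (\<Sum>R\<in>Pow {..<n}. (-1) ^ (n - card R) * s R)"
      by (rule sum.group) (auto dest: card_mono[of "{..<n}", rotated])
    finally have e: "mult_int_L1 n f u = (\<Sum>R\<in>Pow {..<n}. (-1) ^ (n - card R) * s R)" .
    have "((\<lambda>\<kappa>. \<Sum>R\<in>Pow {..<n}. (-1) ^ (n - card R) * cexp (\<kappa> ` R) (kfun n f \<kappa>) u) has_sum mult_int_L1 n f u) (inj_maps n)"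
      unfolding e by (intro has_sum_finite_sum has_sum_cmult_right hs) auto
    then show "((\<lambda>\<kappa>. hoeff (\<kappa> ` {..<n}) (kfun n f \<kappa>) u) has_sum mult_int_L1 n f u) (inj_maps n)"
      by (rule has_sum_cong[THEN iffD1, rotated]) (simp add: hoeff_image)
  qed
qed

section \<open>Multiple integrals of square-integrable kernels\<close>

lemma sqdist_tendsto_ip_self:
  assumes G: "\<And>j. G j \<in> L2_Omega" and F: "F \<in> L2_Omega" and lim: "(\<lambda>j. sqdist (G j) F) \<longlonglongrightarrow> 0"
  shows "(\<lambda>j. ip (G j) (G j)) \<longlonglongrightarrow> ip F F"
proof -
  have "(\<lambda>j. sqdist (G j) F + 2 * ip (G j) F - ip F F) \<longlonglongrightarrow> 0 + 2 * ip F F - ip F F"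
    by (intro tendsto_intros lim sqdist_tendsto_ip[OF G F F lim])
  then show ?thesis by (simp add: sqdist_expand[OF G F])
qed

lemma sqdist_diff_le:
  assumes "F \<in> L2_Omega" "F' \<in> L2_Omega" "G \<in> L2_Omega" "G' \<in> L2_Omega"
  shows "sqdist (\<lambda>u. F u - F' u) (\<lambda>u. G u - G' u) \<le> 2 * sqdist F G + 2 * sqdist F' G'"
proof -
  have "sqdist (\<lambda>u. F u - F' u) (\<lambda>u. G u - G' u) = sqdist (\<lambda>u. F u - G u) (\<lambda>u. F' u - G' u)"
    unfolding sqdist_def ip_def by (intro Bochner_Integration.integral_cong) (auto simp: algebra_simps)
  also have "\<dots> \<le> 2 * sqdist (\<lambda>u. F u - G u) (\<lambda>_. 0) + 2 * sqdist (\<lambda>_. 0) (\<lambda>u. F' u - G' u)"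
    using assms by (intro sqdist_triangle L2_diff L2_const)
  also have "\<dots> = 2 * sqdist F G + 2 * sqdist F' G'"
    unfolding sqdist_commute[of "\<lambda>_. 0"] by (simp add: sqdist_def)
  finally show ?thesis .
qed

lemma sqdist_tendsto_sqdist:
  assumes G: "\<And>j. G j \<in> L2_Omega" "\<And>j. H j \<in> L2_Omega" and F: "F \<in> L2_Omega" "F' \<in> L2_Omega"
    and lim: "(\<lambda>j. sqdist (G j) F) \<longlonglongrightarrow> 0" "(\<lambda>j. sqdist (H j) F') \<longlonglongrightarrow> 0"
  shows "(\<lambda>j. sqdist (G j) (H j)) \<longlonglongrightarrow> sqdist F F'"
  unfolding sqdist_def
proof (rule sqdist_tendsto_ip_self)
  show "(\<lambda>j. sqdist (\<lambda>u. G j u - H j u) (\<lambda>u. F u - F' u)) \<longlonglongrightarrow> 0"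
  proof (rule Lim_null_comparison)
    show "\<forall>\<^sub>F j in sequentially. norm (sqdist (\<lambda>u. G j u - H j u) (\<lambda>u. F u - F' u)) \<le> 2 * sqdist (G j) F + 2 * sqdist (H j) F'"
      using sqdist_diff_le[OF G F] by (simp add: sqdist_nonneg)
    have "(\<lambda>j. 2 * sqdist (G j) F + 2 * sqdist (H j) F') \<longlonglongrightarrow> 2 * 0 + 2 * 0" by (intro tendsto_intros lim)
    then show "(\<lambda>j. 2 * sqdist (G j) F + 2 * sqdist (H j) F') \<longlonglongrightarrow> 0" by simp
  qed
qed (auto intro!: L2_diff G F)

text \<open>By Fatou the lower limit of the squared differences vanishes almost everywhere, and
  along a pointwise convergent sequence it is the squared difference of the two limits.\<close>

lemma sqdist_limit_AE_limit:
  assumes G: "\<And>j. G j \<in> L2_Omega" and F: "F \<in> L2_Omega" and lim: "(\<lambda>j. sqdist (G j) F) \<longlonglongrightarrow> 0"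
    and ae: "AE u in path_law. (\<lambda>j. G j u) \<longlonglongrightarrow> W u"
  shows "AE u in path_law. W u = F u"
proof -
  have [measurable]: "G j \<in> borel_measurable path_law" "F \<in> borel_measurable path_law" for j using G F by measurable
  have "(\<integral>\<^sup>+u. liminf (\<lambda>j. ennreal ((G j u - F u)\<^sup>2)) \<partial>path_law) \<le> liminf (\<lambda>j. \<integral>\<^sup>+u. ennreal ((G j u - F u)\<^sup>2) \<partial>path_law)"
    by (rule nn_integral_liminf) measurable
  also have "\<dots> = 0"
    using tendsto_ennrealI[OF lim] unfolding nn_integral_sqdist[OF G F]
    by (intro lim_imp_Liminf) auto
  finally have "AE u in path_law. liminf (\<lambda>j. ennreal ((G j u - F u)\<^sup>2)) = 0"
    by (subst (asm) le_zero_eq, subst (asm) nn_integral_0_iff_AE) auto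
  then show ?thesis using ae
  proof eventually_elim
    fix u assume *: "liminf (\<lambda>j. ennreal ((G j u - F u)\<^sup>2)) = 0" and "(\<lambda>j. G j u) \<longlonglongrightarrow> W u"
    then have "(\<lambda>j. ennreal ((G j u - F u)\<^sup>2)) \<longlonglongrightarrow> ennreal ((W u - F u)\<^sup>2)"
      by (intro tendsto_ennrealI tendsto_intros)
    then have "liminf (\<lambda>j. ennreal ((G j u - F u)\<^sup>2)) = ennreal ((W u - F u)\<^sup>2)"
      by (intro lim_imp_Liminf) auto
    then show "W u = F u" using * by (simp add: ennreal_eq_0_iff)
  qed
qed

lemma hoeff_diff_AE:
  assumes G: "G \<in> L2_Omega" and H: "H \<in> L2_Omega" and K: "finite K"
  shows "AE u in path_law. hoeff K (\<lambda>u. G u - H u) u = hoeff K G u - hoeff K H u"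
proof -
  have c: "AE u in path_law. cexp J (\<lambda>u. G u - H u) u = cexp J G u - cexp J H u" for J
    using integrable_mix(1)[OF L2_integrable[OF G], of J] integrable_mix(1)[OF L2_integrable[OF H], of J]
    by eventually_elim (simp add: cexp_def)
  have "AE u in path_law. \<forall>J\<in>Pow K. cexp J (\<lambda>u. G u - H u) u = cexp J G u - cexp J H u"
    by (intro AE_finite_allI c) (use K in simp)
  then show ?thesis
    by eventually_elim (simp add: hoeff_def sum_subtractf right_diff_distrib)
qed

lemma ip_hoeff_le:
  assumes "G \<in> L2_Omega" "finite K"
  shows "ip (hoeff K G) (hoeff K G) \<le> ip G G"
  using Bessel[OF assms(1), of "{K}"] assms by (simp add: ip_hoeff_self)

section \<open>Kernel norms and partial sums over choices of cells\<close>

definition maps_onto :: "nat \<Rightarrow> nat set \<Rightarrow> (nat \<Rightarrow> nat) set" where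
  "maps_onto n K = {\<kappa> \<in> inj_maps n. \<kappa> ` {..<n} = K}"

lemma maps_onto_finite_card:
  assumes "finite K"
  shows "finite (maps_onto n K)" and "card K = n \<Longrightarrow> card (maps_onto n K) \<le> n ^ n"
proof -
  have sub: "maps_onto n K \<subseteq> {..<n} \<rightarrow>\<^sub>E K"
    unfolding maps_onto_def inj_maps_def by (intro subsetI PiE_I) (auto dest: PiE_arb)
  have fin: "finite ({..<n} \<rightarrow>\<^sub>E K)" using assms by (intro finite_PiE) auto
  show "finite (maps_onto n K)" using finite_subset[OF sub fin] .
  show "card (maps_onto n K) \<le> n ^ n" if "card K = n"
    using card_mono[OF fin sub] that by (simp add: card_PiE)
qed

lemma card_image_inj_maps: "\<kappa> \<in> inj_maps n \<Longrightarrow> card (\<kappa> ` {..<n}) = n"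
  unfolding inj_maps_def by (simp add: card_image)

lemma maps_onto_empty: "card K \<noteq> n \<Longrightarrow> maps_onto n K = {}"
  unfolding maps_onto_def using card_image_inj_maps by blast

definition knorm :: "nat \<Rightarrow> ((nat \<Rightarrow> real) \<Rightarrow> real) \<Rightarrow> (nat \<Rightarrow> nat) \<Rightarrow> real" where
  "knorm n f \<kappa> = ip (kfun n f \<kappa>) (kfun n f \<kappa>)"

text \<open>The squared norm of a kernel is \<open>2 ^ n\<close> times a sum over choices of
  distinct cells. Finiteness of the total makes each summand finite, so
  \<open>kfun n f \<kappa>\<close> is square integrable for every such choice.\<close>

lemma kernel_norm:
  assumes f: "f \<in> L2_hat n"
  shows "\<And>\<kappa>. \<kappa> \<in> inj_maps n \<Longrightarrow> kfun n f \<kappa> \<in> L2_Omega"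
    and "knorm n f summable_on (inj_maps n)"
    and "(\<integral>\<^sup>+x. ennreal ((f x)\<^sup>2) \<partial>Rplus_pow n) = 2 ^ n * ennreal (infsum (knorm n f) (inj_maps n))"
proof -
  note [measurable] = measurable_kfun[OF f]
  let ?q = "\<lambda>\<kappa>. \<integral>\<^sup>+u. ennreal ((kfun n f \<kappa> u)\<^sup>2) \<partial>path_law"
  have eq: "(\<integral>\<^sup>+x. ennreal ((f x)\<^sup>2) \<partial>Rplus_pow n) = 2 ^ n * (\<integral>\<^sup>+\<kappa>. ?q \<kappa> \<partial>count_space (inj_maps n))"
    by (rule nn_integral_kernel[OF f, of "\<lambda>x. ennreal (x\<^sup>2)"]) auto
  have "(\<integral>\<^sup>+x. ennreal ((f x)\<^sup>2) \<partial>Rplus_pow n) < \<infinity>"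
    using f by (simp add: L2_hat_def integrable_iff_bounded)
  then have fin: "(\<integral>\<^sup>+\<kappa>. ?q \<kappa> \<partial>count_space (inj_maps n)) < \<infinity>"
    unfolding eq by (auto simp: ennreal_mult_less_top)
  show L2: "kfun n f \<kappa> \<in> L2_Omega" if "\<kappa> \<in> inj_maps n" for \<kappa>
  proof (rule L2_I_nn)
    have "AE \<kappa> in count_space (inj_maps n). ?q \<kappa> \<noteq> \<infinity>"
      using fin by (intro nn_integral_PInf_AE) auto
    then show "?q \<kappa> < \<infinity>" using that by (simp add: AE_count_space less_top)
  qed measurable
  have q: "?q \<kappa> = ennreal (knorm n f \<kappa>)" if "\<kappa> \<in> inj_maps n" for \<kappa>
    unfolding knorm_def by (rule nn_integral_square[OF L2[OF that]])
  have qi: "(\<integral>\<^sup>+\<kappa>. ?q \<kappa> \<partial>count_space (inj_maps n)) = (\<integral>\<^sup>+\<kappa>. ennreal (knorm n f \<kappa>) \<partial>count_space (inj_maps n))"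
    by (rule nn_integral_cong) (simp add: q)
  then have e2: "(\<integral>\<^sup>+x. ennreal ((f x)\<^sup>2) \<partial>Rplus_pow n) = 2 ^ n * (\<integral>\<^sup>+\<kappa>. ennreal (knorm n f \<kappa>) \<partial>count_space (inj_maps n))"
    using eq by simp
  have nonneg: "0 \<le> knorm n f \<kappa>" for \<kappa> unfolding knorm_def by (rule ip_self_nonneg)
  have int: "integrable (count_space (inj_maps n)) (knorm n f)"
    using fin qi by (intro integrableI_bounded) (auto simp: nonneg)
  have abs: "Infinite_Sum.abs_summable_on (knorm n f) (inj_maps n)"
    using summable_on_if_nn_integral_count_space(1)[where W="knorm n f" and A="inj_maps n"] fin qi by (simp add: nonneg)
  then show "knorm n f summable_on (inj_maps n)" by (rule abs_summable_summable)
  have "(\<integral>\<^sup>+\<kappa>. ennreal (knorm n f \<kappa>) \<partial>count_space (inj_maps n)) = ennreal (integral\<^sup>L (count_space (inj_maps n)) (knorm n f))"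
    using int by (intro nn_integral_eq_integral) (auto simp: nonneg)
  also have "integral\<^sup>L (count_space (inj_maps n)) (knorm n f) = infsum (knorm n f) (inj_maps n)"
    using infsetsum_infsum[OF abs[unfolded abs_summable_equivalent]] by (simp add: infsetsum_def)
  finally show "(\<integral>\<^sup>+x. ennreal ((f x)\<^sup>2) \<partial>Rplus_pow n) = 2 ^ n * ennreal (infsum (knorm n f) (inj_maps n))"
    using e2 by simp
qed

lemma knorm_nonneg: "0 \<le> knorm n f \<kappa>"
  unfolding knorm_def by (rule ip_self_nonneg)

text \<open>Only kernels on the same set of cells interact, and at most \<open>n ^ n\<close> maps share an image.\<close>

lemma ip_sum_hoeff_le:
  assumes f: "f \<in> L2_hat n" and A: "finite A" "A \<subseteq> inj_maps n"
  defines "S \<equiv> \<lambda>u. \<Sum>\<kappa>\<in>A. hoeff (\<kappa> ` {..<n}) (kfun n f \<kappa>) u"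
  shows "ip S S \<le> real (n ^ n) * (\<Sum>\<kappa>\<in>A. knorm n f \<kappa>)"
proof -
  let ?T = "\<lambda>\<kappa>. hoeff (\<kappa> ` {..<n}) (kfun n f \<kappa>)"
  let ?e = "\<lambda>\<kappa> \<kappa>'. if \<kappa> ` {..<n} = \<kappa>' ` {..<n} then 1 else 0 :: real"
  have L: "kfun n f \<kappa> \<in> L2_Omega" if "\<kappa> \<in> A" for \<kappa> using kernel_norm(1)[OF f] A that by blast
  have T: "?T \<kappa> \<in> L2_Omega" if "\<kappa> \<in> A" for \<kappa> using hoeff_L2[OF L[OF that]] .
  have pair: "ip (?T \<kappa>) (?T \<kappa>') \<le> ?e \<kappa> \<kappa>' * knorm n f \<kappa> / 2 + ?e \<kappa> \<kappa>' * knorm n f \<kappa>' / 2" if "\<kappa> \<in> A" "\<kappa>' \<in> A" for \<kappa> \<kappa>'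
  proof (cases "\<kappa> ` {..<n} = \<kappa>' ` {..<n}")
    case True
    then show ?thesis
      using ip_le_half[OF T[OF that(1)] T[OF that(2)]] ip_hoeff_le[OF L[OF that(1)], of "\<kappa> ` {..<n}"]
        ip_hoeff_le[OF L[OF that(2)], of "\<kappa>' ` {..<n}"]
      by (simp add: knorm_def)
  next
    case False
    then show ?thesis using that by (simp add: ip_hoeff_hoeff L)
  qed
  have card: "(\<Sum>\<kappa>'\<in>A. ?e \<kappa> \<kappa>') \<le> real (n ^ n)" if "\<kappa> \<in> A" for \<kappa>
  proof -
    have "(\<Sum>\<kappa>'\<in>A. ?e \<kappa> \<kappa>') = real (card {\<kappa>' \<in> A. \<kappa> ` {..<n} = \<kappa>' ` {..<n}})"
      using A by (simp add: sum.If_cases Int_def)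
    also have "\<dots> \<le> real (card (maps_onto n (\<kappa> ` {..<n})))"
      using A by (intro of_nat_mono card_mono maps_onto_finite_card) (auto simp: maps_onto_def)
    also have "\<dots> \<le> real (n ^ n)"
      using A that card_image_inj_maps[of \<kappa> n] by (intro of_nat_mono maps_onto_finite_card) auto
    finally show ?thesis by simp
  qed
  have "ip S S = (\<Sum>\<kappa>\<in>A. \<Sum>\<kappa>'\<in>A. ip (?T \<kappa>) (?T \<kappa>'))"
    unfolding S_def using T by (simp add: ip_sum_left ip_sum_right L2_sum)
  also have "\<dots> \<le> (\<Sum>\<kappa>\<in>A. \<Sum>\<kappa>'\<in>A. ?e \<kappa> \<kappa>' * knorm n f \<kappa> / 2 + ?e \<kappa> \<kappa>' * knorm n f \<kappa>' / 2)"
    by (intro sum_mono pair)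
  also have "\<dots> = (\<Sum>\<kappa>\<in>A. \<Sum>\<kappa>'\<in>A. ?e \<kappa> \<kappa>' * knorm n f \<kappa> / 2) + (\<Sum>\<kappa>\<in>A. \<Sum>\<kappa>'\<in>A. ?e \<kappa> \<kappa>' * knorm n f \<kappa>' / 2)"
    by (simp only: sum.distrib)
  also have "(\<Sum>\<kappa>\<in>A. \<Sum>\<kappa>'\<in>A. ?e \<kappa> \<kappa>' * knorm n f \<kappa>' / 2) = (\<Sum>\<kappa>\<in>A. \<Sum>\<kappa>'\<in>A. ?e \<kappa> \<kappa>' * knorm n f \<kappa> / 2)"
    by (subst sum.swap) (intro sum.cong refl, simp add: eq_commute)
  also have "(\<Sum>\<kappa>\<in>A. \<Sum>\<kappa>'\<in>A. ?e \<kappa> \<kappa>' * knorm n f \<kappa> / 2) + (\<Sum>\<kappa>\<in>A. \<Sum>\<kappa>'\<in>A. ?e \<kappa> \<kappa>' * knorm n f \<kappa> / 2)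
      = (\<Sum>\<kappa>\<in>A. (\<Sum>\<kappa>'\<in>A. ?e \<kappa> \<kappa>') * knorm n f \<kappa>)"
    by (simp only: sum.distrib[symmetric] sum_distrib_right) (intro sum.cong refl, simp)
  also have "\<dots> \<le> (\<Sum>\<kappa>\<in>A. real (n ^ n) * knorm n f \<kappa>)"
    by (intro sum_mono mult_right_mono card knorm_nonneg)
  finally show ?thesis by (simp add: sum_distrib_left)
qed

definition maps_below :: "nat \<Rightarrow> nat \<Rightarrow> (nat \<Rightarrow> nat) set" where
  "maps_below n N = {\<kappa> \<in> inj_maps n. \<kappa> ` {..<n} \<subseteq> {..<N}}"

lemma finite_maps_below: "finite (maps_below n N)"
proof (rule finite_subset)
  show "maps_below n N \<subseteq> {..<n} \<rightarrow>\<^sub>E {..<N}"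
    unfolding maps_below_def inj_maps_def by (intro subsetI PiE_I) (auto dest: PiE_arb)
qed (intro finite_PiE; simp)

lemma maps_below_mono: "N \<le> M \<Longrightarrow> maps_below n N \<subseteq> maps_below n M"
  unfolding maps_below_def by auto

lemma maps_below_subset: "maps_below n N \<subseteq> inj_maps n"
  unfolding maps_below_def by auto

lemma filterlim_maps_below: "filterlim (maps_below n) (finite_subsets_at_top (inj_maps n)) sequentially"
  unfolding filterlim_finite_subsets_at_top
proof (intro allI impI)
  fix X assume X: "finite X \<and> X \<subseteq> inj_maps n"
  then have "finite (\<Union>\<kappa>\<in>X. \<kappa> ` {..<n})" by auto
  then obtain m where m: "(\<Union>\<kappa>\<in>X. \<kappa> ` {..<n}) \<subseteq> {..<m}" by (meson finite_nat_iff_bounded)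
  then have "X \<subseteq> maps_below n N" if "N \<ge> m" for N
    using that X unfolding maps_below_def by fastforce
  then show "\<forall>\<^sub>F N in sequentially. finite (maps_below n N) \<and> X \<subseteq> maps_below n N \<and> maps_below n N \<subseteq> inj_maps n"
    unfolding eventually_sequentially using finite_maps_below maps_below_subset by (intro exI[of _ m]) auto
qed

text \<open>Sequential partial sums of the series for the multiple integral. They converge in L2 for
  every kernel in \<open>L2_hat n\<close>, integrable or not, and so describe both branches of
  \<open>mult_int\<close> uniformly.\<close>

definition psum :: "nat \<Rightarrow> ((nat \<Rightarrow> real) \<Rightarrow> real) \<Rightarrow> nat \<Rightarrow> (nat \<Rightarrow> real) \<Rightarrow> real" where
  "psum n f N u = (\<Sum>\<kappa>\<in>maps_below n N. hoeff (\<kappa> ` {..<n}) (kfun n f \<kappa>) u)"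

lemma psum_L2: "f \<in> L2_hat n \<Longrightarrow> psum n f N \<in> L2_Omega"
  unfolding psum_def[abs_def] using maps_below_subset by (intro L2_sum hoeff_L2 kernel_norm(1)) auto

lemma psum_norm_le:
  assumes "f \<in> L2_hat n"
  shows "ip (psum n f N) (psum n f N) \<le> real (n ^ n) * infsum (knorm n f) (inj_maps n)"
proof -
  have "ip (psum n f N) (psum n f N) \<le> real (n ^ n) * (\<Sum>\<kappa>\<in>maps_below n N. knorm n f \<kappa>)"
    unfolding psum_def[abs_def] by (rule ip_sum_hoeff_le[OF assms finite_maps_below maps_below_subset])
  also have "\<dots> \<le> real (n ^ n) * infsum (knorm n f) (inj_maps n)"
    using kernel_norm(2)[OF assms]
    by (intro mult_left_mono finite_sum_le_infsum finite_maps_below maps_below_subset knorm_nonneg) auto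
  finally show ?thesis .
qed

lemma psum_limit:
  assumes f: "f \<in> L2_hat n"
  shows "\<exists>Z\<in>L2_Omega. (\<lambda>N. sqdist (psum n f N) Z) \<longlonglongrightarrow> 0"
proof (rule L2_complete[OF psum_L2[OF f]])
  fix e :: real assume e: "e > 0"
  let ?t = "\<lambda>N. \<Sum>\<kappa>\<in>maps_below n N. knorm n f \<kappa>"
  let ?c = "real (n ^ n) + 1"
  have le: "sqdist (psum n f M) (psum n f N) \<le> ?c * \<bar>?t M - ?t N\<bar>" if "N \<le> M" for M N
  proof -
    let ?A = "maps_below n M - maps_below n N"
    note sub = maps_below_mono[OF that, of n]
    have "(\<lambda>u. psum n f M u - psum n f N u) = (\<lambda>u. \<Sum>\<kappa>\<in>?A. hoeff (\<kappa> ` {..<n}) (kfun n f \<kappa>) u)"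
      unfolding psum_def using sub by (simp add: sum_diff[OF finite_maps_below])
    moreover have "finite ?A" "?A \<subseteq> inj_maps n" using finite_maps_below maps_below_subset by blast+
    ultimately have "sqdist (psum n f M) (psum n f N) \<le> real (n ^ n) * (\<Sum>\<kappa>\<in>?A. knorm n f \<kappa>)"
      unfolding sqdist_def using ip_sum_hoeff_le[OF f, of ?A] by simp
    also have "(\<Sum>\<kappa>\<in>?A. knorm n f \<kappa>) = ?t M - ?t N"
      using sub by (simp add: sum_diff[OF finite_maps_below])
    also have "real (n ^ n) * (?t M - ?t N) \<le> ?c * \<bar>?t M - ?t N\<bar>"
      using sum_mono2[OF finite_maps_below sub, of "knorm n f"] knorm_nonneg by (intro mult_mono) auto
    finally show ?thesis .
  qed
  have "(knorm n f has_sum infsum (knorm n f) (inj_maps n)) (inj_maps n)"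
    using kernel_norm(2)[OF f] by simp
  then have "?t \<longlonglongrightarrow> infsum (knorm n f) (inj_maps n)"
    unfolding has_sum_def by (rule filterlim_compose) (rule filterlim_maps_below)
  then have "Cauchy ?t" by (rule LIMSEQ_imp_Cauchy)
  then obtain N where N: "\<And>i j. i \<ge> N \<Longrightarrow> j \<ge> N \<Longrightarrow> \<bar>?t i - ?t j\<bar> < e / ?c"
    using CauchyD[of ?t "e / ?c"] e by (auto simp: add_nonneg_pos)
  have "sqdist (psum n f i) (psum n f j) < e" if "i \<ge> N" "j \<ge> N" for i j
  proof -
    have c: "?c > 0" by (simp add: add_nonneg_pos)
    have "sqdist (psum n f i) (psum n f j) \<le> ?c * \<bar>?t i - ?t j\<bar>"
      using le[of i j] le[of j i] by (cases "i \<le> j") (auto simp: sqdist_commute abs_minus_commute)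
    also have "\<dots> < e" using mult_strict_left_mono[OF N[OF that] c] c by simp
    finally show ?thesis .
  qed
  then show "\<exists>N. \<forall>i\<ge>N. \<forall>j\<ge>N. sqdist (psum n f i) (psum n f j) < e" by blast
qed

lemma L2_hat_diff:
  assumes f: "f \<in> L2_hat n" and g: "g \<in> L2_hat n"
  shows "(\<lambda>x. f x - g x) \<in> L2_hat n"
proof -
  have m: "f \<in> borel_measurable (Rplus_pow n)" "g \<in> borel_measurable (Rplus_pow n)"
    and i: "integrable (Rplus_pow n) (\<lambda>x. (f x)\<^sup>2)" "integrable (Rplus_pow n) (\<lambda>x. (g x)\<^sup>2)"
    using f g by (auto simp: L2_hat_def)
  have "integrable (Rplus_pow n) (\<lambda>x. (f x - g x)\<^sup>2)"
  proof (rule Bochner_Integration.integrable_bound)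
    show "integrable (Rplus_pow n) (\<lambda>x. 2 * (f x)\<^sup>2 + 2 * (g x)\<^sup>2)" using i by auto
    have "(f x - g x)\<^sup>2 \<le> 2 * (f x)\<^sup>2 + 2 * (g x)\<^sup>2" for x
      using zero_le_power2[of "f x + g x"] by (simp add: power2_eq_square algebra_simps)
    then show "AE x in Rplus_pow n. norm ((f x - g x)\<^sup>2) \<le> norm (2 * (f x)\<^sup>2 + 2 * (g x)\<^sup>2)" by simp
  qed (use m in measurable)
  moreover have "(\<lambda>x. f x - g x) \<in> borel_measurable (Rplus_pow n)" by (intro borel_measurable_diff m)
  ultimately show ?thesis using f g by (simp add: L2_hat_def)
qed

lemma psum_diff_AE:
  assumes f: "f \<in> L2_hat n" and g: "g \<in> L2_hat n"
  shows "AE u in path_law. psum n (\<lambda>x. f x - g x) N u = psum n f N u - psum n g N u"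
proof -
  have "AE u in path_law. \<forall>\<kappa>\<in>maps_below n N. hoeff (\<kappa> ` {..<n}) (kfun n (\<lambda>x. f x - g x) \<kappa>) u
      = hoeff (\<kappa> ` {..<n}) (kfun n f \<kappa>) u - hoeff (\<kappa> ` {..<n}) (kfun n g \<kappa>) u"
  proof (rule AE_finite_allI[OF finite_maps_below])
    fix \<kappa> assume "\<kappa> \<in> maps_below n N"
    then have "\<kappa> \<in> inj_maps n" by (simp add: maps_below_def)
    then have "AE u in path_law. hoeff (\<kappa> ` {..<n}) (\<lambda>u. kfun n f \<kappa> u - kfun n g \<kappa> u) u
      = hoeff (\<kappa> ` {..<n}) (kfun n f \<kappa>) u - hoeff (\<kappa> ` {..<n}) (kfun n g \<kappa>) u"
      by (intro hoeff_diff_AE kernel_norm(1) f g) auto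
    then show "AE u in path_law. hoeff (\<kappa> ` {..<n}) (kfun n (\<lambda>x. f x - g x) \<kappa>) u
      = hoeff (\<kappa> ` {..<n}) (kfun n f \<kappa>) u - hoeff (\<kappa> ` {..<n}) (kfun n g \<kappa>) u"
      unfolding kfun_def[abs_def] .
  qed
  then show ?thesis by eventually_elim (simp add: psum_def sum_subtractf)
qed

text \<open>Partial sums of a difference are differences of partial sums almost everywhere, so the
  norm estimate passes to the limits. The crude constant \<open>n ^ n\<close> in place of n!
  suffices, since only continuity in the kernel is used.\<close>

lemma psum_limit_continuous:
  assumes f: "f \<in> L2_hat n" and g: "g \<in> L2_hat n"
    and Z: "Z \<in> L2_Omega" "(\<lambda>N. sqdist (psum n f N) Z) \<longlonglongrightarrow> 0"
    and Z': "Z' \<in> L2_Omega" "(\<lambda>N. sqdist (psum n g N) Z') \<longlonglongrightarrow> 0"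
  shows "ennreal (sqdist Z Z') \<le> ennreal (n ^ n) * (\<integral>\<^sup>+x. ennreal ((f x - g x)\<^sup>2) \<partial>Rplus_pow n)"
proof -
  note d = L2_hat_diff[OF f g]
  let ?s = "infsum (knorm n (\<lambda>x. f x - g x)) (inj_maps n)"
  have le: "sqdist (psum n f N) (psum n g N) \<le> real (n ^ n) * ?s" for N
  proof -
    have "sqdist (psum n f N) (psum n g N) = ip (psum n (\<lambda>x. f x - g x) N) (psum n (\<lambda>x. f x - g x) N)"
      unfolding sqdist_def ip_def
      by (rule integral_cong_AE)
        (use psum_diff_AE[OF f g, of N] psum_L2[OF f] psum_L2[OF g] psum_L2[OF d] in \<open>auto elim!: eventually_mono\<close>)
    then show ?thesis using psum_norm_le[OF d] by simp
  qed
  have "(\<lambda>N. sqdist (psum n f N) (psum n g N)) \<longlonglongrightarrow> sqdist Z Z'"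
    by (rule sqdist_tendsto_sqdist) (auto intro: psum_L2 f g Z Z')
  then have "sqdist Z Z' \<le> real (n ^ n) * ?s" by (rule LIMSEQ_le_const2) (use le in auto)
  then have "ennreal (sqdist Z Z') \<le> ennreal (n ^ n) * ennreal ?s"
    by (subst ennreal_mult[symmetric]) (auto intro!: ennreal_leI infsum_nonneg knorm_nonneg)
  also have "\<dots> \<le> ennreal (n ^ n) * (2 ^ n * ennreal ?s)"
    using mult_right_mono[of 1 "2 ^ n :: ennreal" "ennreal ?s"] by (intro mult_left_mono) (auto intro: one_le_power)
  finally show ?thesis using kernel_norm(3)[OF d] by simp
qed

lemma mult_int_L1_eq_limit:
  assumes f: "f \<in> L2_hat n" "integrable (Rplus_pow n) f"
    and Z: "Z \<in> L2_Omega" "(\<lambda>N. sqdist (psum n f N) Z) \<longlonglongrightarrow> 0"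
  shows "AE u in path_law. mult_int_L1 n f u = Z u"
proof (rule sqdist_limit_AE_limit[OF psum_L2[OF f(1)] Z])
  show "AE u in path_law. (\<lambda>j. psum n f j u) \<longlonglongrightarrow> mult_int_L1 n f u"
    using mult_int_L1_has_sum[OF f]
  proof eventually_elim
    fix u assume "((\<lambda>\<kappa>. hoeff (\<kappa> ` {..<n}) (kfun n f \<kappa>) u) has_sum mult_int_L1 n f u) (inj_maps n)"
    then show "(\<lambda>j. psum n f j u) \<longlonglongrightarrow> mult_int_L1 n f u"
      unfolding has_sum_def psum_def by (rule filterlim_compose) (rule filterlim_maps_below)
  qed
qed

section \<open>Truncated kernels and the extension by continuity\<close>

definition trunc :: "nat \<Rightarrow> ((nat \<Rightarrow> real) \<Rightarrow> real) \<Rightarrow> nat \<Rightarrow> (nat \<Rightarrow> real) \<Rightarrow> real" where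
  "trunc n f j x = (if \<forall>i\<in>{..<n}. x i < 2 * real j then f x else 0)"

lemma trunc_L2_hat:
  assumes f: "f \<in> L2_hat n"
  shows "trunc n f j \<in> L2_hat n"
proof -
  have m [measurable]: "f \<in> borel_measurable (Rplus_pow n)" and i: "integrable (Rplus_pow n) (\<lambda>x. (f x)\<^sup>2)"
    using f by (auto simp: L2_hat_def)
  have [measurable]: "(\<lambda>x. x i) \<in> borel_measurable (Rplus_pow n)" if "i \<in> {..<n}" for i
    unfolding Rplus_pow_def by (rule measurable_half_pow_component[OF that])
  have meas [measurable]: "trunc n f j \<in> borel_measurable (Rplus_pow n)"
    unfolding trunc_def[abs_def] by measurable
  have "integrable (Rplus_pow n) (\<lambda>x. (trunc n f j x)\<^sup>2)"
    by (rule Bochner_Integration.integrable_bound[OF i]) (auto simp: trunc_def)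
  moreover have "trunc n f j (x \<circ> \<pi>) = trunc n f j x" if \<pi>: "\<pi> permutes {..<n}" and x: "x \<in> space (Rplus_pow n)" for x \<pi>
  proof -
    have "(\<forall>i\<in>{..<n}. (x \<circ> \<pi>) i < 2 * real j) \<longleftrightarrow> (\<forall>i\<in>\<pi> ` {..<n}. x i < 2 * real j)" by simp
    then show ?thesis unfolding trunc_def permutes_image[OF \<pi>]
      using L2_hat_symmetric[OF f \<pi>] x by (simp add: Rplus_pow_def)
  qed
  moreover have "trunc n f j x = 0" if "x \<in> space (Rplus_pow n) - Delta n" for x
    using that f by (simp add: trunc_def L2_hat_def)
  ultimately show ?thesis using meas by (simp add: L2_hat_def)
qed

text \<open>The cut-off \<open>2 * real j\<close> is a cell boundary, so truncation keeps or kills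
  whole cells: it selects the choices of cells below \<open>j\<close>.\<close>

lemma kfun_trunc:
  assumes u: "\<And>i. \<bar>u i\<bar> < 1" and \<kappa>: "\<kappa> \<in> inj_maps n"
  shows "kfun n (trunc n f j) \<kappa> u = (if \<kappa> \<in> maps_below n j then kfun n f \<kappa> u else 0)"
proof -
  have "2 * real (\<kappa> i) + 1 + trim (u (\<kappa> i)) < 2 * real j \<longleftrightarrow> \<kappa> i < j" for i
    using u[of "\<kappa> i"] by (simp add: trim_eq less_imp_le abs_less_iff) linarith
  then show ?thesis using \<kappa> by (auto simp: kfun_def trunc_def maps_below_def)
qed

lemma trunc_integrable:
  assumes f: "f \<in> L2_hat n"
  shows "integrable (Rplus_pow n) (trunc n f j)"
proof (rule integrableI_bounded)
  note tf = trunc_L2_hat[OF f, of j]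
  show "trunc n f j \<in> borel_measurable (Rplus_pow n)" using tf by (simp add: L2_hat_def)
  let ?q = "\<lambda>\<kappa>. \<integral>\<^sup>+u. ennreal \<bar>kfun n (trunc n f j) \<kappa> u\<bar> \<partial>path_law"
  have zero: "?q \<kappa> = 0" if "\<kappa> \<in> inj_maps n" "\<kappa> \<notin> maps_below n j" for \<kappa>
  proof -
    have "AE u in path_law. ennreal \<bar>kfun n (trunc n f j) \<kappa> u\<bar> = 0"
      using AE_path by eventually_elim (simp add: kfun_trunc that)
    then show ?thesis using measurable_kfun[OF tf] by (subst nn_integral_0_iff_AE) auto
  qed
  have fin: "?q \<kappa> < \<infinity>" if "\<kappa> \<in> inj_maps n" for \<kappa>
    using L2_integrable[OF kernel_norm(1)[OF tf that]] by (simp add: integrable_iff_bounded)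
  have "(\<integral>\<^sup>+x. ennreal (norm (trunc n f j x)) \<partial>Rplus_pow n) = 2 ^ n * (\<integral>\<^sup>+\<kappa>. ?q \<kappa> \<partial>count_space (inj_maps n))"
    using nn_integral_kernel[OF tf, of "\<lambda>x. ennreal \<bar>x\<bar>"] by simp
  also have "(\<integral>\<^sup>+\<kappa>. ?q \<kappa> \<partial>count_space (inj_maps n)) = (\<integral>\<^sup>+\<kappa>. ?q \<kappa> \<partial>count_space (maps_below n j))"
    using zero maps_below_subset by (intro nn_integral_count_space_eq) auto
  also have "\<dots> = (\<Sum>\<kappa>\<in>maps_below n j. ?q \<kappa>)"
    by (rule nn_integral_count_space_finite[OF finite_maps_below])
  also have "2 ^ n * \<dots> < \<infinity>"
    using fin maps_below_subset[of n j]
    by (auto simp: ennreal_mult_less_top power_less_top_ennreal finite_maps_below)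
  finally show "(\<integral>\<^sup>+x. ennreal (norm (trunc n f j x)) \<partial>Rplus_pow n) < \<infinity>" .
qed

text \<open>The squared distance to \<open>f\<close> is \<open>2 ^ n\<close> times the sum of
  \<open>knorm n f\<close> over the choices of cells reaching \<open>j\<close> or beyond, which is
  the tail of a convergent series.\<close>

lemma trunc_tendsto:
  assumes f: "f \<in> L2_hat n"
  shows "L2_tendsto (Rplus_pow n) (trunc n f) f"
proof -
  let ?s = "\<lambda>j. infsum (knorm n (\<lambda>x. trunc n f j x - f x)) (inj_maps n)"
  let ?t = "\<lambda>N. \<Sum>\<kappa>\<in>maps_below n N. knorm n f \<kappa>"
  let ?T = "infsum (knorm n f) (inj_maps n)"
  have k: "knorm n (\<lambda>x. trunc n f j x - f x) \<kappa> = knorm n f \<kappa> - (if \<kappa> \<in> maps_below n j then knorm n f \<kappa> else 0)"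
    if \<kappa>: "\<kappa> \<in> inj_maps n" for j \<kappa>
  proof -
    have "knorm n (\<lambda>x. trunc n f j x - f x) \<kappa> = (\<integral>u. (if \<kappa> \<in> maps_below n j then 0 else kfun n f \<kappa> u * kfun n f \<kappa> u) \<partial>path_law)"
      unfolding knorm_def ip_def
    proof (rule integral_cong_AE)
      show "AE u in path_law. kfun n (\<lambda>x. trunc n f j x - f x) \<kappa> u * kfun n (\<lambda>x. trunc n f j x - f x) \<kappa> u
          = (if \<kappa> \<in> maps_below n j then 0 else kfun n f \<kappa> u * kfun n f \<kappa> u)"
        using AE_path
      proof eventually_elim
        fix u :: "nat \<Rightarrow> real" assume "\<forall>i. \<bar>u i\<bar> < 1"
        then have "kfun n (\<lambda>x. trunc n f j x - f x) \<kappa> u = (if \<kappa> \<in> maps_below n j then kfun n f \<kappa> u else 0) - kfun n f \<kappa> u"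
          using kfun_trunc[OF _ \<kappa>, of u f j] by (simp add: kfun_def)
        then show "kfun n (\<lambda>x. trunc n f j x - f x) \<kappa> u * kfun n (\<lambda>x. trunc n f j x - f x) \<kappa> u
          = (if \<kappa> \<in> maps_below n j then 0 else kfun n f \<kappa> u * kfun n f \<kappa> u)" by simp
      qed
    qed (use measurable_kfun[OF L2_hat_diff[OF trunc_L2_hat[OF f] f]] measurable_kfun[OF f] in measurable)
    then show ?thesis by (simp add: knorm_def ip_def)
  qed
  have s: "?s j = ?T - ?t j" for j
  proof (rule infsumI)
    have "((\<lambda>\<kappa>. if \<kappa> \<in> maps_below n j then knorm n f \<kappa> else 0) has_sum ?t j) (inj_maps n)"
      using has_sum_finite[OF finite_maps_below, of "knorm n f" n j]
      by (subst has_sum_cong_neutral[where T="maps_below n j" and g="knorm n f"]) (use maps_below_subset in auto)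
    from has_sum_add[OF has_sum_infsum[OF kernel_norm(2)[OF f]] has_sum_cmult_right[OF this, of "-1"]]
    have "((\<lambda>\<kappa>. knorm n f \<kappa> - (if \<kappa> \<in> maps_below n j then knorm n f \<kappa> else 0)) has_sum (?T - ?t j)) (inj_maps n)"
      by simp
    then show "(knorm n (\<lambda>x. trunc n f j x - f x) has_sum (?T - ?t j)) (inj_maps n)"
      by (rule has_sum_cong[THEN iffD1, rotated]) (simp add: k)
  qed
  have "?t \<longlonglongrightarrow> ?T"
    using has_sum_infsum[OF kernel_norm(2)[OF f]] unfolding has_sum_def
    by (rule filterlim_compose) (rule filterlim_maps_below)
  then have "(\<lambda>j. ?T - ?t j) \<longlonglongrightarrow> ?T - ?T" by (intro tendsto_intros)
  then have "(\<lambda>j. ennreal (2 ^ n * ?s j)) \<longlonglongrightarrow> ennreal (2 ^ n * 0)"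
    unfolding s by (intro tendsto_ennrealI tendsto_intros) simp
  moreover have "(\<integral>\<^sup>+x. ennreal ((trunc n f j x - f x)\<^sup>2) \<partial>Rplus_pow n) = ennreal (2 ^ n * ?s j)" for j
    using kernel_norm(3)[OF L2_hat_diff[OF trunc_L2_hat[OF f] f]]
    by (simp add: ennreal_mult infsum_nonneg knorm_nonneg ennreal_power[symmetric])
  ultimately show ?thesis unfolding L2_tendsto_def by simp
qed

text \<open>Continuity forces the same limit \<open>Z\<close> for every approximating sequence of
  integrable kernels, so whatever \<open>SOME\<close> picks agrees with \<open>Z\<close> almost
  everywhere. Truncations show that there is something to pick.\<close>

lemma mult_int_eq_limit:
  assumes f: "f \<in> L2_hat n"
    and Z: "Z \<in> L2_Omega" "(\<lambda>N. sqdist (psum n f N) Z) \<longlonglongrightarrow> 0"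
  shows "AE u in path_law. mult_int n f u = Z u"
proof (cases "integrable (Rplus_pow n) f")
  case True
  then show ?thesis using mult_int_L1_eq_limit[OF f True Z] by (simp add: mult_int_def)
next
  case False
  define Q where "Q W \<longleftrightarrow> W \<in> L2_Omega \<and>
        (\<exists>g. (\<forall>j. g j \<in> L2_hat n \<and> integrable (Rplus_pow n) (g j)) \<and>
             L2_tendsto (Rplus_pow n) g f \<and>
             L2_tendsto path_law (\<lambda>j. mult_int_L1 n (g j)) W)" for W
  \<comment> \<open>\<open>mult_int_L1\<close> is known only up to null sets through
    square-integrable versions \<open>Y j\<close>. They give the same upper integrals, so
    \<open>L2_tendsto\<close> can be checked on them.\<close>
  have lim: "\<exists>Y. (\<forall>j. Y j \<in> L2_Omega) \<and> (\<lambda>j. sqdist (Y j) Z) \<longlonglongrightarrow> 0 \<and>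
      (\<forall>W. (\<lambda>j. \<integral>\<^sup>+u. ennreal ((mult_int_L1 n (g j) u - W u)\<^sup>2) \<partial>path_law) = (\<lambda>j. \<integral>\<^sup>+u. ennreal ((Y j u - W u)\<^sup>2) \<partial>path_law))"
    if g: "\<forall>j. g j \<in> L2_hat n \<and> integrable (Rplus_pow n) (g j)" and gf: "L2_tendsto (Rplus_pow n) g f" for g
  proof -
    have "\<forall>j. \<exists>Y. Y \<in> L2_Omega \<and> (\<lambda>N. sqdist (psum n (g j) N) Y) \<longlonglongrightarrow> 0"
      using psum_limit g by blast
    then obtain Y where Y: "\<And>j. Y j \<in> L2_Omega" "\<And>j. (\<lambda>N. sqdist (psum n (g j) N) (Y j)) \<longlonglongrightarrow> 0" by metis
    have ae: "AE u in path_law. mult_int_L1 n (g j) u = Y j u" for j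
      using g by (intro mult_int_L1_eq_limit Y) auto
    have up: "(\<lambda>j. ennreal (n ^ n) * (\<integral>\<^sup>+x. ennreal ((g j x - f x)\<^sup>2) \<partial>Rplus_pow n)) \<longlonglongrightarrow> ennreal (n ^ n) * 0"
      using gf unfolding L2_tendsto_def by (intro ennreal_tendsto_cmult) auto
    have "(\<lambda>j. ennreal (sqdist (Y j) Z)) \<longlonglongrightarrow> 0"
    proof (rule tendsto_sandwich)
      show "\<forall>\<^sub>F j in sequentially. 0 \<le> ennreal (sqdist (Y j) Z)" by simp
      have "ennreal (sqdist (Y j) Z) \<le> ennreal (n ^ n) * (\<integral>\<^sup>+x. ennreal ((g j x - f x)\<^sup>2) \<partial>Rplus_pow n)" for j
        by (rule psum_limit_continuous[OF _ f Y Z]) (use g in simp)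
      then show "\<forall>\<^sub>F j in sequentially. ennreal (sqdist (Y j) Z) \<le> ennreal (n ^ n) * (\<integral>\<^sup>+x. ennreal ((g j x - f x)\<^sup>2) \<partial>Rplus_pow n)"
        by simp
      show "(\<lambda>j. ennreal (n ^ n) * (\<integral>\<^sup>+x. ennreal ((g j x - f x)\<^sup>2) \<partial>Rplus_pow n)) \<longlonglongrightarrow> 0"
        using up by simp
    qed simp
    then have "(\<lambda>j. sqdist (Y j) Z) \<longlonglongrightarrow> 0"
      using tendsto_ennreal_iff[of "\<lambda>j. sqdist (Y j) Z" sequentially 0] by (simp add: sqdist_nonneg)
    moreover have "(\<integral>\<^sup>+u. ennreal ((mult_int_L1 n (g j) u - W u)\<^sup>2) \<partial>path_law) = (\<integral>\<^sup>+u. ennreal ((Y j u - W u)\<^sup>2) \<partial>path_law)" for j W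
      by (rule nn_integral_cong_AE) (use ae[of j] in \<open>auto elim!: eventually_mono\<close>)
    ultimately show ?thesis using Y(1) by (intro exI[of _ Y] conjI allI) auto
  qed
  have "Q Z"
  proof -
    have t: "\<forall>j. trunc n f j \<in> L2_hat n \<and> integrable (Rplus_pow n) (trunc n f j)"
      using trunc_L2_hat[OF f] trunc_integrable[OF f] by blast
    from lim[OF t trunc_tendsto[OF f]] obtain Y where Y: "\<And>j. Y j \<in> L2_Omega" "(\<lambda>j. sqdist (Y j) Z) \<longlonglongrightarrow> 0"
      "\<And>W. (\<lambda>j. \<integral>\<^sup>+u. ennreal ((mult_int_L1 n (trunc n f j) u - W u)\<^sup>2) \<partial>path_law) = (\<lambda>j. \<integral>\<^sup>+u. ennreal ((Y j u - W u)\<^sup>2) \<partial>path_law)"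
      by blast
    have "L2_tendsto path_law (\<lambda>j. mult_int_L1 n (trunc n f j)) Z"
      using L2_tendsto_iff[OF Y(1) Z(1)] Y(2) unfolding L2_tendsto_def Y(3) by simp
    then show ?thesis unfolding Q_def using Z(1) t trunc_tendsto[OF f] by blast
  qed
  have "mult_int n f = (SOME W. Q W)" unfolding mult_int_def Q_def using False by simp
  then have "Q (mult_int n f)" using someI[of Q, OF \<open>Q Z\<close>] by simp
  then obtain g where W: "mult_int n f \<in> L2_Omega" and g: "\<forall>j. g j \<in> L2_hat n \<and> integrable (Rplus_pow n) (g j)"
    and gf: "L2_tendsto (Rplus_pow n) g f" and gW: "L2_tendsto path_law (\<lambda>j. mult_int_L1 n (g j)) (mult_int n f)"
    unfolding Q_def by blast
  from lim[OF g gf] obtain Y where Y: "\<And>j. Y j \<in> L2_Omega" "(\<lambda>j. sqdist (Y j) Z) \<longlonglongrightarrow> 0"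
      "\<And>W. (\<lambda>j. \<integral>\<^sup>+u. ennreal ((mult_int_L1 n (g j) u - W u)\<^sup>2) \<partial>path_law) = (\<lambda>j. \<integral>\<^sup>+u. ennreal ((Y j u - W u)\<^sup>2) \<partial>path_law)"
    by blast
  have "(\<lambda>j. sqdist (Y j) (mult_int n f)) \<longlonglongrightarrow> 0"
    using L2_tendsto_iff[OF Y(1) W] gW unfolding L2_tendsto_def Y(3) by simp
  from sqdist_limit_unique[OF Y(1) W Z(1) this Y(2)] show ?thesis .
qed

text \<open>All that is kept of a multiple integral: its pairings with Hoeffding components. The
  pairing with a set of cardinality other than \<open>n\<close> is an empty sum, which yields
  orthogonality of different orders.\<close>

lemma mult_int_chaos:
  assumes f: "f \<in> L2_hat n"
  shows "\<exists>Z\<in>L2_Omega. (AE u in path_law. mult_int n f u = Z u) \<and>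
    (\<forall>K H. finite K \<longrightarrow> H \<in> L2_Omega \<longrightarrow> ip Z (hoeff K H) = (\<Sum>\<kappa>\<in>maps_onto n K. ip (kfun n f \<kappa>) (hoeff K H)))"
proof -
  obtain Z where Z: "Z \<in> L2_Omega" "(\<lambda>N. sqdist (psum n f N) Z) \<longlonglongrightarrow> 0" using psum_limit[OF f] by blast
  have "ip Z (hoeff K H) = (\<Sum>\<kappa>\<in>maps_onto n K. ip (kfun n f \<kappa>) (hoeff K H))" if K: "finite K" and H: "H \<in> L2_Omega" for K H
  proof -
    obtain m where m: "K \<subseteq> {..<m}" using K by (meson finite_nat_iff_bounded)
    have "ip (psum n f N) (hoeff K H) = (\<Sum>\<kappa>\<in>maps_onto n K. ip (kfun n f \<kappa>) (hoeff K H))" if "N \<ge> m" for N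
    proof -
      have L: "kfun n f \<kappa> \<in> L2_Omega" if "\<kappa> \<in> maps_below n N" for \<kappa>
        using that by (intro kernel_norm(1)[OF f]) (simp add: maps_below_def)
      have "ip (psum n f N) (hoeff K H) = (\<Sum>\<kappa>\<in>maps_below n N. ip (hoeff (\<kappa> ` {..<n}) (kfun n f \<kappa>)) (hoeff K H))"
        unfolding psum_def[abs_def] by (intro ip_sum_left hoeff_L2 L H)
      also have "\<dots> = (\<Sum>\<kappa>\<in>maps_below n N. if \<kappa> ` {..<n} = K then ip (kfun n f \<kappa>) (hoeff K H) else 0)"
        by (intro sum.cong refl) (auto simp: ip_hoeff_hoeff L H K ip_hoeff)
      also have "\<dots> = (\<Sum>\<kappa>\<in>maps_onto n K. if \<kappa> ` {..<n} = K then ip (kfun n f \<kappa>) (hoeff K H) else 0)"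
        using m that by (intro sum.mono_neutral_right finite_maps_below) (auto simp: maps_onto_def maps_below_def)
      also have "\<dots> = (\<Sum>\<kappa>\<in>maps_onto n K. ip (kfun n f \<kappa>) (hoeff K H))"
        by (intro sum.cong refl) (simp add: maps_onto_def)
      finally show ?thesis .
    qed
    then have "(\<lambda>N. ip (psum n f N) (hoeff K H)) \<longlonglongrightarrow> (\<Sum>\<kappa>\<in>maps_onto n K. ip (kfun n f \<kappa>) (hoeff K H))"
      by (intro tendsto_eventually) (auto simp: eventually_sequentially)
    moreover have "(\<lambda>N. ip (psum n f N) (hoeff K H)) \<longlonglongrightarrow> ip Z (hoeff K H)"
      by (rule sqdist_tendsto_ip[OF psum_L2[OF f] Z(1) hoeff_L2[OF H] Z(2)])
    ultimately show ?thesis by (rule LIMSEQ_unique[rotated])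
  qed
  then show ?thesis using Z mult_int_eq_limit[OF f Z] by blast
qed

section \<open>The chaos decomposition and the inverse of the number operator\<close>

definition cells :: "nat \<Rightarrow> (nat \<Rightarrow> real) \<Rightarrow> nat \<Rightarrow> nat" where
  "cells n x = (\<lambda>i\<in>{..<n}. nat \<lfloor>x i / 2\<rfloor>)"

text \<open>Recovers coordinates of a path from a point: the offset is stored at the index of its
  cell, with 0 at unoccupied cells. For distinct cells at most one summand survives, and the sum is
  visibly measurable and invariant under permutations of the positions.\<close>

definition offsets :: "nat \<Rightarrow> (nat \<Rightarrow> real) \<Rightarrow> nat \<Rightarrow> real" where
  "offsets n x j = (\<Sum>i<n. if cells n x i = j then x i - 2 * real j - 1 else 0)"

text \<open>
  Each set of cells is the image of \<open>card (maps_onto n K)\<close> injections, all of which occur in the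
  multiple integral.
\<close>

definition chaos_kernel :: "nat \<Rightarrow> ((nat \<Rightarrow> real) \<Rightarrow> real) \<Rightarrow> (nat \<Rightarrow> real) \<Rightarrow> real" where
  "chaos_kernel n F x = (if inj_on (cells n x) {..<n}
     then hoeff (cells n x ` {..<n}) F (offsets n x) / real (card (maps_onto n (cells n x ` {..<n}))) else 0)"

lemma space_half_pow: "x \<in> space (half_pow I) \<longleftrightarrow> x \<in> extensional I \<and> (\<forall>i\<in>I. 0 \<le> x i)"
  by (auto simp: space_PiM space_halfline PiE_iff)

lemma measurable_chaos_kernel:
  assumes F: "F \<in> L2_Omega"
  shows "chaos_kernel n F \<in> borel_measurable (half_pow {..<n})"
proof -
  let ?M = "half_pow {..<n}"
  note [measurable] = measurable_half_pow_component
  have [measurable]: "hoeff K F \<in> borel_measurable path_law" for K using hoeff_L2[OF F] by measurable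
  let ?I = "{..<n} \<rightarrow>\<^sub>E (UNIV :: nat set)"
  have cnt: "countable ?I" by (intro countable_PiE) auto
  have cell: "{x \<in> space ?M. nat \<lfloor>x i / 2\<rfloor> = k} \<in> sets ?M" if "i \<in> {..<n}" for i k
    using that by measurable
  have cm: "cells n \<in> measurable ?M (count_space ?I)"
    unfolding measurable_count_space_eq_countable[OF cnt]
  proof (intro conjI ballI)
    show "cells n \<in> space ?M \<rightarrow> ?I" by (auto simp: cells_def)
    fix k assume k: "k \<in> ?I"
    have "cells n x = k \<longleftrightarrow> (\<forall>i\<in>{..<n}. nat \<lfloor>x i / 2\<rfloor> = k i)" for x
    proof
      assume "cells n x = k"
      then have "k i = cells n x i" for i by simp
      then show "\<forall>i\<in>{..<n}. nat \<lfloor>x i / 2\<rfloor> = k i" by (simp add: cells_def)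
    next
      assume *: "\<forall>i\<in>{..<n}. nat \<lfloor>x i / 2\<rfloor> = k i"
      show "cells n x = k"
        by (rule extensionalityI[of _ "{..<n}"]) (use * k in \<open>simp_all add: cells_def PiE_iff\<close>)
    qed
    then have "cells n -` {k} \<inter> space ?M = {x \<in> space ?M. \<forall>i\<in>{..<n}. nat \<lfloor>x i / 2\<rfloor> = k i}"
      by auto
    also have "\<dots> \<in> sets ?M" using cell by (intro sets.sets_Collect_finite_All) auto
    finally show "cells n -` {k} \<inter> space ?M \<in> sets ?M" .
  qed
  define off where "off k x j = (\<Sum>i<n. if k i = j then x i - 2 * real j - 1 else 0)" for k :: "nat \<Rightarrow> nat" and x :: "nat \<Rightarrow> real" and j
  have [measurable]: "off k \<in> measurable ?M path_law" for k
    by (rule measurable_path_law) (simp add: off_def)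
  define G where "G k x = (if inj_on k {..<n} then hoeff (k ` {..<n}) F (off k x) / real (card (maps_onto n (k ` {..<n}))) else 0)" for k x
  have "(\<lambda>x. G (cells n x) x) \<in> borel_measurable ?M"
    by (rule measurable_compose_countable'[OF _ cm cnt]) (simp add: G_def)
  moreover have "G (cells n x) x = chaos_kernel n F x" for x
    unfolding G_def chaos_kernel_def off_def offsets_def[abs_def] ..
  ultimately show ?thesis by simp
qed

lemma chaos_kernel_off_Delta:
  assumes "x \<in> space (half_pow {..<n})" "x \<notin> Delta n"
  shows "chaos_kernel n F x = 0"
proof -
  have "\<not> inj_on (cells n x) {..<n}"
  proof
    assume inj: "inj_on (cells n x) {..<n}"
    have "x i \<in> {2 * real (cells n x i)..2 * real (cells n x i) + 2}" if "i < n" for i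
    proof -
      have "0 \<le> x i" using assms(1) that by (simp add: space_half_pow)
      then have "0 \<le> \<lfloor>x i / 2\<rfloor>" by simp
      then have "real (cells n x i) = of_int \<lfloor>x i / 2\<rfloor>" using that by (simp add: cells_def)
      moreover have "2 * of_int \<lfloor>x i / 2\<rfloor> \<le> x i" "x i \<le> 2 * of_int \<lfloor>x i / 2\<rfloor> + 2" by linarith+
      ultimately show ?thesis by simp
    qed
    moreover have "cells n x \<in> {..<n} \<rightarrow>\<^sub>E UNIV" by (simp add: cells_def)
    moreover have "x \<in> extensional {..<n}" using assms(1) by (simp add: space_half_pow)
    ultimately have "x \<in> (\<Pi>\<^sub>E i\<in>{..<n}. {2 * real (cells n x i)..2 * real (cells n x i) + 2})"
      by (simp add: PiE_iff)
    then have "x \<in> Delta n"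
      unfolding Delta_def using inj \<open>cells n x \<in> {..<n} \<rightarrow>\<^sub>E UNIV\<close> by blast
    then show False using assms(2) by simp
  qed
  then show ?thesis by (simp add: chaos_kernel_def)
qed

lemma chaos_kernel_symmetric:
  assumes \<pi>: "\<pi> permutes {..<n}"
  shows "chaos_kernel n F (x \<circ> \<pi>) = chaos_kernel n F x"
proof -
  have c: "cells n (x \<circ> \<pi>) i = cells n x (\<pi> i)" if "i < n" for i
    using that permutes_in_image[OF \<pi>, of i] by (simp add: cells_def)
  have im: "cells n (x \<circ> \<pi>) ` {..<n} = cells n x ` {..<n}"
  proof -
    have "cells n (x \<circ> \<pi>) ` {..<n} = cells n x ` \<pi> ` {..<n}" unfolding image_image using c by (intro image_cong) auto
    then show ?thesis by (simp add: permutes_image[OF \<pi>])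
  qed
  have inj: "inj_on (cells n (x \<circ> \<pi>)) {..<n} \<longleftrightarrow> inj_on (cells n x) {..<n}"
    using im by (simp add: inj_on_iff_eq_card)
  have "offsets n (x \<circ> \<pi>) j = offsets n x j" for j
  proof -
    have "offsets n (x \<circ> \<pi>) j = (\<Sum>i<n. ((\<lambda>i. if cells n x i = j then x i - 2 * real j - 1 else 0) \<circ> \<pi>) i)"
      unfolding offsets_def using c by (intro sum.cong) auto
    also have "\<dots> = offsets n x j" unfolding offsets_def by (rule sum.permute[OF \<pi>, symmetric])
    finally show ?thesis .
  qed
  then have "offsets n (x \<circ> \<pi>) = offsets n x" by auto
  then show ?thesis unfolding chaos_kernel_def im inj by simp
qed

text \<open>Strictly inside the cells, the floor recovers \<open>\<kappa>\<close> and the offsets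
  recover \<open>u\<close> on its image, which are the only coordinates that the component depends
  on.\<close>

lemma kfun_chaos_kernel:
  assumes u: "\<And>i. \<bar>u i\<bar> < 1" and \<kappa>: "\<kappa> \<in> inj_maps n"
  shows "kfun n (chaos_kernel n F) \<kappa> u = hoeff (\<kappa> ` {..<n}) F u / real (card (maps_onto n (\<kappa> ` {..<n})))"
proof -
  have inj: "inj_on \<kappa> {..<n}" using \<kappa> by (simp add: inj_maps_def)
  let ?x = "\<lambda>i\<in>{..<n}. 2 * real (\<kappa> i) + 1 + trim (u (\<kappa> i))"
  have cell: "cells n ?x i = \<kappa> i" if "i < n" for i
  proof -
    have "\<lfloor>(2 * real (\<kappa> i) + 1 + u (\<kappa> i)) / 2\<rfloor> = int (\<kappa> i)"
      using u[of "\<kappa> i"] by (intro floor_unique) (auto simp: abs_less_iff)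
    then show ?thesis using that u[of "\<kappa> i"] by (simp add: cells_def trim_eq less_imp_le)
  qed
  have im: "cells n ?x ` {..<n} = \<kappa> ` {..<n}" using cell by (intro image_cong) auto
  have "inj_on (cells n ?x) {..<n}" using inj cell by (simp add: inj_on_def)
  moreover have "hoeff (\<kappa> ` {..<n}) F (offsets n ?x) = hoeff (\<kappa> ` {..<n}) F u"
  proof (rule hoeff_cong_on)
    fix j assume "j \<in> \<kappa> ` {..<n}"
    then obtain i where i: "i < n" "j = \<kappa> i" by auto
    have "offsets n ?x j = (\<Sum>i'<n. if i' = i then u (\<kappa> i) else 0)"
      unfolding offsets_def
    proof (intro sum.cong refl)
      fix i' assume "i' \<in> {..<n}"
      then have i': "i' < n" by simp
      then have "cells n ?x i' = j \<longleftrightarrow> i' = i" using cell[OF i'] i inj_onD[OF inj] by auto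
      then show "(if cells n ?x i' = j then ?x i' - 2 * real j - 1 else 0) = (if i' = i then u (\<kappa> i) else 0)"
        using i u[of "\<kappa> i"] by (simp add: trim_eq less_imp_le)
    qed
    then show "offsets n ?x j = u j" using i by simp
  qed
  ultimately show ?thesis unfolding kfun_def chaos_kernel_def im by simp
qed

lemma maps_onto_nonempty:
  assumes "finite K" shows "maps_onto (card K) K \<noteq> {}"
proof -
  obtain h where h: "bij_betw h {..<card K} K"
    using finite_same_card_bij[of "{..<card K}" K] assms by auto
  have "restrict h {..<card K} \<in> maps_onto (card K) K"
    using h unfolding maps_onto_def inj_maps_def bij_betw_def by simp
  then show ?thesis by blast
qed

lemma card_maps_onto_pos: "finite K \<Longrightarrow> card K = n \<Longrightarrow> 1 \<le> card (maps_onto n K)"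
  using maps_onto_nonempty[of K] maps_onto_finite_card(1)[of K n] by (simp add: Suc_le_eq card_gt_0_iff)

text \<open>For a fixed set \<open>K\<close>, the maps onto it number
  \<open>m = card (maps_onto n K)\<close> and each contributes the squared norm of the component
  divided by \<open>m^2\<close>. Their total is at most that squared norm, and Bessel's inequality
  bounds the sum over \<open>K\<close>.\<close>

lemma chaos_kernel_L2_hat:
  assumes F: "F \<in> L2_Omega"
  shows "chaos_kernel n F \<in> L2_hat n"
proof -
  let ?f = "chaos_kernel n F"
  note fm = measurable_chaos_kernel[OF F, of n]
  note kL = hoeff_L2[OF F]
  let ?c = "\<lambda>\<kappa>. real (card (maps_onto n (\<kappa> ` {..<n})))"
  let ?a = "\<lambda>K. ip (hoeff K F) F"
  let ?w = "\<lambda>\<kappa>. ?a (\<kappa> ` {..<n}) / (?c \<kappa>)\<^sup>2"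
  have w0: "0 \<le> ?w \<kappa>" for \<kappa> using ip_hoeff_nonneg[OF F, of "\<kappa> ` {..<n}"] by simp
  have q: "(\<integral>\<^sup>+u. ennreal ((kfun n ?f \<kappa> u)\<^sup>2) \<partial>path_law) = ennreal (?w \<kappa>)" if \<kappa>: "\<kappa> \<in> inj_maps n" for \<kappa>
  proof -
    have "(\<integral>\<^sup>+u. ennreal ((kfun n ?f \<kappa> u)\<^sup>2) \<partial>path_law)
        = (\<integral>\<^sup>+u. ennreal ((1 / ?c \<kappa> * hoeff (\<kappa> ` {..<n}) F u)\<^sup>2) \<partial>path_law)"
      by (rule nn_integral_cong_AE) (use AE_path in \<open>eventually_elim, simp add: kfun_chaos_kernel \<kappa>\<close>)
    also have "\<dots> = ennreal (ip (\<lambda>u. 1 / ?c \<kappa> * hoeff (\<kappa> ` {..<n}) F u) (\<lambda>u. 1 / ?c \<kappa> * hoeff (\<kappa> ` {..<n}) F u))"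
      by (rule nn_integral_square) (intro L2_scale kL)
    also have "\<dots> = ennreal (?w \<kappa>)"
      unfolding ip_scale_left ip_scale_right using F by (simp add: ip_hoeff_self power2_eq_square)
    finally show ?thesis .
  qed
  have "?w summable_on inj_maps n"
  proof (rule nonneg_bdd_above_summable_on)
    show "bdd_above (sum ?w ` {A. A \<subseteq> inj_maps n \<and> finite A})"
    proof (rule bdd_aboveI2)
      fix A assume A: "A \<in> {A. A \<subseteq> inj_maps n \<and> finite A}"
      let ?im = "\<lambda>\<kappa> :: nat \<Rightarrow> nat. \<kappa> ` {..<n}"
      have "sum ?w A = (\<Sum>K\<in>?im ` A. \<Sum>\<kappa>\<in>{\<kappa> \<in> A. ?im \<kappa> = K}. ?w \<kappa>)"
        by (rule sum.group[symmetric]) (use A in auto)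
      also have "\<dots> \<le> (\<Sum>K\<in>?im ` A. ?a K)"
      proof (rule sum_mono)
        fix K assume "K \<in> ?im ` A"
        then have K: "finite K" "card K = n" using A card_image_inj_maps by auto
        let ?m = "real (card (maps_onto n K))"
        have m: "1 \<le> ?m" using card_maps_onto_pos[OF K] by simp
        have a: "0 \<le> ?a K" by (rule ip_hoeff_nonneg[OF F K(1)])
        have "card {\<kappa> \<in> A. ?im \<kappa> = K} \<le> card (maps_onto n K)"
          using A by (intro card_mono maps_onto_finite_card K) (auto simp: maps_onto_def)
        then have "real (card {\<kappa> \<in> A. ?im \<kappa> = K}) * (?a K / ?m\<^sup>2) \<le> ?m * (?a K / ?m\<^sup>2)"
          using a by (intro mult_right_mono) auto
        then have "(\<Sum>\<kappa>\<in>{\<kappa> \<in> A. ?im \<kappa> = K}. ?w \<kappa>) \<le> ?m * (?a K / ?m\<^sup>2)" by simp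
        also have "\<dots> = ?a K / ?m" using m by (simp add: power2_eq_square)
        also have "\<dots> \<le> ?a K" using divide_left_mono[of 1 ?m "?a K"] a m by simp
        finally show "(\<Sum>\<kappa>\<in>{\<kappa> \<in> A. ?im \<kappa> = K}. ?w \<kappa>) \<le> ?a K" .
      qed
      also have "\<dots> \<le> ip F F" using A by (intro Bessel F) auto
      finally show "sum ?w A \<le> ip F F" .
    qed
  qed (use w0 in simp)
  then have "Infinite_Sum.abs_summable_on ?w (inj_maps n)" using w0 by (simp only: real_norm_def abs_of_nonneg)
  then have "Infinite_Set_Sum.abs_summable_on ?w (inj_maps n)" by (simp only: abs_summable_equivalent)
  then have wfin: "(\<integral>\<^sup>+\<kappa>. ennreal (?w \<kappa>) \<partial>count_space (inj_maps n)) < \<infinity>"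
    unfolding Infinite_Set_Sum.abs_summable_on_def integrable_iff_bounded using w0 by (simp only: real_norm_def abs_of_nonneg)
  have "(\<integral>\<^sup>+x. ennreal ((?f x)\<^sup>2) \<partial>Rplus_pow n)
      = 2 ^ n * (\<integral>\<^sup>+\<kappa>. (\<integral>\<^sup>+u. ennreal ((kfun n ?f \<kappa> u)\<^sup>2) \<partial>path_law) \<partial>count_space (inj_maps n))"
    by (rule nn_integral_kernel'[OF fm chaos_kernel_off_Delta, of "\<lambda>x. ennreal (x\<^sup>2)"]) auto
  also have "(\<integral>\<^sup>+\<kappa>. (\<integral>\<^sup>+u. ennreal ((kfun n ?f \<kappa> u)\<^sup>2) \<partial>path_law) \<partial>count_space (inj_maps n))
      = (\<integral>\<^sup>+\<kappa>. ennreal (?w \<kappa>) \<partial>count_space (inj_maps n))"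
    by (rule nn_integral_cong) (simp add: q)
  also have "2 ^ n * \<dots> < \<infinity>" using wfin by (simp add: ennreal_mult_less_top power_less_top_ennreal)
  finally have "integrable (Rplus_pow n) (\<lambda>x. (?f x)\<^sup>2)"
    using fm by (intro integrableI_bounded) (auto simp: Rplus_pow_def)
  then show ?thesis
    unfolding L2_hat_def using fm chaos_kernel_symmetric chaos_kernel_off_Delta
    by (auto simp: Rplus_pow_def)
qed

text \<open>The multiple integral counts the component on \<open>K\<close> once for every injection
  onto \<open>K\<close>; the normalisation of the kernel undoes this, leaving the components with
  \<open>card K = n\<close>, each once.\<close>

lemma chaos_component:
  assumes F: "F \<in> L2_Omega"
  shows "\<exists>Z\<in>L2_Omega. (AE u in path_law. mult_int n (chaos_kernel n F) u = Z u) \<and>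
    (\<forall>K H. finite K \<longrightarrow> H \<in> L2_Omega \<longrightarrow> ip Z (hoeff K H) = (if card K = n then ip (hoeff K F) H else 0))"
proof -
  note fL = chaos_kernel_L2_hat[OF F, of n]
  obtain Z where Z: "Z \<in> L2_Omega" "AE u in path_law. mult_int n (chaos_kernel n F) u = Z u"
    "\<And>K H. finite K \<Longrightarrow> H \<in> L2_Omega \<Longrightarrow> ip Z (hoeff K H) = (\<Sum>\<kappa>\<in>maps_onto n K. ip (kfun n (chaos_kernel n F) \<kappa>) (hoeff K H))"
    using mult_int_chaos[OF fL] by blast
  have "ip Z (hoeff K H) = (if card K = n then ip (hoeff K F) H else 0)" if K: "finite K" and H: "H \<in> L2_Omega" for K H
  proof (cases "card K = n")
    case True
    let ?c = "real (card (maps_onto n K))"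
    have c: "?c \<noteq> 0" using card_maps_onto_pos[OF K True] by simp
    have "ip (kfun n (chaos_kernel n F) \<kappa>) (hoeff K H) = ip (hoeff K F) H / ?c" if "\<kappa> \<in> maps_onto n K" for \<kappa>
    proof -
      have \<kappa>: "\<kappa> \<in> inj_maps n" "\<kappa> ` {..<n} = K" using that by (auto simp: maps_onto_def)
      have "ip (kfun n (chaos_kernel n F) \<kappa>) (hoeff K H) = ip (\<lambda>u. 1 / ?c * hoeff K F u) (hoeff K H)"
      proof (rule ip_cong_AE)
        show "AE u in path_law. kfun n (chaos_kernel n F) \<kappa> u = 1 / ?c * hoeff K F u"
          using AE_path by eventually_elim (simp add: kfun_chaos_kernel \<kappa>)
      qed (intro kernel_norm(1)[OF fL \<kappa>(1)] L2_scale hoeff_L2 F H)+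
      also have "\<dots> = ip (hoeff K F) H / ?c"
        unfolding ip_scale_left using F H K by (simp add: ip_hoeff_hoeff)
      finally show ?thesis .
    qed
    then have "ip Z (hoeff K H) = ?c * (ip (hoeff K F) H / ?c)" unfolding Z(3)[OF K H] by simp
    then show ?thesis using True c by simp
  next
    case False
    then show ?thesis using Z(3)[OF K H] maps_onto_empty[OF False] by simp
  qed
  then show ?thesis using Z(1,2) by blast
qed

section \<open>Diagonal multipliers on Hoeffding components and the existence of the chaos
  decomposition\<close>

lemma multiplier_norm:
  assumes D: "D \<in> L2_Omega" and F: "F \<in> L2_Omega"
    and w: "\<And>K H. finite K \<Longrightarrow> H \<in> L2_Omega \<Longrightarrow> ip D (hoeff K H) = w K * ip (hoeff K F) H"
  shows "((\<lambda>K. (w K)\<^sup>2 * ip (hoeff K F) F) has_sum ip D D) {K. finite K}"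
proof -
  have *: "ip (hoeff K D) D = (w K)\<^sup>2 * ip (hoeff K F) F" if K: "finite K" for K
  proof -
    have "ip (hoeff K D) D = w K * ip (hoeff K F) D"
      using w[OF K D] D by (simp add: ip_hoeff)
    also have "ip (hoeff K F) D = ip D (hoeff K F)" by (rule ip_commute)
    also have "\<dots> = w K * ip (hoeff K F) F" by (rule w[OF K F])
    finally show ?thesis by (simp add: power2_eq_square)
  qed
  show ?thesis
    using Parseval(2)[OF D D] by (rule has_sum_cong[THEN iffD1, rotated]) (simp add: *)
qed

lemma tail_tendsto_0:
  assumes F: "F \<in> L2_Omega"
  shows "(\<lambda>m::nat. infsum (\<lambda>K. if m < card K then ip (hoeff K F) F else 0) {K. finite K}) \<longlonglongrightarrow> 0" (is "?t \<longlonglongrightarrow> 0")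
    and "(\<lambda>K. if m < card K then ip (hoeff K F) F else 0) summable_on {K. finite K}"
proof -
  let ?a = "\<lambda>K. ip (hoeff K F) F"
  let ?S = "{K :: nat set. finite K}"
  have hs: "(?a has_sum ip F F) ?S" by (rule Parseval(2)[OF F F])
  have nn: "0 \<le> ?a K" if "K \<in> ?S" for K using ip_hoeff_nonneg[OF F] that by simp
  show sm: "(\<lambda>K. if m < card K then ?a K else 0) summable_on ?S" for m
    by (rule summable_on_comparison_test[OF has_sum_imp_summable[OF hs]]) (use nn in auto)
  have t0: "0 \<le> ?t m" for m by (intro infsum_nonneg) (use nn in auto)
  show "?t \<longlonglongrightarrow> 0"
  proof (rule LIMSEQ_I)
    fix e :: real assume e: "0 < e"
    have "\<forall>\<^sub>F X in finite_subsets_at_top ?S. dist (sum ?a X) (ip F F) < e"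
      using hs e unfolding has_sum_def by (rule tendstoD)
    then obtain X where X: "finite X" "X \<subseteq> ?S" "dist (sum ?a X) (ip F F) < e"
      unfolding eventually_finite_subsets_at_top by blast
    \<comment> \<open>Beyond the largest cardinality occurring in \<open>X\<close>, the sets counted
      by the tail are disjoint from \<open>X\<close>, and Bessel's inequality for the union leaves
      only the small rest for them.\<close>
    define m0 where "m0 = Max (insert 0 (card ` X))"
    have "norm (?t m - 0) < e" if "m \<ge> m0" for m
    proof -
      have cX: "card K \<le> m" if "K \<in> X" for K
      proof -
        have "card K \<le> m0" unfolding m0_def using X(1) that by (intro Max_ge) auto
        then show ?thesis using \<open>m \<ge> m0\<close> by simp
      qed
      have "?t m \<le> ip F F - sum ?a X"
      proof (rule infsum_le_finite_sums[OF sm])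
        fix Y assume Y: "finite Y" "Y \<subseteq> ?S"
        have "(\<Sum>K\<in>Y. if m < card K then ?a K else 0) = (\<Sum>K\<in>{K \<in> Y. m < card K}. ?a K)"
          using Y(1) by (intro sum.inter_filter[symmetric])
        moreover have "(\<Sum>K\<in>{K \<in> Y. m < card K}. ?a K) + sum ?a X = sum ?a ({K \<in> Y. m < card K} \<union> X)"
          using Y(1) X(1) cX by (intro sum.union_disjoint[symmetric]) (auto simp: not_less[symmetric])
        moreover have "\<dots> \<le> ip F F" using X Y by (intro Bessel F) auto
        ultimately show "(\<Sum>K\<in>Y. if m < card K then ?a K else 0) \<le> ip F F - sum ?a X" by linarith
      qed
      then show ?thesis using X(3) t0[of m] by (simp add: dist_real_def)
    qed
    then show "\<exists>m0. \<forall>m\<ge>m0. norm (?t m - 0) < e" by blast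
  qed
qed

text \<open>Guarantees that the choice in \<open>L_inv\<close> is meaningful. Taking the kernels of
  the Hoeffding components, all the errors to be estimated multiply each component of
  \<open>F\<close> by a number, so Parseval turns their norms into tails of the norm of
  \<open>F\<close>.\<close>

lemma L_inv_exists:
  assumes F: "F \<in> L2_Omega" and mean: "(\<integral>u. F u \<partial>path_law) = 0"
  shows "\<exists>Y. Y \<in> L2_Omega \<and>
     (\<exists>f. (\<forall>n\<ge>1. f n \<in> L2_hat n) \<and>
          L2_tendsto path_law (\<lambda>m u. \<Sum>n=1..m. mult_int n (f n) u) F \<and>
          L2_tendsto path_law (\<lambda>m u. \<Sum>n=1..m. - (1 / real n) * mult_int n (f n) u) Y)"
proof -
  let ?f = "\<lambda>n. chaos_kernel n F"
  let ?t = "\<lambda>m::nat. infsum (\<lambda>K. if m < card K then ip (hoeff K F) F else 0) {K. finite K}"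
  have "\<forall>n. \<exists>Z. Z \<in> L2_Omega \<and> (AE u in path_law. mult_int n (?f n) u = Z u) \<and>
    (\<forall>K H. finite K \<longrightarrow> H \<in> L2_Omega \<longrightarrow> ip Z (hoeff K H) = (if card K = n then ip (hoeff K F) H else 0))"
    using chaos_component[OF F] by blast
  then obtain Z where Z: "\<And>n. Z n \<in> L2_Omega" "\<And>n. AE u in path_law. mult_int n (?f n) u = Z n u"
    "\<And>n K H. finite K \<Longrightarrow> H \<in> L2_Omega \<Longrightarrow> ip (Z n) (hoeff K H) = (if card K = n then ip (hoeff K F) H else 0)"
    by metis
  define S where "S c m u = (\<Sum>n=1..m. c n * Z n u)" for c :: "nat \<Rightarrow> real" and m u
  have SL: "S c m \<in> L2_Omega" for c m
    unfolding S_def[abs_def] by (intro L2_sum L2_scale Z)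
  have Sw: "ip (S c m) (hoeff K H) = (if 1 \<le> card K \<and> card K \<le> m then c (card K) else 0) * ip (hoeff K F) H"
    if "finite K" "H \<in> L2_Omega" for c m K H
  proof -
    have "ip (S c m) (hoeff K H) = (\<Sum>n=1..m. c n * ip (Z n) (hoeff K H))"
      unfolding S_def[abs_def] using that by (subst ip_sum_left) (auto intro!: L2_scale Z hoeff_L2 simp: ip_scale_left)
    also have "\<dots> = (\<Sum>n=1..m. if card K = n then c n * ip (hoeff K F) H else 0)"
      by (intro sum.cong refl) (simp add: Z(3) that)
    finally show ?thesis by (simp add: sum.delta)
  qed
  have AE_S: "AE u in path_law. (\<Sum>n=1..m. c n * mult_int n (?f n) u) = S c m u" for c m
  proof -
    have "AE u in path_law. \<forall>n\<in>{1..m}. mult_int n (?f n) u = Z n u"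
      by (intro AE_finite_allI Z) auto
    then show ?thesis by eventually_elim (simp add: S_def)
  qed
  \<comment> \<open>Centring removes the component of the empty set, the one that sums starting at
    order 1 cannot reach.\<close>
  have zero: "ip (hoeff K F) H = 0" if "card K = 0" "finite K" for K H
    using that mean by (simp add: ip_def hoeff_empty)
  have conv: "L2_tendsto path_law (\<lambda>m u. \<Sum>n=1..m. c n * mult_int n (?f n) u) W"
    if "W \<in> L2_Omega" "(\<lambda>m. sqdist (S c m) W) \<longlonglongrightarrow> 0" for c W
  proof -
    have "(\<integral>\<^sup>+u. ennreal (((\<Sum>n=1..m. c n * mult_int n (?f n) u) - W u)\<^sup>2) \<partial>path_law) = (\<integral>\<^sup>+u. ennreal ((S c m u - W u)\<^sup>2) \<partial>path_law)" for m
      by (rule nn_integral_cong_AE) (use AE_S[of c m] in \<open>auto elim!: eventually_mono\<close>)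
    then show ?thesis using L2_tendsto_iff[OF SL that(1)] that(2) unfolding L2_tendsto_def by simp
  qed
  \<comment> \<open>Covers both the error of the partial sums of \<open>F\<close> and the
    differences of the partial sums of \<open>L_inv F\<close>: the multipliers vanish on nonempty
    sets with at most \<open>m\<close> elements and never exceed 1 in modulus on larger
    ones.\<close>
  have bound: "ip D D \<le> ?t m" if D: "D \<in> L2_Omega"
    and w: "\<And>K H. finite K \<Longrightarrow> H \<in> L2_Omega \<Longrightarrow> ip D (hoeff K H) = w K * ip (hoeff K F) H"
    and w1: "\<And>K. finite K \<Longrightarrow> 1 \<le> card K \<Longrightarrow> \<bar>w K\<bar> \<le> (if m < card K then 1 else 0)" for D w m
  proof -
    have "(w K)\<^sup>2 * ip (hoeff K F) F \<le> (if m < card K then ip (hoeff K F) F else 0)" if K: "finite K" for K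
    proof (cases "card K = 0")
      case True then show ?thesis using zero[OF True K, of F] by simp
    next
      case False
      then have "\<bar>w K\<bar> \<le> (if m < card K then 1 else 0)" using w1[OF K] by simp
      then have "(w K)\<^sup>2 \<le> (if m < card K then 1 else 0)"
        by (auto simp: abs_square_le_1 split: if_splits)
      then have "(w K)\<^sup>2 * ip (hoeff K F) F \<le> (if m < card K then 1 else 0) * ip (hoeff K F) F"
        by (intro mult_right_mono ip_hoeff_nonneg F K)
      then show ?thesis by (simp split: if_splits)
    qed
    then show ?thesis
      using has_sum_mono[OF multiplier_norm[OF D F w] has_sum_infsum[OF tail_tendsto_0(2)[OF F, where m=m]]] by simp
  qed
  have "sqdist (S (\<lambda>_. 1) m) F \<le> ?t m" for m
    unfolding sqdist_commute[of _ F] unfolding sqdist_def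
  proof (rule bound)
    show "(\<lambda>u. F u - S (\<lambda>_. 1) m u) \<in> L2_Omega" by (intro L2_diff F SL)
    fix K :: "nat set" and H assume "finite K" "H \<in> L2_Omega"
    then show "ip (\<lambda>u. F u - S (\<lambda>_. 1) m u) (hoeff K H) = (1 - (if 1 \<le> card K \<and> card K \<le> m then 1 else 0)) * ip (hoeff K F) H"
      using F by (simp add: ip_diff_left SL hoeff_L2 Sw ip_hoeff)
  qed auto
  then have "(\<lambda>m. sqdist (S (\<lambda>_. 1) m) F) \<longlonglongrightarrow> 0"
    by (intro Lim_null_comparison[OF _ tail_tendsto_0(1)[OF F]]) (simp add: sqdist_nonneg)
  from conv[OF F this] have 1: "L2_tendsto path_law (\<lambda>m u. \<Sum>n=1..m. mult_int n (?f n) u) F" by simp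
  let ?c = "\<lambda>n. - (1 / real n)"
  have le: "sqdist (S ?c m') (S ?c m) \<le> ?t m" if "m \<le> m'" for m m'
    unfolding sqdist_def
  proof (rule bound)
    show "(\<lambda>u. S ?c m' u - S ?c m u) \<in> L2_Omega" by (intro L2_diff SL)
    fix K :: "nat set" and H assume "finite K" "H \<in> L2_Omega"
    then show "ip (\<lambda>u. S ?c m' u - S ?c m u) (hoeff K H)
        = (if m < card K \<and> card K \<le> m' then ?c (card K) else 0) * ip (hoeff K F) H"
      using \<open>m \<le> m'\<close> by (simp add: ip_diff_left SL hoeff_L2 Sw)
  qed auto
  have "\<exists>N. \<forall>i\<ge>N. \<forall>j\<ge>N. sqdist (S ?c i) (S ?c j) < e" if e: "0 < e" for e
  proof -
    from LIMSEQ_D[OF tail_tendsto_0(1)[OF F] e] obtain N where N: "\<And>m. m \<ge> N \<Longrightarrow> \<bar>?t m\<bar> < e" by auto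
    have "sqdist (S ?c i) (S ?c j) < e" if "i \<ge> N" "j \<ge> N" for i j
      using le[of i j] le[of j i] N[OF that(1)] N[OF that(2)] sqdist_commute[of "S ?c i" "S ?c j"]
      by (cases "i \<le> j") auto
    then show ?thesis by blast
  qed
  from L2_complete[OF SL this] obtain Y where Y: "Y \<in> L2_Omega" "(\<lambda>m. sqdist (S ?c m) Y) \<longlonglongrightarrow> 0" by blast
  have 2: "L2_tendsto path_law (\<lambda>m u. \<Sum>n=1..m. - (1 / real n) * mult_int n (?f n) u) Y"
    by (rule conv[OF Y])
  show ?thesis
    by (rule exI[of _ Y], rule conjI[OF Y(1)], rule exI[of _ ?f])
      (intro conjI allI impI 1 2 chaos_kernel_L2_hat[OF F])
qed

text \<open>The kernels behind the chosen value are unknown, but a component on a set of n elements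
  sees only the term of order n in both series, and these terms differ by the factor -1/n. No term
  has order 0, so the pairing with the empty component is 0, in agreement with
  \<open>1 / 0 = 0\<close>.\<close>

lemma L_inv:
  assumes F: "F \<in> L2_Omega" and mean: "(\<integral>u. F u \<partial>path_law) = 0"
  shows "L_inv F \<in> L2_Omega"
    and "finite K \<Longrightarrow> H \<in> L2_Omega \<Longrightarrow> ip (L_inv F) (hoeff K H) = - (1 / real (card K)) * ip (hoeff K F) H"
proof -
  let ?Y = "L_inv F"
  from someI_ex[OF L_inv_exists[OF assms]] obtain f where Y: "?Y \<in> L2_Omega" and f: "\<And>n. n \<ge> 1 \<Longrightarrow> f n \<in> L2_hat n"
    and limF: "L2_tendsto path_law (\<lambda>m u. \<Sum>n=1..m. mult_int n (f n) u) F"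
    and limY: "L2_tendsto path_law (\<lambda>m u. \<Sum>n=1..m. - (1 / real n) * mult_int n (f n) u) ?Y"
    unfolding L_inv_def[symmetric] by blast
  show "?Y \<in> L2_Omega" by fact
  have "\<forall>n. \<exists>Z. n \<ge> 1 \<longrightarrow> Z \<in> L2_Omega \<and> (AE u in path_law. mult_int n (f n) u = Z u) \<and>
    (\<forall>K H. finite K \<longrightarrow> H \<in> L2_Omega \<longrightarrow> ip Z (hoeff K H) = (\<Sum>\<kappa>\<in>maps_onto n K. ip (kfun n (f n) \<kappa>) (hoeff K H)))"
    using mult_int_chaos f by blast
  from choice[OF this] obtain Z where Z': "\<forall>n. n \<ge> 1 \<longrightarrow> Z n \<in> L2_Omega \<and> (AE u in path_law. mult_int n (f n) u = Z n u) \<and>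
    (\<forall>K H. finite K \<longrightarrow> H \<in> L2_Omega \<longrightarrow> ip (Z n) (hoeff K H) = (\<Sum>\<kappa>\<in>maps_onto n K. ip (kfun n (f n) \<kappa>) (hoeff K H)))" ..
  have Z: "\<And>n. n \<ge> 1 \<Longrightarrow> Z n \<in> L2_Omega" "\<And>n. n \<ge> 1 \<Longrightarrow> AE u in path_law. mult_int n (f n) u = Z n u"
    "\<And>n K H. n \<ge> 1 \<Longrightarrow> finite K \<Longrightarrow> H \<in> L2_Omega \<Longrightarrow> ip (Z n) (hoeff K H) = (\<Sum>\<kappa>\<in>maps_onto n K. ip (kfun n (f n) \<kappa>) (hoeff K H))"
    using Z' by simp_all
  define S where "S c m u = (\<Sum>n=1..m. c n * Z n u)" for c :: "nat \<Rightarrow> real" and m u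
  have SL: "S c m \<in> L2_Omega" for c m
    unfolding S_def[abs_def] by (intro L2_sum L2_scale Z) auto
  have Sw: "ip (S c m) (hoeff K H) = c (card K) * (if 1 \<le> card K then ip (Z (card K)) (hoeff K H) else 0)"
    if "finite K" "H \<in> L2_Omega" "card K \<le> m" for c m K H
  proof -
    have "ip (S c m) (hoeff K H) = (\<Sum>n=1..m. c n * ip (Z n) (hoeff K H))"
      unfolding S_def[abs_def] using that by (subst ip_sum_left) (auto intro!: L2_scale Z hoeff_L2 simp: ip_scale_left)
    also have "\<dots> = (\<Sum>n=1..m. if card K = n then c n * ip (Z n) (hoeff K H) else 0)"
      using that by (intro sum.cong refl) (auto simp: Z(3) maps_onto_empty)
    finally show ?thesis using that(3) by (simp add: sum.delta)
  qed
  have limit: "ip W (hoeff K H) = c (card K) * (if 1 \<le> card K then ip (Z (card K)) (hoeff K H) else 0)"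
    if W: "W \<in> L2_Omega" and l: "L2_tendsto path_law (\<lambda>m u. \<Sum>n=1..m. c n * mult_int n (f n) u) W"
      and K: "finite K" and H: "H \<in> L2_Omega" for c W K H
  proof -
    have AE_S: "AE u in path_law. (\<Sum>n=1..m. c n * mult_int n (f n) u) = S c m u" for m
    proof -
      have "AE u in path_law. \<forall>n\<in>{1..m}. mult_int n (f n) u = Z n u"
        by (intro AE_finite_allI Z) auto
      then show ?thesis by eventually_elim (simp add: S_def)
    qed
    have "(\<integral>\<^sup>+u. ennreal (((\<Sum>n=1..m. c n * mult_int n (f n) u) - W u)\<^sup>2) \<partial>path_law) = (\<integral>\<^sup>+u. ennreal ((S c m u - W u)\<^sup>2) \<partial>path_law)" for m
      by (rule nn_integral_cong_AE) (use AE_S[of m] in \<open>auto elim!: eventually_mono\<close>)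
    then have "(\<lambda>m. sqdist (S c m) W) \<longlonglongrightarrow> 0"
      using L2_tendsto_iff[OF SL[of c] W] l unfolding L2_tendsto_def by simp
    from sqdist_tendsto_ip[OF SL W hoeff_L2[OF H] this]
    have "(\<lambda>m. ip (S c m) (hoeff K H)) \<longlonglongrightarrow> ip W (hoeff K H)" .
    \<comment> \<open>The pairing is constant once \<open>m\<close> has reached
      \<open>card K\<close>.\<close>
    moreover have "(\<lambda>m. ip (S c m) (hoeff K H)) \<longlonglongrightarrow> c (card K) * (if 1 \<le> card K then ip (Z (card K)) (hoeff K H) else 0)"
      by (intro tendsto_eventually) (auto simp: eventually_sequentially Sw[OF K H] intro!: exI[of _ "card K"])
    ultimately show ?thesis by (rule LIMSEQ_unique)
  qed
  show "ip ?Y (hoeff K H) = - (1 / real (card K)) * ip (hoeff K F) H" if K: "finite K" and H: "H \<in> L2_Omega"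
    using limit[OF F _ K H, of "\<lambda>_. 1"] limit[OF Y limY K H] limF by (simp add: ip_hoeff[OF F H])
qed

section \<open>The gradient in one coordinate\<close>

definition avg :: "nat \<Rightarrow> ((nat \<Rightarrow> real) \<Rightarrow> real) \<Rightarrow> (nat \<Rightarrow> real) \<Rightarrow> real" where
  "avg k G u = (\<integral>w. G (u(k := w)) \<partial>unif)"

definition cgrad :: "nat \<Rightarrow> ((nat \<Rightarrow> real) \<Rightarrow> real) \<Rightarrow> (nat \<Rightarrow> real) \<Rightarrow> real" where
  "cgrad k G u = G u - avg k G u"

lemma cgrad_eq: "cgrad k G = (\<lambda>u. G u - avg k G u)"
  by (simp add: fun_eq_iff cgrad_def)

lemma measurable_section:
  assumes "G \<in> borel_measurable path_law"
  shows "(\<lambda>w. G (u(k := w))) \<in> borel_measurable borel"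
proof -
  have "(\<lambda>w. u(k := w)) \<in> measurable borel path_law"
    by (rule measurable_path_law) (simp add: fun_upd_def)
  from measurable_compose[OF this assms] show ?thesis .
qed

lemma avg_upd [simp]: "avg k G (u(k := w)) = avg k G u"
  unfolding avg_def by simp

lemma avg_eq_cexp:
  assumes G: "G \<in> borel_measurable path_law"
  shows "avg k G = cexp (- {k}) G"
proof
  fix u
  have m: "(\<lambda>w. G (u(k := w))) \<in> borel_measurable unif"
    unfolding measurable_cong_sets[OF sets_unif refl] by (rule measurable_section[OF G])
  have d: "distr path_law unif (\<lambda>v. v k) = unif"
    unfolding path_law_def by (rule path.PiM_component) simp
  have "(\<integral>w. G (u(k := w)) \<partial>unif) = (\<integral>w. G (u(k := w)) \<partial>distr path_law unif (\<lambda>v. v k))"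
    unfolding d ..
  also have "\<dots> = (\<integral>v. G (u(k := v k)) \<partial>path_law)"
    using m by (intro integral_distr) auto
  also have "(\<lambda>v. u(k := v k)) = mix (- {k}) u" by (auto simp: mix_def fun_eq_iff)
  then have "(\<integral>v. G (u(k := v k)) \<partial>path_law) = (\<integral>v. G (mix (- {k}) u v) \<partial>path_law)"
    by (metis (no_types))
  finally show "avg k G u = cexp (- {k}) G u" by (simp add: avg_def cexp_def)
qed

lemma avg_L2: "G \<in> L2_Omega \<Longrightarrow> avg k G \<in> L2_Omega"
  by (simp add: avg_eq_cexp L2_measurable cexp_L2)

lemma cgrad_L2: "G \<in> L2_Omega \<Longrightarrow> cgrad k G \<in> L2_Omega"
  unfolding cgrad_eq by (intro L2_diff avg_L2)

lemma avg_measurable [measurable]: "G \<in> borel_measurable path_law \<Longrightarrow> avg k G \<in> borel_measurable path_law"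
  by (simp add: avg_eq_cexp)

lemma cgrad_measurable [measurable]: "G \<in> borel_measurable path_law \<Longrightarrow> cgrad k G \<in> borel_measurable path_law"
  unfolding cgrad_eq by (intro borel_measurable_diff avg_measurable)

lemma integral_avg:
  assumes "integrable path_law G"
  shows "integrable path_law (avg k G)" and "(\<integral>u. avg k G u \<partial>path_law) = (\<integral>u. G u \<partial>path_law)"
  using integrable_mix[OF assms, of "- {k}"] assms by (simp_all add: avg_eq_cexp borel_measurable_integrable)

text \<open>\<open>avg k\<close> is an orthogonal projection, hence so is \<open>cgrad k\<close>,
  whose range is orthogonal to everything that does not depend on coordinate
  \<open>k\<close>.\<close>

lemma ip_cgrad_right:
  assumes Y: "Y \<in> L2_Omega" and G: "G \<in> L2_Omega"
  shows "ip (cgrad k Y) (cgrad k G) = ip (cgrad k Y) G"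
proof -
  have "ip (cgrad k Y) (avg k G) = ip Y (avg k G) - ip (avg k Y) (avg k G)"
    unfolding cgrad_eq using Y G by (simp add: ip_diff_left avg_L2)
  also have "ip (avg k Y) (avg k G) = ip Y (avg k G)"
    using Y G ip_cexp_cexp[OF Y G, of "- {k}"] ip_cexp[OF Y G, of "- {k}"] by (simp add: avg_eq_cexp L2_measurable)
  finally have "ip (cgrad k Y) (avg k G) = 0" by simp
  moreover have "ip (cgrad k Y) (cgrad k G) = ip (cgrad k Y) G - ip (cgrad k Y) (avg k G)"
    using ip_diff_right[OF G avg_L2[OF G] cgrad_L2[OF Y]] by (simp only: cgrad_eq[of k G])
  ultimately show ?thesis by simp
qed

text \<open>Averaging over coordinate \<open>k\<close> kills the components on sets containing
  \<open>k\<close> and fixes the others; the complementary projection does the opposite.\<close>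

lemma ip_cgrad_hoeff:
  assumes G: "G \<in> L2_Omega" and H: "H \<in> L2_Omega" and K: "finite K"
  shows "ip (cgrad k G) (hoeff K H) = (if k \<in> K then ip (hoeff K G) H else 0)"
proof -
  have "ip (avg k G) (hoeff K H) = (if k \<in> K then 0 else ip (hoeff K G) H)"
    using ip_hoeff_cexp[OF H G K, of "- {k}"] G H
    by (auto simp: avg_eq_cexp L2_measurable ip_commute[of "cexp _ _"] ip_hoeff[of H G] ip_commute[of H])
  moreover have "ip (cgrad k G) (hoeff K H) = ip G (hoeff K H) - ip (avg k G) (hoeff K H)"
    unfolding cgrad_eq using G H by (simp add: ip_diff_left avg_L2 hoeff_L2)
  ultimately show ?thesis using G H by (simp add: ip_hoeff)
qed

text \<open>Each finite set \<open>K\<close> is counted once for every one of its \<open>card K\<close> elements.\<close>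

lemma has_sum_over_members:
  fixes q :: "nat set \<Rightarrow> real"
  assumes q: "(\<lambda>K. \<bar>q K\<bar>) summable_on {K. finite K}" "q {} = 0"
    and s: "\<And>k. ((\<lambda>K. if k \<in> K then q K / real (card K) else 0) has_sum s k) {K. finite K}"
  shows "(s has_sum infsum q {K. finite K}) UNIV"
proof -
  let ?S = "{K :: nat set. finite K}"
  have inner: "((\<lambda>k. r / real (card K)) has_sum r) K" if "K \<in> ?S" "K = {} \<Longrightarrow> r = 0" for K :: "nat set" and r
    using has_sum_finite[of K "\<lambda>k. r / real (card K)"] that by (cases "K = {}") auto
  have "(\<lambda>(K, k). \<bar>q K\<bar> / real (card K)) summable_on Sigma ?S (\<lambda>K. K)"
    by (rule summable_on_SigmaI[where g="\<lambda>K. \<bar>q K\<bar>"]) (use inner q in auto)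
  then have "(\<lambda>x. norm ((\<lambda>(K, k). q K / real (card K)) x)) summable_on Sigma ?S (\<lambda>K. K)"
    by (simp add: split_beta')
  then have sm: "(\<lambda>(K, k). q K / real (card K)) summable_on Sigma ?S (\<lambda>K. K)"
    by (rule abs_summable_summable)
  have q_sum: "q summable_on ?S" using q(1) abs_summable_summable[of q ?S] by simp
  have "((\<lambda>(K, k). q K / real (card K)) has_sum infsum q ?S) (Sigma ?S (\<lambda>K. K))"
    by (rule has_sum_SigmaI[OF _ has_sum_infsum[OF q_sum] sm]) (use inner q(2) in auto)
  moreover have "bij_betw (\<lambda>(k, K). (K, k)) (Sigma UNIV (\<lambda>k. {K \<in> ?S. k \<in> K})) (Sigma ?S (\<lambda>K. K))"
    by (rule bij_betwI[where g="\<lambda>(K, k). (k, K)"]) auto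
  ultimately have "((\<lambda>(k, K). q K / real (card K)) has_sum infsum q ?S) (Sigma UNIV (\<lambda>k. {K \<in> ?S. k \<in> K}))"
    using has_sum_reindex_bij_betw[of "\<lambda>(k, K). (K, k)" "Sigma UNIV (\<lambda>k. {K \<in> ?S. k \<in> K})" "Sigma ?S (\<lambda>K. K)"
        "\<lambda>(K, k). q K / real (card K)" "infsum q ?S"]
    by (simp add: split_beta')
  then show ?thesis
  proof (rule has_sum_SigmaD)
    fix k
    show "((\<lambda>K. (case (k, K) of (k, K) \<Rightarrow> q K / real (card K))) has_sum s k) {K \<in> ?S. k \<in> K}"
      using s[of k] by (subst has_sum_cong_neutral[where T="?S" and g="\<lambda>K. if k \<in> K then q K / real (card K) else 0"]) auto
  qed
qed

text \<open>In the sum over \<open>k\<close> the component on \<open>K\<close> appears once for each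
  element of \<open>K\<close>, which cancels the factor \<open>1 / card K\<close> of
  \<open>L_inv\<close>. Pairing \<open>L_inv F\<close> with itself leaves a further factor
  \<open>1 / card K\<close>, at most 1, so its gradient is square summable for every centred
  square-integrable \<open>F\<close>.\<close>

lemma L_inv_integration_by_parts:
  assumes F: "F \<in> L2_Omega" and mean: "(\<integral>u. F u \<partial>path_law) = 0" and G: "G \<in> L2_Omega"
  shows "((\<lambda>k. ip (cgrad k (L_inv F)) (cgrad k G)) has_sum - ip F G) UNIV"
    and "(\<lambda>k. ip (cgrad k (L_inv F)) (cgrad k (L_inv F))) summable_on UNIV"
proof -
  let ?Y = "L_inv F"
  note Y = L_inv(1)[OF F mean]
  have Yh: "ip (hoeff K ?Y) H = - (1 / real (card K)) * ip (hoeff K F) H" if "finite K" "H \<in> L2_Omega" for K H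
    using L_inv(2)[OF F mean that] ip_hoeff[OF Y that(2)] by simp
  have comp: "ip (hoeff K (cgrad k ?Y)) (cgrad k H) = (if k \<in> K then - (ip (hoeff K F) H / real (card K)) else 0)"
    if K: "finite K" and H: "H \<in> L2_Omega" for k K H
  proof -
    have "ip (hoeff K (cgrad k ?Y)) (cgrad k H) = ip (cgrad k ?Y) (hoeff K (cgrad k H))"
      by (rule ip_hoeff) (intro cgrad_L2 Y H)+
    also have "\<dots> = (if k \<in> K then ip (hoeff K ?Y) (cgrad k H) else 0)"
      by (rule ip_cgrad_hoeff) (intro cgrad_L2 Y H K)+
    also have "ip (hoeff K ?Y) (cgrad k H) = - (1 / real (card K)) * ip (cgrad k H) (hoeff K F)"
      using Yh[OF K cgrad_L2[OF H]] by (simp add: ip_commute)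
    also have "ip (cgrad k H) (hoeff K F) = (if k \<in> K then ip (hoeff K F) H else 0)"
      using ip_cgrad_hoeff[OF H F K] ip_hoeff[OF H F] by (simp add: ip_commute)
    finally show ?thesis by simp
  qed
  have empty: "ip (hoeff {} F) H = 0" for H
    using mean by (simp add: ip_def hoeff_empty)
  have "((\<lambda>k. ip (cgrad k ?Y) (cgrad k G)) has_sum infsum (\<lambda>K. - ip (hoeff K F) G) {K. finite K}) UNIV"
  proof (rule has_sum_over_members)
    show "(\<lambda>K. \<bar>- ip (hoeff K F) G\<bar>) summable_on {K. finite K}" using Parseval(1)[OF F G] by simp
    fix k show "((\<lambda>K. if k \<in> K then - ip (hoeff K F) G / real (card K) else 0) has_sum ip (cgrad k ?Y) (cgrad k G)) {K. finite K}"
      using Parseval(2)[OF cgrad_L2[OF Y] cgrad_L2[OF G], of k k]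
      by (rule has_sum_cong[THEN iffD1, rotated]) (simp add: comp G)
  qed (simp add: empty)
  also have "infsum (\<lambda>K. - ip (hoeff K F) G) {K. finite K} = - ip F G"
    using has_sum_cmult_right[OF Parseval(2)[OF F G], of "-1"] by (intro infsumI) simp
  finally show "((\<lambda>k. ip (cgrad k ?Y) (cgrad k G)) has_sum - ip F G) UNIV" .
  let ?q = "\<lambda>K. ip (hoeff K F) F / real (card K)"
  have a0: "0 \<le> ip (hoeff K F) F" if "finite K" for K by (rule ip_hoeff_nonneg[OF F that])
  have "((\<lambda>k. ip (cgrad k ?Y) (cgrad k ?Y)) has_sum infsum ?q {K. finite K}) UNIV"
  proof (rule has_sum_over_members)
    have "?q K \<le> ip (hoeff K F) F" if "finite K" for K
      using a0[OF that] empty[of F] that by (cases "K = {}") (auto simp: divide_le_eq card_gt_0_iff Suc_le_eq mult_le_cancel_left1)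
    then show "(\<lambda>K. \<bar>?q K\<bar>) summable_on {K. finite K}"
      using a0 by (intro summable_on_comparison_test[OF has_sum_imp_summable[OF Parseval(2)[OF F F]]]) auto
    fix k show "((\<lambda>K. if k \<in> K then ?q K / real (card K) else 0) has_sum ip (cgrad k ?Y) (cgrad k ?Y)) {K. finite K}"
      using Parseval(2)[OF cgrad_L2[OF Y] cgrad_L2[OF Y], of k k]
    proof (rule has_sum_cong[THEN iffD1, rotated])
      fix K assume "K \<in> {K :: nat set. finite K}"
      then have K: "finite K" by simp
      have "ip (hoeff K F) ?Y = - (1 / real (card K)) * ip (hoeff K F) F"
        using Yh[OF K F] ip_hoeff[OF F Y] by (simp add: ip_commute)
      then show "ip (hoeff K (cgrad k ?Y)) (cgrad k ?Y) = (if k \<in> K then ?q K / real (card K) else 0)"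
        by (simp add: comp[OF K Y])
    qed
  qed (simp add: empty)
  then show "(\<lambda>k. ip (cgrad k ?Y) (cgrad k ?Y)) summable_on UNIV" by (rule has_sum_imp_summable)
qed

section \<open>The gradient and integrals over the half line, cell by cell\<close>

lemma floor_half_cell:
  assumes "2 * real k \<le> t" "t < 2 * real k + 2"
  shows "\<lfloor>t / 2\<rfloor> = int k"
  using assms by (intro floor_unique) auto

lemma integral_unif:
  fixes g :: "real \<Rightarrow> real"
  assumes [measurable]: "g \<in> borel_measurable borel"
  shows "2 * (\<integral>w. g w \<partial>unif) = (\<integral>w. indicator {-1..1} w * g w \<partial>lborel)"
proof -
  have half: "(1 :: ennreal) / 2 = ennreal (1 / 2)" using divide_ennreal[of 1 2] by simp
  have "unif = density lborel (\<lambda>w. ennreal (indicator {-1..1} w / 2))"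
    unfolding uniform_measure_def
    by (intro arg_cong[where f="density lborel"]) (auto simp: fun_eq_iff indicator_def half)
  then have "(\<integral>w. g w \<partial>unif) = (\<integral>w. indicator {-1..1} w / 2 * g w \<partial>lborel)"
    by (simp add: integral_real_density)
  also have "\<dots> = (\<integral>w. 1 / 2 * (indicator {-1..1} w * g w) \<partial>lborel)" by simp
  also have "\<dots> = 1 / 2 * (\<integral>w. indicator {-1..1} w * g w \<partial>lborel)" by (rule integral_mult_right_zero)
  finally show ?thesis by simp
qed

lemma measurable_Psi [measurable]:
  "(\<lambda>(t, u). Psi t u) \<in> measurable (borel \<Otimes>\<^sub>M path_law) path_law"
  by (rule measurable_path_law) (unfold Psi_def fun_upd_def split_beta', measurable)

text \<open>The value \<open>w = 1\<close> is excluded because there the floor already points to the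
  next cell. Inside the integral over the closed cell that endpoint is a null set.\<close>

lemma nabla_eq_cgrad:
  assumes G: "G \<in> borel_measurable path_law" and w: "-1 \<le> w" "w < 1"
  shows "nabla G (2 * real k + 1 + w) u = cgrad k G (u(k := w))"
proof -
  let ?t = "2 * real k + 1 + w"
  have fl: "\<lfloor>?t / 2\<rfloor> = int k" using w by (intro floor_half_cell) auto
  have Psi_t: "Psi ?t u = u(k := w)" unfolding Psi_def fl by simp
  have c: "cell ?t = {2 * real k..2 * real k + 2}" unfolding cell_def fl by simp
  note m = measurable_section[OF G]
  have "(LBINT s:cell ?t. G (Psi s u)) = (\<integral>s. indicator {2 * real k..2 * real k + 2} s * G (Psi s u) \<partial>lborel)"
    unfolding c set_lebesgue_integral_def by simp
  also have "\<dots> = (\<integral>w. indicator {2 * real k..2 * real k + 2} (2 * real k + 1 + 1 * w) * G (Psi (2 * real k + 1 + 1 * w) u) \<partial>lborel)"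
    by (subst lborel_integral_real_affine[where c=1 and t="2 * real k + 1"]) auto
  also have "\<dots> = (\<integral>w. indicator {-1..1} w * G (u(k := w)) \<partial>lborel)"
  proof (rule integral_cong_AE)
    show eq: "AE w in lborel. indicator {2 * real k..2 * real k + 2} (2 * real k + 1 + 1 * w) * G (Psi (2 * real k + 1 + 1 * w) u)
        = indicator {-1..1} w * G (u(k := w))"
      using AE_lborel_singleton[of 1]
    proof eventually_elim
      fix w :: real assume w1: "w \<noteq> 1"
      show "indicator {2 * real k..2 * real k + 2} (2 * real k + 1 + 1 * w) * G (Psi (2 * real k + 1 + 1 * w) u)
        = indicator {-1..1} w * G (u(k := w))"
      proof (cases "-1 \<le> w \<and> w < 1")
        case True
        then have "\<lfloor>(2 * real k + 1 + w) / 2\<rfloor> = int k" by (intro floor_half_cell) auto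
        then show ?thesis using True by (simp add: Psi_def indicator_def)
      next
        case False
        then show ?thesis using w1 by (auto simp: indicator_def)
      qed
    qed
    show "(\<lambda>w. indicator {-1..1} w * G (u(k := w))) \<in> borel_measurable lborel"
      using m by (intro borel_measurable_times) simp_all
    have "(\<lambda>w. (2 * real k + 1 + 1 * w, u)) \<in> measurable lborel (borel \<Otimes>\<^sub>M path_law)"
      by (intro measurable_Pair) simp_all
    from measurable_compose[OF measurable_compose[OF this measurable_Psi] G]
    have "(\<lambda>w. G (Psi (2 * real k + 1 + 1 * w) u)) \<in> borel_measurable lborel" by simp
    then show "(\<lambda>w. indicator {2 * real k..2 * real k + 2} (2 * real k + 1 + 1 * w) * G (Psi (2 * real k + 1 + 1 * w) u)) \<in> borel_measurable lborel"
      by measurable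
  qed
  also have "\<dots> = 2 * avg k G u"
    unfolding avg_def by (rule integral_unif[OF m, symmetric])
  finally show ?thesis unfolding nabla_def Psi_t cgrad_def by simp
qed

lemma measurable_nabla_pair:
  assumes [measurable]: "G \<in> borel_measurable path_law"
  shows "(\<lambda>(t, u). nabla G t u) \<in> borel_measurable (borel \<Otimes>\<^sub>M path_law)"
proof -
  have P: "(\<lambda>x. Psi (f x) (g x)) \<in> measurable N path_law"
    if "f \<in> borel_measurable N" "g \<in> measurable N path_law" for f g and N :: "'z measure"
    using measurable_compose[OF measurable_Pair[OF that] measurable_Psi] by simp
  have 1: "(\<lambda>x. G (Psi (fst x) (snd x))) \<in> borel_measurable (borel \<Otimes>\<^sub>M path_law)"
    by (rule measurable_compose[OF P assms]) measurable
  have 2: "(\<lambda>x. G (Psi (snd x) (snd (fst x)))) \<in> borel_measurable ((borel \<Otimes>\<^sub>M path_law) \<Otimes>\<^sub>M lborel)"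
    by (rule measurable_compose[OF P assms]) measurable
  have 3: "(\<lambda>x. (if 2 * of_int \<lfloor>(fst (fst x) :: real) / 2\<rfloor> \<le> snd x \<and> snd x \<le> 2 * of_int \<lfloor>(fst (fst x) :: real) / 2\<rfloor> + 2 then G (Psi (snd x) (snd (fst x))) else 0))
      \<in> borel_measurable ((borel \<Otimes>\<^sub>M path_law) \<Otimes>\<^sub>M (lborel :: real measure))"
    using 2 by measurable
  have "(\<lambda>y. \<integral>s. (if 2 * of_int \<lfloor>(fst y :: real) / 2\<rfloor> \<le> s \<and> s \<le> 2 * of_int \<lfloor>(fst y :: real) / 2\<rfloor> + 2 then G (Psi s (snd y)) else 0) \<partial>lborel)
      \<in> borel_measurable (borel \<Otimes>\<^sub>M path_law)"
    by (rule sigma_finite_measure.borel_measurable_lebesgue_integral[OF sigma_finite_lborel]) (use 3 in \<open>simp add: split_beta'\<close>)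
  moreover have "(LBINT s:cell t. G (Psi s u)) = (\<integral>s. (if 2 * of_int \<lfloor>t / 2\<rfloor> \<le> s \<and> s \<le> 2 * of_int \<lfloor>t / 2\<rfloor> + 2 then G (Psi s u) else 0) \<partial>lborel)" for t u
    unfolding set_lebesgue_integral_def cell_def by (intro Bochner_Integration.integral_cong refl) (simp add: indicator_def)
  ultimately have 4: "(\<lambda>y. (LBINT s:cell (fst y). G (Psi s (snd y)))) \<in> borel_measurable (borel \<Otimes>\<^sub>M path_law)" by simp
  show ?thesis unfolding nabla_def split_beta' using 1 4 by measurable
qed

lemma measurable_nabla [measurable (raw)]:
  assumes "G \<in> borel_measurable path_law" "f \<in> borel_measurable N" "g \<in> measurable N path_law"
  shows "(\<lambda>x. nabla G (f x) (g x)) \<in> borel_measurable N"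
  using measurable_compose[OF measurable_Pair[OF assms(2,3)] measurable_nabla_pair[OF assms(1)]] by simp

lemma nn_integral_halfline_cells:
  assumes [measurable]: "\<Phi> \<in> borel_measurable borel"
    and eq: "\<And>k w. \<bar>w\<bar> < 1 \<Longrightarrow> \<Phi> (2 * real k + 1 + w) = \<psi> k w"
  shows "(\<integral>\<^sup>+t\<in>{0..}. \<Phi> t \<partial>lborel) = (\<Sum>k. 2 * (\<integral>\<^sup>+w. \<psi> k w \<partial>unif))"
proof -
  have "(\<integral>\<^sup>+t\<in>{0..}. \<Phi> t \<partial>lborel) = (\<integral>\<^sup>+t. \<Phi> t \<partial>halfline)"
    unfolding halfline_def by (rule nn_integral_restrict_space[symmetric]) auto
  also have "\<dots> = (\<Sum>k. 2 * (\<integral>\<^sup>+w. \<Phi> (2 * real k + 1 + trim w) \<partial>unif))"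
    by (rule nn_integral_halfline) (simp add: halfline_def measurable_restrict_space1)
  also have "(\<lambda>k. \<integral>\<^sup>+w. \<Phi> (2 * real k + 1 + trim w) \<partial>unif) = (\<lambda>k. \<integral>\<^sup>+w. \<psi> k w \<partial>unif)"
    by (rule ext, rule nn_integral_cong_AE) (use AE_unif in \<open>eventually_elim, simp add: eq trim_eq\<close>)
  finally show ?thesis .
qed

text \<open>For signed integrands countable additivity over the cells requires integrability, which
  the formula for absolute values supplies.\<close>

lemma integral_halfline_cells:
  fixes g :: "real \<Rightarrow> real"
  assumes g [measurable]: "g \<in> borel_measurable borel"
    and eq: "\<And>k w. \<bar>w\<bar> < 1 \<Longrightarrow> g (2 * real k + 1 + w) = \<psi> k w"
    and \<psi> [measurable]: "\<And>k. \<psi> k \<in> borel_measurable borel"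
    and fin: "(\<Sum>k. 2 * (\<integral>\<^sup>+w. ennreal \<bar>\<psi> k w\<bar> \<partial>unif)) < \<infinity>"
  shows "(LBINT t:{0..}. g t) = (\<Sum>k. 2 * (\<integral>w. \<psi> k w \<partial>unif))"
proof -
  note U = Union_cells
  have "(\<integral>\<^sup>+t\<in>{0..}. ennreal \<bar>g t\<bar> \<partial>lborel) = (\<Sum>k. 2 * (\<integral>\<^sup>+w. ennreal \<bar>\<psi> k w\<bar> \<partial>unif))"
    by (rule nn_integral_halfline_cells) (auto simp: eq)
  then have "set_integrable lborel {0..} g"
    unfolding set_integrable_def using fin
    by (intro integrableI_bounded) (auto simp: ennreal_indicator[symmetric] ennreal_mult[symmetric] abs_mult mult.commute cong: nn_integral_cong)
  then have "(LBINT t:(\<Union>k. {2 * real k..<2 * real k + 2}). g t) = (\<Sum>k. (LBINT t:{2 * real k..<2 * real k + 2}. g t))"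
    using U by (intro lebesgue_integral_countable_add) (use disjoint_cells in \<open>auto simp: disjoint_family_on_def\<close>)
  also have "(\<lambda>k. (LBINT t:{2 * real k..<2 * real k + 2}. g t)) = (\<lambda>k. 2 * (\<integral>w. \<psi> k w \<partial>unif))"
  proof
    fix k
    have "(LBINT t:{2 * real k..<2 * real k + 2}. g t)
        = (\<integral>w. indicator {2 * real k..<2 * real k + 2} (2 * real k + 1 + 1 * w) * g (2 * real k + 1 + 1 * w) \<partial>lborel)"
      unfolding set_lebesgue_integral_def
      by (subst lborel_integral_real_affine[where c=1 and t="2 * real k + 1"]) auto
    also have "\<dots> = (\<integral>w. indicator {-1..1} w * \<psi> k w \<partial>lborel)"
    proof (rule integral_cong_AE)
      show "AE w in lborel. indicator {2 * real k..<2 * real k + 2} (2 * real k + 1 + 1 * w) * g (2 * real k + 1 + 1 * w)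
          = indicator {-1..1} w * \<psi> k w"
        using AE_lborel_singleton[of 1] AE_lborel_singleton[of "-1"]
        by eventually_elim (auto simp: indicator_def eq)
      have "(\<lambda>w. indicator {2 * real k..<2 * real k + 2} w * g w) \<in> borel_measurable borel" using g by simp
      from measurable_compose[OF _ this, of "\<lambda>w. 2 * real k + 1 + 1 * w" lborel]
      show "(\<lambda>w. indicator {2 * real k..<2 * real k + 2} (2 * real k + 1 + 1 * w) * g (2 * real k + 1 + 1 * w)) \<in> borel_measurable lborel"
        by simp
      show "(\<lambda>w. indicator {-1..1} w * \<psi> k w) \<in> borel_measurable lborel" using \<psi>[of k] by simp
    qed
    also have "\<dots> = 2 * (\<integral>w. \<psi> k w \<partial>unif)" by (rule integral_unif[symmetric]) simp
    finally show "(LBINT t:{2 * real k..<2 * real k + 2}. g t) = 2 * (\<integral>w. \<psi> k w \<partial>unif)" .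
  qed
  finally show ?thesis unfolding U .
qed

section \<open>Stein's method on the path space\<close>

lemma measurable_resample_pair:
  assumes "K \<in> measurable path_law N"
  shows "(\<lambda>x. K ((fst x)(k := snd x))) \<in> measurable (path_law \<Otimes>\<^sub>M unif) N"
proof -
  have "(\<lambda>x. (fst x)(k := snd x)) \<in> measurable (path_law \<Otimes>\<^sub>M unif) path_law" by measurable
  from measurable_compose[OF this assms] show ?thesis .
qed

lemma measurable_nn_section:
  assumes "(\<lambda>x. K (fst x) (snd x)) \<in> borel_measurable (path_law \<Otimes>\<^sub>M unif)"
  shows "(\<lambda>u. \<integral>\<^sup>+w. K u w \<partial>unif) \<in> borel_measurable path_law"
  using unif.borel_measurable_nn_integral[of "\<lambda>u w. K u w" path_law] assms by (simp add: split_beta')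

lemma unif_section:
  assumes "G \<in> borel_measurable path_law"
  shows "(\<lambda>w. G (u(k := w))) \<in> borel_measurable unif"
  unfolding measurable_cong_sets[OF sets_unif refl] by (rule measurable_section[OF assms])

lemma section_square_AE:
  assumes G: "G \<in> L2_Omega"
  shows "AE u in path_law. (\<integral>\<^sup>+w. ennreal ((G (u(k := w)))\<^sup>2) \<partial>unif) < \<infinity>"
proof -
  have m: "(\<lambda>u. ennreal ((G u)\<^sup>2)) \<in> borel_measurable path_law" using G by measurable
  have "(\<integral>\<^sup>+u. (\<integral>\<^sup>+w. ennreal ((G (u(k := w)))\<^sup>2) \<partial>unif) \<partial>path_law) = (\<integral>\<^sup>+u. ennreal ((G u)\<^sup>2) \<partial>path_law)"
    by (rule nn_integral_resample[OF m])
  then have "(\<integral>\<^sup>+u. (\<integral>\<^sup>+w. ennreal ((G (u(k := w)))\<^sup>2) \<partial>unif) \<partial>path_law) \<noteq> \<infinity>"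
    using nn_integral_square[OF G] by simp
  moreover have "(\<lambda>u. \<integral>\<^sup>+w. ennreal ((G (u(k := w)))\<^sup>2) \<partial>unif) \<in> borel_measurable path_law"
    by (rule measurable_nn_section) (use measurable_resample_pair[OF m] in simp)
  ultimately show ?thesis using nn_integral_PInf_AE by (simp add: less_top)
qed

lemma unif_square_integrable:
  assumes [measurable]: "g \<in> borel_measurable unif" and fin: "(\<integral>\<^sup>+w. ennreal ((g w)\<^sup>2) \<partial>unif) < \<infinity>"
  shows "integrable unif (\<lambda>w. (g w)\<^sup>2)" and "integrable unif g"
proof -
  show *: "integrable unif (\<lambda>w. (g w)\<^sup>2)" by (rule integrableI_bounded) (use fin in auto)
  show "integrable unif g" by (rule unif.square_integrable_imp_integrable[OF _ *]) simp
qed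

lemma unif_product_integrable:
  assumes [measurable]: "g \<in> borel_measurable unif" "g' \<in> borel_measurable unif"
    and fin: "(\<integral>\<^sup>+w. ennreal ((g w)\<^sup>2) \<partial>unif) < \<infinity>" "(\<integral>\<^sup>+w. ennreal ((g' w)\<^sup>2) \<partial>unif) < \<infinity>"
  shows "integrable unif (\<lambda>w. g w * g' w)"
proof (rule Bochner_Integration.integrable_bound)
  show "integrable unif (\<lambda>w. (g w)\<^sup>2 + (g' w)\<^sup>2)"
    by (intro Bochner_Integration.integrable_add unif_square_integrable assms)
  have "\<bar>x * y\<bar> \<le> x\<^sup>2 + y\<^sup>2" for x y :: real
  proof -
    have "0 \<le> (\<bar>x\<bar> - \<bar>y\<bar>)\<^sup>2" "0 \<le> \<bar>x\<bar> * \<bar>y\<bar>" by simp_all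
    then have "\<bar>x\<bar> * \<bar>y\<bar> \<le> x\<^sup>2 + y\<^sup>2" unfolding power2_diff power2_abs by linarith
    then show ?thesis by (simp only: abs_mult)
  qed
  then show "AE w in unif. norm (g w * g' w) \<le> norm ((g w)\<^sup>2 + (g' w)\<^sup>2)" by simp
qed measurable

text \<open>The mean over the coordinate vanishes only where the section is integrable, since
  otherwise the integrals take their default value; square-integrable sections occur for almost
  every path.\<close>

lemma cgrad_section_AE:
  assumes G: "G \<in> L2_Omega"
  shows "AE u in path_law. (\<integral>\<^sup>+w. ennreal ((cgrad k G (u(k := w)))\<^sup>2) \<partial>unif) < \<infinity> \<and>
    (\<integral>w. cgrad k G (u(k := w)) \<partial>unif) = 0"
  using section_square_AE[OF cgrad_L2[OF G], of k k] section_square_AE[OF G, of k]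
proof eventually_elim
  fix u assume 1: "(\<integral>\<^sup>+w. ennreal ((cgrad k G (u(k := w)))\<^sup>2) \<partial>unif) < \<infinity>"
    and 2: "(\<integral>\<^sup>+w. ennreal ((G (u(k := w)))\<^sup>2) \<partial>unif) < \<infinity>"
  have "integrable unif (\<lambda>w. G (u(k := w)))"
    by (rule unif_square_integrable(2)[OF unif_section 2]) (use G in measurable)
  then have "(\<integral>w. cgrad k G (u(k := w)) \<partial>unif) = (\<integral>w. G (u(k := w)) \<partial>unif) - avg k G u"
    unfolding cgrad_def avg_upd by (subst Bochner_Integration.integral_diff) (auto simp: unif.prob_space[simplified])
  then show "(\<integral>\<^sup>+w. ennreal ((cgrad k G (u(k := w)))\<^sup>2) \<partial>unif) < \<infinity> \<and> (\<integral>w. cgrad k G (u(k := w)) \<partial>unif) = 0"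
    using 1 by (simp add: avg_def)
qed

lemma measurable_indicator_cell:
  assumes [measurable]: "f \<in> borel_measurable N" "g \<in> borel_measurable N"
  shows "(\<lambda>x. indicator (cell (f x)) (g x) :: ennreal) \<in> borel_measurable N"
proof -
  have "(\<lambda>x. if 2 * of_int \<lfloor>f x / 2\<rfloor> \<le> g x \<and> g x \<le> 2 * of_int \<lfloor>f x / 2\<rfloor> + 2 then 1 else 0 :: ennreal) \<in> borel_measurable N"
    by measurable
  then show ?thesis by (simp add: cell_def indicator_def of_bool_def)
qed

lemma nn_integral_cell:
  assumes [measurable]: "\<Phi> \<in> borel_measurable borel" and eq: "\<And>w. \<bar>w\<bar> < 1 \<Longrightarrow> \<Phi> (2 * real k + 1 + w) = \<psi> w"
  shows "(\<integral>\<^sup>+s\<in>{2 * real k..2 * real k + 2}. \<Phi> s \<partial>lborel) = 2 * (\<integral>\<^sup>+w. \<psi> w \<partial>unif)"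
proof -
  have m: "(\<lambda>w. \<Phi> (2 * real k + 1 + w)) \<in> borel_measurable borel" by measurable
  have "(\<integral>\<^sup>+s\<in>{2 * real k..2 * real k + 2}. \<Phi> s \<partial>lborel)
      = (\<integral>\<^sup>+w. \<Phi> (2 * real k + 1 + 1 * w) * indicator {2 * real k..2 * real k + 2} (2 * real k + 1 + 1 * w) \<partial>lborel)"
    by (subst nn_integral_real_affine[where c=1 and t="2 * real k + 1"]) auto
  also have "\<dots> = (\<integral>\<^sup>+w. \<Phi> (2 * real k + 1 + w) * indicator {-1..1} w \<partial>lborel)"
    by (intro nn_integral_cong) (auto simp: indicator_def)
  also have "\<dots> = 2 * (\<integral>\<^sup>+w. \<Phi> (2 * real k + 1 + w) \<partial>unif)" by (rule nn_integral_unif[OF m, symmetric])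
  also have "(\<integral>\<^sup>+w. \<Phi> (2 * real k + 1 + w) \<partial>unif) = (\<integral>\<^sup>+w. \<psi> w \<partial>unif)"
    by (rule nn_integral_cong_AE) (use AE_unif in \<open>eventually_elim, simp add: eq\<close>)
  finally show ?thesis .
qed

lemma half_times_suminf_double:
  "1 / 2 * (\<Sum>k. 2 * X k) = (\<Sum>k. X k :: ennreal)"
proof -
  have "1 / 2 * (2 * s) = s" for s :: ennreal
    using ennreal_mult_divide_eq[of 2 s] by (simp add: ennreal_times_divide mult.commute)
  then show ?thesis by simp
qed

section \<open>Comparing the terms of Stein's equation with the bound\<close>

locale stein_setup =
  fixes F :: "(nat \<Rightarrow> real) \<Rightarrow> real" and h :: "real \<Rightarrow> real"
  assumes Dom: "F \<in> Dom_nabla" and mean: "(\<integral>u. F u \<partial>path_law) = 0" and lip: "1-lipschitz_on UNIV h"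
begin

definition Y :: "(nat \<Rightarrow> real) \<Rightarrow> real" where "Y = L_inv F"

abbreviation a :: "nat \<Rightarrow> (nat \<Rightarrow> real) \<Rightarrow> real \<Rightarrow> real" where "a k u w \<equiv> cgrad k Y (u(k := w))"
abbreviation b :: "nat \<Rightarrow> (nat \<Rightarrow> real) \<Rightarrow> real \<Rightarrow> real" where "b k u w \<equiv> cgrad k F (u(k := w))"
abbreviation f :: "real \<Rightarrow> real" where "f \<equiv> stein_fun h"
abbreviation f' :: "real \<Rightarrow> real" where "f' \<equiv> stein_deriv h"

lemma F: "F \<in> L2_Omega" using Dom by (simp add: Dom_nabla_def)

lemma Y: "Y \<in> L2_Omega" unfolding Y_def by (rule L_inv(1)[OF F mean])

lemma Fm [measurable]: "F \<in> borel_measurable path_law" by (rule L2_measurable[OF F])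
lemma Ym [measurable]: "Y \<in> borel_measurable path_law" by (rule L2_measurable[OF Y])

lemma fm [measurable]: "f \<in> borel_measurable borel"
proof (rule borel_measurable_continuous_onI)
  have "continuous_on UNIV h" using lip by (rule lipschitz_on_continuous_on)
  from stein_fun_has_derivative[OF this integrable_lipschitz_normal[OF lip]]
  show "continuous_on UNIV f" by (meson DERIV_isCont continuous_at_imp_continuous_on)
qed

lemma f'm [measurable]: "f' \<in> borel_measurable borel"
proof -
  have "h \<in> borel_measurable borel"
    using lip by (intro borel_measurable_continuous_onI lipschitz_on_continuous_on)
  then show ?thesis unfolding stein_deriv_def[abs_def] by measurable
qed

definition G :: "(nat \<Rightarrow> real) \<Rightarrow> real" where "G u = f (F u)"

lemma G: "G \<in> L2_Omega"
proof (rule L2_bounded)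
  show "G \<in> borel_measurable path_law" unfolding G_def[abs_def] by measurable
  show "\<bar>G u\<bar> \<le> 1" for u unfolding G_def by (rule stein_lipschitz(1)[OF lip])
qed

lemma Gm [measurable]: "G \<in> borel_measurable path_law" by (rule L2_measurable[OF G])

lemma am: "a k u \<in> borel_measurable unif" and bm: "b k u \<in> borel_measurable unif"
  by (rule unif_section, rule cgrad_measurable, rule Ym) (rule unif_section, rule cgrad_measurable, rule Fm)

lemma ab_pair_measurable [measurable]:
  "(\<lambda>x. a k (fst x) (snd x)) \<in> borel_measurable (path_law \<Otimes>\<^sub>M unif)"
  "(\<lambda>x. b k (fst x) (snd x)) \<in> borel_measurable (path_law \<Otimes>\<^sub>M unif)"
  by (rule measurable_resample_pair, rule cgrad_measurable, rule Ym) (rule measurable_resample_pair, rule cgrad_measurable, rule Fm)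

text \<open>Contributions of cell \<open>k\<close>: \<open>c k\<close> to minus one half of the
  inner product in the bound, \<open>g k\<close> to minus the covariance of \<open>F\<close> with
  \<open>f (F)\<close>, and \<open>\<tau> k\<close> to the Taylor error between \<open>g k\<close>
  and \<open>f' (F) * c k\<close>.\<close>

definition c :: "nat \<Rightarrow> (nat \<Rightarrow> real) \<Rightarrow> real" where "c k u = (\<integral>w. a k u w * b k u w \<partial>unif)"
definition g :: "nat \<Rightarrow> (nat \<Rightarrow> real) \<Rightarrow> real" where "g k u = (\<integral>w. a k u w * G (u(k := w)) \<partial>unif)"
definition \<tau> :: "nat \<Rightarrow> (nat \<Rightarrow> real) \<Rightarrow> ennreal" where
  "\<tau> k u = (\<integral>\<^sup>+w. ennreal (\<bar>a k u w\<bar> * (F (u(k := w)) - F u)\<^sup>2) \<partial>unif)"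
definition T :: "nat \<Rightarrow> ennreal" where "T k = (\<integral>\<^sup>+u. \<tau> k u \<partial>path_law)"

lemma c_eq_avg: "c k = avg k (\<lambda>u. cgrad k Y u * cgrad k F u)" and g_eq_avg: "g k = avg k (\<lambda>u. cgrad k Y u * G u)"
  by (simp_all add: fun_eq_iff c_def g_def avg_def)

lemma c_integrable: "integrable path_law (c k)"
  unfolding c_eq_avg by (intro integral_avg L2_integrable_mult cgrad_L2 Y F)

lemma g_integrable: "integrable path_law (g k)" and integral_g: "(\<integral>u. g k u \<partial>path_law) = ip (cgrad k Y) G"
  unfolding g_eq_avg ip_def by (intro integral_avg L2_integrable_mult cgrad_L2 Y G)+

text \<open>The product of the two gradients is dominated by the sum of their squared norms, which
  is summable over \<open>k\<close>. This justifies the exchanges of sum and integral below.\<close>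

lemma integral_abs_c: "(\<integral>u. \<bar>c k u\<bar> \<partial>path_law) \<le> ip (cgrad k Y) (cgrad k Y) + ip (cgrad k F) (cgrad k F)"
  and nn_integral_abs_ab: "(\<integral>\<^sup>+u. (\<integral>\<^sup>+w. ennreal \<bar>a k u w * b k u w\<bar> \<partial>unif) \<partial>path_law) \<le> ennreal (ip (cgrad k Y) (cgrad k Y) + ip (cgrad k F) (cgrad k F))"
proof -
  let ?P = "\<lambda>u. cgrad k Y u * cgrad k F u"
  note dY = cgrad_L2[OF Y, of k] and dF = cgrad_L2[OF F, of k]
  have "(\<lambda>u. \<bar>cgrad k Y u\<bar>) \<in> L2_Omega" "(\<lambda>u. \<bar>cgrad k F u\<bar>) \<in> L2_Omega"
    using dY dF by (auto simp: L2_Omega_def)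
  from ip_le_half[OF this] have "2 * (\<integral>u. \<bar>?P u\<bar> \<partial>path_law) \<le> ip (cgrad k Y) (cgrad k Y) + ip (cgrad k F) (cgrad k F)"
    by (simp add: ip_def abs_mult)
  moreover have "0 \<le> (\<integral>u. \<bar>?P u\<bar> \<partial>path_law)" by simp
  ultimately have "(\<integral>u. \<bar>?P u\<bar> \<partial>path_law) \<le> ip (cgrad k Y) (cgrad k Y) + ip (cgrad k F) (cgrad k F)" by linarith
  moreover have "(\<integral>\<^sup>+u. (\<integral>\<^sup>+w. ennreal \<bar>a k u w * b k u w\<bar> \<partial>unif) \<partial>path_law) = (\<integral>\<^sup>+u. ennreal \<bar>?P u\<bar> \<partial>path_law)"
    by (rule nn_integral_resample[of "\<lambda>u. ennreal \<bar>?P u\<bar>"]) measurable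
  moreover have "(\<integral>\<^sup>+u. ennreal \<bar>?P u\<bar> \<partial>path_law) = ennreal (\<integral>u. \<bar>?P u\<bar> \<partial>path_law)"
    by (rule nn_integral_eq_integral) (use L2_integrable_mult[OF dY dF] in auto)
  ultimately show nn: "(\<integral>\<^sup>+u. (\<integral>\<^sup>+w. ennreal \<bar>a k u w * b k u w\<bar> \<partial>unif) \<partial>path_law) \<le> ennreal (ip (cgrad k Y) (cgrad k Y) + ip (cgrad k F) (cgrad k F))"
    by (simp add: ennreal_leI)
  have "ennreal (\<integral>u. \<bar>c k u\<bar> \<partial>path_law) = (\<integral>\<^sup>+u. ennreal \<bar>c k u\<bar> \<partial>path_law)"
    by (rule nn_integral_eq_integral[symmetric]) (use c_integrable in auto)
  also have "\<dots> \<le> (\<integral>\<^sup>+u. (\<integral>\<^sup>+w. ennreal \<bar>a k u w * b k u w\<bar> \<partial>unif) \<partial>path_law)"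
  proof (rule nn_integral_mono)
    fix u show "ennreal \<bar>c k u\<bar> \<le> (\<integral>\<^sup>+w. ennreal \<bar>a k u w * b k u w\<bar> \<partial>unif)"
      unfolding c_def using integral_norm_bound_ennreal[of unif "\<lambda>w. a k u w * b k u w"]
      by (cases "integrable unif (\<lambda>w. a k u w * b k u w)") (auto simp: not_integrable_integral_eq)
  qed
  also note nn
  finally show "(\<integral>u. \<bar>c k u\<bar> \<partial>path_law) \<le> ip (cgrad k Y) (cgrad k Y) + ip (cgrad k F) (cgrad k F)"
    by (subst (asm) ennreal_le_iff) (auto simp: ip_self_nonneg)
qed

text \<open>
  Since the gradient of \<open>Y\<close> has mean zero over the cell, the expansion of \<open>f\<close> can be made
  around the value of \<open>F\<close> at the path itself.
\<close>

lemma taylor_AE: "AE u in path_law. ennreal \<bar>g k u - f' (F u) * c k u\<bar> \<le> \<tau> k u"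
  using cgrad_section_AE[OF Y, of k] cgrad_section_AE[OF F, of k]
proof eventually_elim
  fix u
  assume A: "(\<integral>\<^sup>+w. ennreal ((a k u w)\<^sup>2) \<partial>unif) < \<infinity> \<and> (\<integral>w. a k u w \<partial>unif) = 0"
    and B: "(\<integral>\<^sup>+w. ennreal ((b k u w)\<^sup>2) \<partial>unif) < \<infinity> \<and> (\<integral>w. b k u w \<partial>unif) = 0"
  let ?m = "avg k F u"
  let ?r = "\<lambda>w. f (F (u(k := w))) - f (F u) - f' (F u) * (F (u(k := w)) - F u)"
  have Fb: "F (u(k := w)) = b k u w + ?m" for w by (simp add: cgrad_def)
  have ia: "integrable unif (a k u)" by (rule unif_square_integrable(2)[OF am]) (use A in simp)
  have iab: "integrable unif (\<lambda>w. a k u w * b k u w)"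
    by (rule unif_product_integrable[OF am bm]) (use A B in simp_all)
  have iaG: "integrable unif (\<lambda>w. a k u w * f (F (u(k := w))))"
  proof (rule Bochner_Integration.integrable_bound[OF ia])
    show "(\<lambda>w. a k u w * f (F (u(k := w)))) \<in> borel_measurable unif"
      using am unif_section[OF Gm] unfolding G_def by (rule borel_measurable_times)
    show "AE w in unif. norm (a k u w * f (F (u(k := w)))) \<le> norm (a k u w)"
      using stein_lipschitz(1)[OF lip] by (simp add: abs_mult mult_left_le)
  qed
  have ar: "a k u w * ?r w = a k u w * f (F (u(k := w))) - (f (F u) + f' (F u) * (?m - F u)) * a k u w
      - f' (F u) * (a k u w * b k u w)" for w
    unfolding Fb by (simp add: algebra_simps)
  have "(\<integral>w. a k u w * ?r w \<partial>unif) = g k u - (f (F u) + f' (F u) * (?m - F u)) * (\<integral>w. a k u w \<partial>unif) - f' (F u) * c k u"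
    unfolding ar g_def c_def G_def using ia iab iaG by simp
  then have e: "(\<integral>w. a k u w * ?r w \<partial>unif) = g k u - f' (F u) * c k u" using A by simp
  have "integrable unif (\<lambda>w. a k u w * ?r w)" unfolding ar using ia iab iaG by simp
  then have "ennreal \<bar>g k u - f' (F u) * c k u\<bar> \<le> (\<integral>\<^sup>+w. ennreal (norm (a k u w * ?r w)) \<partial>unif)"
    using integral_norm_bound_ennreal[of unif "\<lambda>w. a k u w * ?r w"] unfolding e by simp
  also have "\<dots> \<le> \<tau> k u"
    unfolding \<tau>_def by (intro nn_integral_mono ennreal_leI) (auto simp: abs_mult intro!: mult_left_mono stein_taylor[OF lip])
  finally show "ennreal \<bar>g k u - f' (F u) * c k u\<bar> \<le> \<tau> k u" .
qed

lemma f'c_integrable: "integrable path_law (\<lambda>u. f' (F u) * c k u)"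
proof (rule Bochner_Integration.integrable_bound[OF c_integrable[of k]])
  show "(\<lambda>u. f' (F u) * c k u) \<in> borel_measurable path_law"
    using c_integrable[of k] by measurable
  show "AE u in path_law. norm (f' (F u) * c k u) \<le> norm (c k u)"
    using stein_deriv_bound[OF lip] by (simp add: abs_mult mult_left_le_one_le)
qed

lemma error_bound: "ennreal \<bar>ip (cgrad k Y) G - (\<integral>u. f' (F u) * c k u \<partial>path_law)\<bar> \<le> T k"
proof -
  have i: "integrable path_law (\<lambda>u. g k u - f' (F u) * c k u)"
    by (intro Bochner_Integration.integrable_diff g_integrable f'c_integrable)
  have "ip (cgrad k Y) G - (\<integral>u. f' (F u) * c k u \<partial>path_law) = (\<integral>u. g k u - f' (F u) * c k u \<partial>path_law)"
    by (simp add: integral_g g_integrable f'c_integrable)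
  then have "ennreal \<bar>ip (cgrad k Y) G - (\<integral>u. f' (F u) * c k u \<partial>path_law)\<bar> \<le> (\<integral>\<^sup>+u. ennreal \<bar>g k u - f' (F u) * c k u\<bar> \<partial>path_law)"
    using integral_norm_bound_ennreal[OF i] by simp
  also have "\<dots> \<le> T k" unfolding T_def by (rule nn_integral_mono_AE[OF taylor_AE])
  finally show ?thesis .
qed

definition B :: "nat \<Rightarrow> (nat \<Rightarrow> real) \<Rightarrow> ennreal" where "B k u = (\<integral>\<^sup>+w. ennreal ((b k u w)\<^sup>2) \<partial>unif)"

text \<open>
  Averaging the squared increment over both the old and the new value of the coordinate
  makes the cross term vanish, so no constants are lost.
\<close>

lemma T_eq: "T k = (\<integral>\<^sup>+u. (\<integral>\<^sup>+w. ennreal (\<bar>a k u w\<bar> * \<bar>b k u w\<bar>\<^sup>2) \<partial>unif) \<partial>path_law)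
    + (\<integral>\<^sup>+u. (\<integral>\<^sup>+w. ennreal \<bar>a k u w\<bar> * B k u \<partial>unif) \<partial>path_law)"
proof -
  interpret UU: pair_sigma_finite unif unif ..
  have \<tau>m: "\<tau> k \<in> borel_measurable path_law"
    unfolding \<tau>_def[abs_def]
  proof (rule measurable_nn_section)
    have "(\<lambda>x. F (fst x)) \<in> borel_measurable (path_law \<Otimes>\<^sub>M unif)" by measurable
    moreover have "(\<lambda>x. F ((fst x)(k := snd x))) \<in> borel_measurable (path_law \<Otimes>\<^sub>M unif)"
      by (rule measurable_resample_pair[OF Fm])
    ultimately show "(\<lambda>x. ennreal (\<bar>a k (fst x) (snd x)\<bar> * (F ((fst x)(k := snd x)) - F (fst x))\<^sup>2)) \<in> borel_measurable (path_law \<Otimes>\<^sub>M unif)"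
      using ab_pair_measurable(1)[of k] by simp
  qed
  \<comment> \<open>\<open>\<tau> k\<close> still depends on the old value of coordinate
    \<open>k\<close> through \<open>F u\<close>; resampling turns that value into a second uniform
    variable \<open>x\<close>.\<close>
  have "T k = (\<integral>\<^sup>+u. (\<integral>\<^sup>+x. \<tau> k (u(k := x)) \<partial>unif) \<partial>path_law)"
    unfolding T_def by (rule nn_integral_resample[OF \<tau>m, symmetric])
  also have "\<dots> = (\<integral>\<^sup>+u. (\<integral>\<^sup>+w. ennreal (\<bar>a k u w\<bar> * \<bar>b k u w\<bar>\<^sup>2) \<partial>unif) + (\<integral>\<^sup>+w. ennreal \<bar>a k u w\<bar> * B k u \<partial>unif) \<partial>path_law)"
  proof (rule nn_integral_cong_AE)
    show "AE u in path_law. (\<integral>\<^sup>+x. \<tau> k (u(k := x)) \<partial>unif)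
        = (\<integral>\<^sup>+w. ennreal (\<bar>a k u w\<bar> * \<bar>b k u w\<bar>\<^sup>2) \<partial>unif) + (\<integral>\<^sup>+w. ennreal \<bar>a k u w\<bar> * B k u \<partial>unif)"
      using cgrad_section_AE[OF F, of k]
    proof eventually_elim
      fix u assume Bu: "(\<integral>\<^sup>+w. ennreal ((b k u w)\<^sup>2) \<partial>unif) < \<infinity> \<and> (\<integral>w. b k u w \<partial>unif) = 0"
      note [measurable] = am[of k u] bm[of k u]
      have ib: "integrable unif (\<lambda>w. (b k u w)\<^sup>2)" "integrable unif (b k u)"
        using unif_square_integrable[OF bm] Bu by auto
      have Fb: "F (u(k := w)) - F (u(k := x)) = b k u w - b k u x" for w x by (simp add: cgrad_def)
      have inner: "(\<integral>\<^sup>+x. ennreal ((y - b k u x)\<^sup>2) \<partial>unif) = ennreal (y\<^sup>2) + B k u" for y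
      proof -
        have i: "integrable unif (\<lambda>x. y\<^sup>2 - 2 * y * b k u x + (b k u x)\<^sup>2)" using ib by simp
        have "(\<integral>\<^sup>+x. ennreal ((y - b k u x)\<^sup>2) \<partial>unif) = (\<integral>\<^sup>+x. ennreal (y\<^sup>2 - 2 * y * b k u x + (b k u x)\<^sup>2) \<partial>unif)"
          by (intro nn_integral_cong) (simp add: power2_diff algebra_simps)
        also have "\<dots> = ennreal (\<integral>x. y\<^sup>2 - 2 * y * b k u x + (b k u x)\<^sup>2 \<partial>unif)"
        proof (rule nn_integral_eq_integral[OF i])
          have "0 \<le> y\<^sup>2 - 2 * y * b k u x + (b k u x)\<^sup>2" for x
            using zero_le_power2[of "y - b k u x"] by (simp add: power2_diff)
          then show "AE x in unif. 0 \<le> y\<^sup>2 - 2 * y * b k u x + (b k u x)\<^sup>2" by simp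
        qed
        also have "(\<integral>x. y\<^sup>2 - 2 * y * b k u x + (b k u x)\<^sup>2 \<partial>unif) = y\<^sup>2 + (\<integral>x. (b k u x)\<^sup>2 \<partial>unif)"
          using ib Bu by (simp add: unif.prob_space[simplified])
        also have "ennreal (y\<^sup>2 + (\<integral>x. (b k u x)\<^sup>2 \<partial>unif)) = ennreal (y\<^sup>2) + B k u"
          unfolding B_def using ib(1) by (simp add: nn_integral_eq_integral)
        finally show ?thesis .
      qed
      have pm: "(\<lambda>(x, w). ennreal (\<bar>a k u w\<bar> * (b k u w - b k u x)\<^sup>2)) \<in> borel_measurable (unif \<Otimes>\<^sub>M unif)"
        by measurable
      have "(\<integral>\<^sup>+x. \<tau> k (u(k := x)) \<partial>unif) = (\<integral>\<^sup>+x. (\<integral>\<^sup>+w. ennreal (\<bar>a k u w\<bar> * (b k u w - b k u x)\<^sup>2) \<partial>unif) \<partial>unif)"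
        unfolding \<tau>_def by (simp add: Fb)
      also have "\<dots> = (\<integral>\<^sup>+w. (\<integral>\<^sup>+x. ennreal (\<bar>a k u w\<bar> * (b k u w - b k u x)\<^sup>2) \<partial>unif) \<partial>unif)"
        by (rule UU.Fubini'[OF pm, symmetric])
      also have "\<dots> = (\<integral>\<^sup>+w. ennreal \<bar>a k u w\<bar> * (\<integral>\<^sup>+x. ennreal ((b k u w - b k u x)\<^sup>2) \<partial>unif) \<partial>unif)"
        by (intro nn_integral_cong) (simp add: ennreal_mult nn_integral_cmult)
      also have "\<dots> = (\<integral>\<^sup>+w. ennreal (\<bar>a k u w\<bar> * \<bar>b k u w\<bar>\<^sup>2) + ennreal \<bar>a k u w\<bar> * B k u \<partial>unif)"
        unfolding inner by (simp add: distrib_left ennreal_mult)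
      also have "\<dots> = (\<integral>\<^sup>+w. ennreal (\<bar>a k u w\<bar> * \<bar>b k u w\<bar>\<^sup>2) \<partial>unif) + (\<integral>\<^sup>+w. ennreal \<bar>a k u w\<bar> * B k u \<partial>unif)"
        by (rule nn_integral_add) measurable
      finally show "(\<integral>\<^sup>+x. \<tau> k (u(k := x)) \<partial>unif)
        = (\<integral>\<^sup>+w. ennreal (\<bar>a k u w\<bar> * \<bar>b k u w\<bar>\<^sup>2) \<partial>unif) + (\<integral>\<^sup>+w. ennreal \<bar>a k u w\<bar> * B k u \<partial>unif)" .
    qed
  qed
  also have "\<dots> = (\<integral>\<^sup>+u. (\<integral>\<^sup>+w. ennreal (\<bar>a k u w\<bar> * \<bar>b k u w\<bar>\<^sup>2) \<partial>unif) \<partial>path_law)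
    + (\<integral>\<^sup>+u. (\<integral>\<^sup>+w. ennreal \<bar>a k u w\<bar> * B k u \<partial>unif) \<partial>path_law)"
  proof (rule nn_integral_add)
    show "(\<lambda>u. \<integral>\<^sup>+w. ennreal (\<bar>a k u w\<bar> * \<bar>b k u w\<bar>\<^sup>2) \<partial>unif) \<in> borel_measurable path_law"
      by (rule measurable_nn_section) (use ab_pair_measurable[of k] in simp)
    have "B k \<in> borel_measurable path_law"
      unfolding B_def[abs_def] by (rule measurable_nn_section) (use ab_pair_measurable(2)[of k] in simp)
    then have "(\<lambda>x. B k (fst x)) \<in> borel_measurable (path_law \<Otimes>\<^sub>M unif)" by (rule measurable_compose[OF measurable_fst])
    then show "(\<lambda>u. \<integral>\<^sup>+w. ennreal \<bar>a k u w\<bar> * B k u \<partial>unif) \<in> borel_measurable path_law"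
      by (intro measurable_nn_section) (use ab_pair_measurable(1)[of k] in simp)
  qed
  finally show ?thesis .
qed

lemma nabla_measurable: "(\<lambda>t. nabla Y t u) \<in> borel_measurable borel" "(\<lambda>t. nabla F t u) \<in> borel_measurable borel"
  by (rule measurable_nabla; simp)+

lemma nabla_cell:
  assumes "\<bar>w\<bar> < 1"
  shows "nabla Y (2 * real k + 1 + w) u = a k u w" "nabla F (2 * real k + 1 + w) u = b k u w"
  using nabla_eq_cgrad[OF Ym, of w k u] nabla_eq_cgrad[OF Fm, of w k u] assms by (simp_all add: abs_less_iff)

lemma second_term:
  "1 / 2 * (\<integral>\<^sup>+u. (\<integral>\<^sup>+t\<in>{0..}. ennreal (\<bar>nabla Y t u\<bar> * \<bar>nabla F t u\<bar>\<^sup>2) \<partial>lborel) \<partial>path_law)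
    = (\<Sum>k. \<integral>\<^sup>+u. (\<integral>\<^sup>+w. ennreal (\<bar>a k u w\<bar> * \<bar>b k u w\<bar>\<^sup>2) \<partial>unif) \<partial>path_law)"
proof -
  let ?X = "\<lambda>k u. \<integral>\<^sup>+w. ennreal (\<bar>a k u w\<bar> * \<bar>b k u w\<bar>\<^sup>2) \<partial>unif"
  have m: "?X k \<in> borel_measurable path_law" for k
    by (rule measurable_nn_section) (use ab_pair_measurable[of k] in simp)
  have "(\<integral>\<^sup>+t\<in>{0..}. ennreal (\<bar>nabla Y t u\<bar> * \<bar>nabla F t u\<bar>\<^sup>2) \<partial>lborel) = (\<Sum>k. 2 * ?X k u)" for u
    by (rule nn_integral_halfline_cells) (use nabla_measurable[of u] in \<open>simp_all add: nabla_cell\<close>)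
  then have "(\<integral>\<^sup>+u. (\<integral>\<^sup>+t\<in>{0..}. ennreal (\<bar>nabla Y t u\<bar> * \<bar>nabla F t u\<bar>\<^sup>2) \<partial>lborel) \<partial>path_law) = (\<integral>\<^sup>+u. (\<Sum>k. 2 * ?X k u) \<partial>path_law)"
    by simp
  also have "\<dots> = (\<Sum>k. \<integral>\<^sup>+u. 2 * ?X k u \<partial>path_law)" by (rule nn_integral_suminf) (use m in simp)
  also have "\<dots> = (\<Sum>k. 2 * (\<integral>\<^sup>+u. ?X k u \<partial>path_law))" using m by (simp add: nn_integral_cmult)
  finally show ?thesis by (simp only: half_times_suminf_double)
qed

text \<open>Both the outer and the inner integral run over the cell, each contributing a factor 2,
  which 1/4 cancels exactly.\<close>

lemma third_term:
  "1 / 4 * (\<integral>\<^sup>+u. (\<integral>\<^sup>+t\<in>{0..}. ennreal \<bar>nabla Y t u\<bar> * (\<integral>\<^sup>+s\<in>cell t. ennreal (\<bar>nabla F s u\<bar>\<^sup>2) \<partial>lborel) \<partial>lborel) \<partial>path_law)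
    = (\<Sum>k. \<integral>\<^sup>+u. (\<integral>\<^sup>+w. ennreal \<bar>a k u w\<bar> * B k u \<partial>unif) \<partial>path_law)"
proof -
  let ?X = "\<lambda>k u. \<integral>\<^sup>+w. ennreal \<bar>a k u w\<bar> * B k u \<partial>unif"
  have "B k \<in> borel_measurable path_law" for k
    unfolding B_def[abs_def] by (rule measurable_nn_section) (use ab_pair_measurable(2)[of k] in simp)
  then have "(\<lambda>x. B k (fst x)) \<in> borel_measurable (path_law \<Otimes>\<^sub>M unif)" for k by (rule measurable_compose[OF measurable_fst])
  then have m: "?X k \<in> borel_measurable path_law" for k
    by (intro measurable_nn_section) (use ab_pair_measurable(1)[of k] in simp)
  have "(\<integral>\<^sup>+t\<in>{0..}. ennreal \<bar>nabla Y t u\<bar> * (\<integral>\<^sup>+s\<in>cell t. ennreal (\<bar>nabla F s u\<bar>\<^sup>2) \<partial>lborel) \<partial>lborel) = (\<Sum>k. 2 * (2 * ?X k u))" for u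
  proof -
    note [measurable] = nabla_measurable[of u]
    have "(\<lambda>x. nabla F (snd x) u) \<in> borel_measurable (borel \<Otimes>\<^sub>M lborel)" by (rule measurable_nabla) simp_all
    then have "(\<lambda>(t, s). ennreal (\<bar>nabla F s u\<bar>\<^sup>2) * indicator (cell t) s) \<in> borel_measurable (borel \<Otimes>\<^sub>M lborel)"
      using measurable_indicator_cell[of fst "borel \<Otimes>\<^sub>M lborel" snd] by (simp add: split_beta')
    then have cm: "(\<lambda>t. \<integral>\<^sup>+s\<in>cell t. ennreal (\<bar>nabla F s u\<bar>\<^sup>2) \<partial>lborel) \<in> borel_measurable borel"
      by (rule lborel.borel_measurable_nn_integral)
    have "(\<integral>\<^sup>+t\<in>{0..}. ennreal \<bar>nabla Y t u\<bar> * (\<integral>\<^sup>+s\<in>cell t. ennreal (\<bar>nabla F s u\<bar>\<^sup>2) \<partial>lborel) \<partial>lborel)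
        = (\<Sum>k. 2 * (\<integral>\<^sup>+w. 2 * (ennreal \<bar>a k u w\<bar> * B k u) \<partial>unif))"
    proof (rule nn_integral_halfline_cells)
      show "(\<lambda>t. ennreal \<bar>nabla Y t u\<bar> * (\<integral>\<^sup>+s\<in>cell t. ennreal (\<bar>nabla F s u\<bar>\<^sup>2) \<partial>lborel)) \<in> borel_measurable borel"
        using cm by simp
      fix k and w :: real assume w: "\<bar>w\<bar> < 1"
      have "\<lfloor>(2 * real k + 1 + w) / 2\<rfloor> = int k" using w by (intro floor_half_cell) (auto simp: abs_less_iff)
      then have "cell (2 * real k + 1 + w) = {2 * real k..2 * real k + 2}" by (simp add: cell_def)
      moreover have "(\<integral>\<^sup>+s\<in>{2 * real k..2 * real k + 2}. ennreal (\<bar>nabla F s u\<bar>\<^sup>2) \<partial>lborel) = 2 * B k u"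
        unfolding B_def by (rule nn_integral_cell) (simp_all add: nabla_cell)
      ultimately show "ennreal \<bar>nabla Y (2 * real k + 1 + w) u\<bar> * (\<integral>\<^sup>+s\<in>cell (2 * real k + 1 + w). ennreal (\<bar>nabla F s u\<bar>\<^sup>2) \<partial>lborel)
          = 2 * (ennreal \<bar>a k u w\<bar> * B k u)"
        by (simp only: nabla_cell[OF w] mult.left_commute[of _ 2])
    qed
    also have "\<dots> = (\<Sum>k. 2 * (2 * ?X k u))"
      using am by (simp add: nn_integral_cmult)
    finally show ?thesis .
  qed
  then have "(\<integral>\<^sup>+u. (\<integral>\<^sup>+t\<in>{0..}. ennreal \<bar>nabla Y t u\<bar> * (\<integral>\<^sup>+s\<in>cell t. ennreal (\<bar>nabla F s u\<bar>\<^sup>2) \<partial>lborel) \<partial>lborel) \<partial>path_law)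
      = (\<integral>\<^sup>+u. (\<Sum>k. 2 * (2 * ?X k u)) \<partial>path_law)"
    by simp
  also have "\<dots> = (\<Sum>k. \<integral>\<^sup>+u. 2 * (2 * ?X k u) \<partial>path_law)" by (rule nn_integral_suminf) (use m in simp)
  also have "\<dots> = (\<Sum>k. 2 * (2 * (\<integral>\<^sup>+u. ?X k u \<partial>path_law)))" using m by (simp add: nn_integral_cmult)
  finally have e: "(\<integral>\<^sup>+u. (\<integral>\<^sup>+t\<in>{0..}. ennreal \<bar>nabla Y t u\<bar> * (\<integral>\<^sup>+s\<in>cell t. ennreal (\<bar>nabla F s u\<bar>\<^sup>2) \<partial>lborel) \<partial>lborel) \<partial>path_law)
      = (\<Sum>k. 2 * (2 * (\<integral>\<^sup>+u. ?X k u \<partial>path_law)))" .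
  have "(1 / 4 :: ennreal) = 1 / 2 * (1 / 2)"
    using divide_ennreal[of 1 2] divide_ennreal[of 1 4] ennreal_mult[of "1/2" "1/2"] by simp
  then show ?thesis unfolding e by (simp only: mult.assoc half_times_suminf_double)
qed

text \<open>The domain condition on \<open>F\<close> rewritten cell by cell.\<close>

lemma cgrad_F_summable: "summable (\<lambda>k. ip (cgrad k F) (cgrad k F))"
proof -
  let ?X = "\<lambda>k u. \<integral>\<^sup>+w. ennreal ((b k u w)\<^sup>2) \<partial>unif"
  have m: "?X k \<in> borel_measurable path_law" for k
    by (rule measurable_nn_section) (use ab_pair_measurable[of k] in simp)
  have X: "(\<integral>\<^sup>+u. ?X k u \<partial>path_law) = ennreal (ip (cgrad k F) (cgrad k F))" for k
    unfolding nn_integral_square[OF cgrad_L2[OF F], symmetric]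
    by (rule nn_integral_resample[of "\<lambda>u. ennreal ((cgrad k F u)\<^sup>2)"]) measurable
  have "(\<integral>\<^sup>+t\<in>{0..}. ennreal ((nabla F t u)\<^sup>2) \<partial>lborel) = (\<Sum>k. 2 * ?X k u)" for u
    by (rule nn_integral_halfline_cells) (use nabla_measurable[of u] in \<open>simp_all add: nabla_cell\<close>)
  then have "(\<integral>\<^sup>+u. (\<integral>\<^sup>+t\<in>{0..}. ennreal ((nabla F t u)\<^sup>2) \<partial>lborel) \<partial>path_law) = (\<integral>\<^sup>+u. (\<Sum>k. 2 * ?X k u) \<partial>path_law)"
    by simp
  also have "\<dots> = (\<Sum>k. \<integral>\<^sup>+u. 2 * ?X k u \<partial>path_law)" by (rule nn_integral_suminf) (use m in simp)
  also have "\<dots> = 2 * (\<Sum>k. ennreal (ip (cgrad k F) (cgrad k F)))" using m by (simp add: nn_integral_cmult X)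
  finally have "2 * (\<Sum>k. ennreal (ip (cgrad k F) (cgrad k F))) < \<infinity>" using Dom by (simp add: Dom_nabla_def)
  then have "(\<Sum>k. ennreal (ip (cgrad k F) (cgrad k F))) \<noteq> \<top>" by (auto simp: ennreal_mult_less_top)
  then show ?thesis by (intro summable_suminf_not_top) (auto simp: ip_self_nonneg)
qed

lemma cgrad_Y_summable: "summable (\<lambda>k. ip (cgrad k Y) (cgrad k Y))"
  using L_inv_integration_by_parts(2)[OF F mean F] unfolding Y_def[symmetric] by (rule summable_on_imp_summable)

lemma cgrad_summable: "summable (\<lambda>k. ip (cgrad k Y) (cgrad k Y) + ip (cgrad k F) (cgrad k F))"
  by (intro summable_add cgrad_F_summable cgrad_Y_summable)

text \<open>The minus sign before the gradient of \<open>Y\<close> and the factor 2 of each cell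
  turn the inner product into \<open>-2\<close> times the sum of the \<open>c k\<close>. Absolute
  convergence holds almost everywhere by the domination above.\<close>

lemma inner_AE: "AE u in path_law. summable (\<lambda>k. \<bar>c k u\<bar>) \<and>
    1 - 1 / 2 * inner_Rplus (\<lambda>t. nabla F t u) (\<lambda>t. - nabla Y t u) = 1 + (\<Sum>k. c k u)"
proof -
  let ?X = "\<lambda>k u. \<integral>\<^sup>+w. ennreal \<bar>a k u w * b k u w\<bar> \<partial>unif"
  have m: "?X k \<in> borel_measurable path_law" for k
    by (rule measurable_nn_section) (use ab_pair_measurable[of k] in simp)
  have "(\<integral>\<^sup>+u. (\<Sum>k. ?X k u) \<partial>path_law) = (\<Sum>k. \<integral>\<^sup>+u. ?X k u \<partial>path_law)"
    by (rule nn_integral_suminf) (use m in simp)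
  also have "\<dots> \<le> (\<Sum>k. ennreal (ip (cgrad k Y) (cgrad k Y) + ip (cgrad k F) (cgrad k F)))"
    by (intro suminf_le nn_integral_abs_ab) auto
  also have "\<dots> < \<infinity>"
    using cgrad_summable by (subst suminf_ennreal2) (auto simp: ip_self_nonneg)
  finally have "(\<integral>\<^sup>+u. (\<Sum>k. ?X k u) \<partial>path_law) \<noteq> \<infinity>" by simp
  then have "AE u in path_law. (\<Sum>k. ?X k u) \<noteq> \<infinity>" using m by (intro nn_integral_PInf_AE) auto
  then show ?thesis
  proof eventually_elim
    fix u assume fin: "(\<Sum>k. ?X k u) \<noteq> \<infinity>"
    have le: "ennreal \<bar>c k u\<bar> \<le> ?X k u" for k
      unfolding c_def using integral_norm_bound_ennreal[of unif "\<lambda>w. a k u w * b k u w"]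
      by (cases "integrable unif (\<lambda>w. a k u w * b k u w)") (auto simp: not_integrable_integral_eq)
    have "(\<Sum>k. ennreal \<bar>c k u\<bar>) \<le> (\<Sum>k. ?X k u)" by (intro suminf_le le) auto
    then have "(\<Sum>k. ennreal \<bar>c k u\<bar>) \<noteq> \<top>" using fin by (auto simp: top_unique)
    then have sm: "summable (\<lambda>k. \<bar>c k u\<bar>)" by (intro summable_suminf_not_top) auto
    then have sm': "summable (\<lambda>k. c k u)" by (rule summable_rabs_cancel)
    have "inner_Rplus (\<lambda>t. nabla F t u) (\<lambda>t. - nabla Y t u) = (\<Sum>k. 2 * (\<integral>w. - (a k u w * b k u w) \<partial>unif))"
      unfolding inner_Rplus_def
    proof (rule integral_halfline_cells)
      show "(\<lambda>t. nabla F t u * - nabla Y t u) \<in> borel_measurable borel" using nabla_measurable[of u] by simp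
      show "nabla F (2 * real k + 1 + w) u * - nabla Y (2 * real k + 1 + w) u = - (a k u w * b k u w)" if "\<bar>w\<bar> < 1" for k w
        using that by (simp add: nabla_cell)
      show "(\<lambda>w. - (a k u w * b k u w)) \<in> borel_measurable borel" for k
        using am[of k u] bm[of k u] unfolding measurable_cong_sets[OF sets_unif refl] by simp
      have "(\<Sum>k. 2 * (\<integral>\<^sup>+w. ennreal \<bar>- (a k u w * b k u w)\<bar> \<partial>unif)) = 2 * (\<Sum>k. ?X k u)" by simp
      also have "\<dots> < \<infinity>" using fin by (simp add: ennreal_mult_less_top less_top)
      finally show "(\<Sum>k. 2 * (\<integral>\<^sup>+w. ennreal \<bar>- (a k u w * b k u w)\<bar> \<partial>unif)) < \<infinity>" .
    qed
    also have "\<dots> = (\<Sum>k. (-2) * c k u)" by (simp add: c_def)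
    also have "\<dots> = (-2) * (\<Sum>k. c k u)" by (rule suminf_mult[OF sm'])
    finally show "summable (\<lambda>k. \<bar>c k u\<bar>) \<and>
      1 - 1 / 2 * inner_Rplus (\<lambda>t. nabla F t u) (\<lambda>t. - nabla Y t u) = 1 + (\<Sum>k. c k u)"
      using sm by simp
  qed
qed

text \<open>The expectation of \<open>F * f (F)\<close> is replaced by the sum over cells through
  integration by parts. There \<open>G\<close> enters as a square-integrable functional, which it is
  because f is bounded.\<close>

lemma stein_identity:
  "(\<integral>u. h (F u) \<partial>path_law) - (\<integral>z. h z * \<phi> z \<partial>lborel) = (\<integral>u. f' (F u) \<partial>path_law) + (\<Sum>k. ip (cgrad k Y) G)"
  and ip_summable: "summable (\<lambda>k. ip (cgrad k Y) G)"
proof -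
  let ?c = "\<integral>z. h z * \<phi> z \<partial>lborel"
  have i1: "integrable path_law (\<lambda>u. f' (F u))"
    by (rule P.integrable_const_bound[of _ 1]) (use stein_deriv_bound[OF lip] in auto)
  have i2: "integrable path_law (\<lambda>u. F u * G u)" by (rule L2_integrable_mult[OF F G])
  have "h (F u) = f' (F u) - F u * G u + ?c" for u
    unfolding stein_deriv_def G_def by simp
  then have "(\<integral>u. h (F u) \<partial>path_law) = (\<integral>u. f' (F u) \<partial>path_law) - ip F G + ?c"
    using i1 i2 by (simp add: ip_def)
  moreover have "(\<lambda>k. ip (cgrad k Y) G) sums (- ip F G)"
    using has_sum_imp_sums[OF L_inv_integration_by_parts(1)[OF F mean G]]
    unfolding Y_def[symmetric] by (simp add: ip_cgrad_right Y G)
  ultimately show "(\<integral>u. h (F u) \<partial>path_law) - ?c = (\<integral>u. f' (F u) \<partial>path_law) + (\<Sum>k. ip (cgrad k Y) G)"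
    and "summable (\<lambda>k. ip (cgrad k Y) G)"
    by (auto simp: sums_iff)
qed

text \<open>With \<open>ip (cgrad k Y) G\<close> replaced by the mean of
  \<open>f' (F) * c k\<close>, the identity becomes the mean of f'(F) times one plus the sum of the
  \<open>c k\<close>, bounded by the first term because f' is at most 1 in modulus. The replacement
  costs at most \<open>T k\<close> per cell, and these sum to the other two terms.\<close>

lemma stein_bound:
  "ennreal \<bar>(\<integral>u. h (F u) \<partial>path_law) - (\<integral>z. h z * \<phi> z \<partial>lborel)\<bar> \<le>
      (\<integral>\<^sup>+u. ennreal \<bar>1 - 1 / 2 * inner_Rplus (\<lambda>t. nabla F t u) (\<lambda>t. - nabla Y t u)\<bar> \<partial>path_law)
    + 1 / 2 * (\<integral>\<^sup>+u. (\<integral>\<^sup>+t\<in>{0..}. ennreal (\<bar>nabla Y t u\<bar> * \<bar>nabla F t u\<bar>\<^sup>2) \<partial>lborel) \<partial>path_law)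
    + 1 / 4 * (\<integral>\<^sup>+u. (\<integral>\<^sup>+t\<in>{0..}. ennreal \<bar>nabla Y t u\<bar> * (\<integral>\<^sup>+s\<in>cell t. ennreal (\<bar>nabla F s u\<bar>\<^sup>2) \<partial>lborel) \<partial>lborel) \<partial>path_law)"
    (is "_ \<le> ?A + ?R2 + ?R3")
proof (cases "(\<Sum>k. T k) = \<top>")
  \<comment> \<open>An infinite total error makes the right side infinite; only otherwise does the
    termwise comparison of the two series yield a summable difference.\<close>
  case True
  have "?R2 + ?R3 = (\<Sum>k. T k)" unfolding second_term third_term T_eq by (rule suminf_add) auto
  then have "?A + ?R2 + ?R3 = \<top>" unfolding add.assoc by (simp only: True ennreal_add_eq_top simp_thms)
  then show ?thesis by (simp only: top_greatest)
next
  case False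
  have R: "?R2 + ?R3 = (\<Sum>k. T k)" unfolding second_term third_term T_eq by (rule suminf_add) auto
  let ?p = "\<lambda>k. ip (cgrad k Y) G" and ?q = "\<lambda>k. \<integral>u. f' (F u) * c k u \<partial>path_law"
  let ?s = "\<lambda>u. 1 + (\<Sum>k. c k u)"
  have i1: "integrable path_law (\<lambda>u. f' (F u))"
    by (rule P.integrable_const_bound[of _ 1]) (use stein_deriv_bound[OF lip] in auto)
  have norm_le: "(\<integral>u. norm (f' (F u) * c k u) \<partial>path_law) \<le> ip (cgrad k Y) (cgrad k Y) + ip (cgrad k F) (cgrad k F)" for k
  proof -
    have "(\<integral>u. norm (f' (F u) * c k u) \<partial>path_law) \<le> (\<integral>u. \<bar>c k u\<bar> \<partial>path_law)"
    proof (rule integral_mono)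
      show "integrable path_law (\<lambda>u. norm (f' (F u) * c k u))" by (rule integrable_norm[OF f'c_integrable])
      show "integrable path_law (\<lambda>u. \<bar>c k u\<bar>)" by (rule integrable_abs[OF c_integrable])
      show "norm (f' (F u) * c k u) \<le> \<bar>c k u\<bar>" for u
        using stein_deriv_bound[OF lip] by (simp add: abs_mult mult_left_le_one_le)
    qed
    then show ?thesis using integral_abs_c[of k] by linarith
  qed
  have sn: "summable (\<lambda>k. \<integral>u. norm (f' (F u) * c k u) \<partial>path_law)"
    by (rule summable_comparison_test'[OF cgrad_summable, of 0]) (use norm_le in simp)
  have sc: "AE u in path_law. summable (\<lambda>k. norm (f' (F u) * c k u))"
    using inner_AE
  proof eventually_elim
    fix u assume "summable (\<lambda>k. \<bar>c k u\<bar>) \<and> 1 - 1 / 2 * inner_Rplus (\<lambda>t. nabla F t u) (\<lambda>t. - nabla Y t u) = 1 + (\<Sum>k. c k u)"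
    then have "summable (\<lambda>k. \<bar>f' (F u)\<bar> * \<bar>c k u\<bar>)" by (intro summable_mult) simp
    then show "summable (\<lambda>k. norm (f' (F u) * c k u))" by (simp add: abs_mult)
  qed
  \<comment> \<open>Sum and expectation may be exchanged because the L1 norms are dominated by the
    summable squared norms of the gradients.\<close>
  note swap = integral_suminf[OF f'c_integrable sc sn] integrable_suminf[OF f'c_integrable sc sn]
  have sq: "summable ?q"
    by (rule summable_norm_cancel, rule summable_comparison_test'[OF sn, of 0]) (simp add: integral_norm_bound[of path_law, simplified])
  have "(\<integral>u. f' (F u) \<partial>path_law) + (\<Sum>k. ?q k) = (\<integral>u. f' (F u) + (\<Sum>k. f' (F u) * c k u) \<partial>path_law)"
    using i1 swap(2) by (simp add: swap(1))
  moreover have "integrable path_law (\<lambda>u. f' (F u) + (\<Sum>k. f' (F u) * c k u))" using i1 swap(2) by simp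
  ultimately have "ennreal \<bar>(\<integral>u. f' (F u) \<partial>path_law) + (\<Sum>k. ?q k)\<bar> \<le> (\<integral>\<^sup>+u. ennreal \<bar>f' (F u) + (\<Sum>k. f' (F u) * c k u)\<bar> \<partial>path_law)"
    using integral_norm_bound_ennreal[of path_law "\<lambda>u. f' (F u) + (\<Sum>k. f' (F u) * c k u)"] by simp
  also have "\<dots> \<le> ?A"
  proof (rule nn_integral_mono_AE)
    show "AE u in path_law. ennreal \<bar>f' (F u) + (\<Sum>k. f' (F u) * c k u)\<bar>
        \<le> ennreal \<bar>1 - 1 / 2 * inner_Rplus (\<lambda>t. nabla F t u) (\<lambda>t. - nabla Y t u)\<bar>"
      using inner_AE
    proof eventually_elim
      fix u assume u: "summable (\<lambda>k. \<bar>c k u\<bar>) \<and> 1 - 1 / 2 * inner_Rplus (\<lambda>t. nabla F t u) (\<lambda>t. - nabla Y t u) = 1 + (\<Sum>k. c k u)"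
      note u2 = conjunct2[OF u]
      have "summable (\<lambda>k. c k u)" by (rule summable_rabs_cancel[OF conjunct1[OF u]])
      then have "f' (F u) + (\<Sum>k. f' (F u) * c k u) = f' (F u) * ?s u" by (simp add: suminf_mult distrib_left)
      then have "\<bar>f' (F u) + (\<Sum>k. f' (F u) * c k u)\<bar> \<le> \<bar>?s u\<bar>"
        using stein_deriv_bound[OF lip, of "F u"] by (simp add: abs_mult mult_left_le_one_le)
      then show "ennreal \<bar>f' (F u) + (\<Sum>k. f' (F u) * c k u)\<bar>
        \<le> ennreal \<bar>1 - 1 / 2 * inner_Rplus (\<lambda>t. nabla F t u) (\<lambda>t. - nabla Y t u)\<bar>"
        unfolding u2 by (rule ennreal_leI)
    qed
  qed
  finally have first: "ennreal \<bar>(\<integral>u. f' (F u) \<partial>path_law) + (\<Sum>k. ?q k)\<bar> \<le> ?A" .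
  have le: "(\<Sum>k. ennreal \<bar>?p k - ?q k\<bar>) \<le> (\<Sum>k. T k)" by (intro suminf_le error_bound) auto
  then have "(\<Sum>k. ennreal \<bar>?p k - ?q k\<bar>) \<noteq> \<top>" using False by (auto simp: top_unique)
  then have sd: "summable (\<lambda>k. \<bar>?p k - ?q k\<bar>)" by (intro summable_suminf_not_top) auto
  have second: "ennreal (\<Sum>k. \<bar>?p k - ?q k\<bar>) \<le> ?R2 + ?R3"
  proof -
    have "(\<Sum>k. ennreal \<bar>?p k - ?q k\<bar>) = ennreal (\<Sum>k. \<bar>?p k - ?q k\<bar>)"
      by (rule suminf_ennreal2[OF _ sd]) simp
    then show ?thesis unfolding R using le by (simp only:)
  qed
  have "\<bar>(\<Sum>k. ?p k) - (\<Sum>k. ?q k)\<bar> \<le> (\<Sum>k. \<bar>?p k - ?q k\<bar>)"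
    using summable_rabs[OF sd] suminf_diff[OF ip_summable sq] by simp
  then have "\<bar>(\<integral>u. h (F u) \<partial>path_law) - (\<integral>z. h z * \<phi> z \<partial>lborel)\<bar>
      \<le> \<bar>(\<integral>u. f' (F u) \<partial>path_law) + (\<Sum>k. ?q k)\<bar> + (\<Sum>k. \<bar>?p k - ?q k\<bar>)"
    unfolding stein_identity by linarith
  then have "ennreal \<bar>(\<integral>u. h (F u) \<partial>path_law) - (\<integral>z. h z * \<phi> z \<partial>lborel)\<bar>
      \<le> ennreal \<bar>(\<integral>u. f' (F u) \<partial>path_law) + (\<Sum>k. ?q k)\<bar> + ennreal (\<Sum>k. \<bar>?p k - ?q k\<bar>)"
    by (subst ennreal_plus[symmetric]) (simp_all only: abs_ge_zero ennreal_leI suminf_nonneg[OF sd])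
  also have "\<dots> \<le> ?A + (?R2 + ?R3)" by (intro add_mono first second)
  finally show ?thesis by (simp add: add.assoc)
qed

end

section \<open>Transfer to an arbitrary i.i.d. uniform sequence\<close>

lemma distr_iid_uniform:
  assumes "prob_space M" and indep: "prob_space.indep_vars M (\<lambda>_. borel) U (UNIV :: nat set)"
    and unif: "\<And>k. distr M borel (U k) = unif"
  shows "(\<lambda>\<omega> k. U k \<omega>) \<in> measurable M path_law" and "distr M path_law (\<lambda>\<omega> k. U k \<omega>) = path_law"
proof -
  interpret M: prob_space M by fact
  have rv: "U k \<in> borel_measurable M" for k
    using indep unfolding M.indep_vars_def by auto
  show m: "(\<lambda>\<omega> k. U k \<omega>) \<in> measurable M path_law" by (rule measurable_path_law) (rule rv)
  have "distr M path_law (\<lambda>\<omega> k. U k \<omega>) = distr M (\<Pi>\<^sub>M k\<in>UNIV. borel) (\<lambda>\<omega>. \<lambda>k\<in>UNIV. U k \<omega>)"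
    by (rule distr_cong) (auto simp: sets_path_law)
  also have "\<dots> = (\<Pi>\<^sub>M k\<in>UNIV. distr M borel (U k))"
    using indep rv by (subst (asm) M.indep_vars_iff_distr_eq_PiM) auto
  finally show "distr M path_law (\<lambda>\<omega> k. U k \<omega>) = path_law" by (simp add: unif path_law_def)
qed

theorem proposition3p3:
  fixes M :: "'a measure" and U :: "nat \<Rightarrow> 'a \<Rightarrow> real" and X :: "'a \<Rightarrow> real"
    and F :: "(nat \<Rightarrow> real) \<Rightarrow> real"
    and M' :: "'b measure" and N :: "'b \<Rightarrow> real"
  assumes "prob_space M"
    and "prob_space.indep_vars M (\<lambda>_. borel) U UNIV"
    and "\<And>k. distr M borel (U k) = uniform_measure lborel {-1..1}"
    and "prob_space M'"
    and "distributed M' lborel N std_normal_density"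
    and "\<And>\<omega>. \<omega> \<in> space M \<Longrightarrow> X \<omega> = F (\<lambda>k. U k \<omega>)"
    and "F \<in> Dom_nabla"
    and "(\<integral>\<omega>. X \<omega> \<partial>M) = 0"
  shows "d_W M X M' N \<le>
      (\<integral>\<^sup>+\<omega>. ennreal \<bar>1 - 1 / 2 * inner_Rplus (\<lambda>t. nabla F t (\<lambda>k. U k \<omega>))
                                     (\<lambda>t. - nabla (L_inv F) t (\<lambda>k. U k \<omega>))\<bar> \<partial>M)
    + 1 / 2 * (\<integral>\<^sup>+\<omega>. (\<integral>\<^sup>+t\<in>{0..}. ennreal (\<bar>nabla (L_inv F) t (\<lambda>k. U k \<omega>)\<bar>
                                     * \<bar>nabla F t (\<lambda>k. U k \<omega>)\<bar>\<^sup>2) \<partial>lborel) \<partial>M)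
    + 1 / 4 * (\<integral>\<^sup>+\<omega>. (\<integral>\<^sup>+t\<in>{0..}. ennreal \<bar>nabla (L_inv F) t (\<lambda>k. U k \<omega>)\<bar>
           * (\<integral>\<^sup>+s\<in>cell t. ennreal (\<bar>nabla F s (\<lambda>k. U k \<omega>)\<bar>\<^sup>2) \<partial>lborel) \<partial>lborel) \<partial>M)"
proof -
  note iid = distr_iid_uniform[OF assms(1-3)]
  let ?V = "\<lambda>\<omega> k. U k \<omega>"
  have F: "F \<in> L2_Omega" using assms(7) by (simp add: Dom_nabla_def)
  have Fm [measurable]: "F \<in> borel_measurable path_law" by (rule L2_measurable[OF F])
  have transfer: "(\<integral>\<omega>. H (X \<omega>) \<partial>M) = (\<integral>u. H (F u) \<partial>path_law)" if [measurable]: "H \<in> borel_measurable borel" for H :: "real \<Rightarrow> real"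
  proof -
    have "(\<integral>\<omega>. H (X \<omega>) \<partial>M) = (\<integral>\<omega>. H (F (?V \<omega>)) \<partial>M)"
      by (intro Bochner_Integration.integral_cong) (simp_all add: assms(6))
    also have "\<dots> = (\<integral>u. H (F u) \<partial>distr M path_law ?V)"
      by (rule integral_distr[symmetric, OF iid(1)]) measurable
    finally show ?thesis unfolding iid(2) .
  qed
  \<comment> \<open>The centring of \<open>X\<close> becomes that of \<open>F\<close> on the path
    space, which is what makes the value of \<open>L_inv F\<close> determinate almost
    everywhere.\<close>
  have mean: "(\<integral>u. F u \<partial>path_law) = 0" using transfer[of "\<lambda>x. x"] assms(8) by simp
  have Ym [measurable]: "L_inv F \<in> borel_measurable path_law" by (rule L2_measurable[OF L_inv(1)[OF F mean]])
  \<comment> \<open>The change of variables for nonnegative integrals asks for measurable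
    integrands; this is why the three integrands of the bound are shown to be measurable in the
    path.\<close>
  have transfer_nn: "(\<integral>\<^sup>+\<omega>. K (?V \<omega>) \<partial>M) = (\<integral>\<^sup>+u. K u \<partial>path_law)" if "K \<in> borel_measurable path_law" for K
    using nn_integral_distr[OF iid(1), of K] that unfolding iid(2) by simp
  let ?A = "\<lambda>u. ennreal \<bar>1 - 1 / 2 * inner_Rplus (\<lambda>t. nabla F t u) (\<lambda>t. - nabla (L_inv F) t u)\<bar>"
  let ?R2 = "\<lambda>u. \<integral>\<^sup>+t\<in>{0..}. ennreal (\<bar>nabla (L_inv F) t u\<bar> * \<bar>nabla F t u\<bar>\<^sup>2) \<partial>lborel"
  let ?R3 = "\<lambda>u. \<integral>\<^sup>+t\<in>{0..}. ennreal \<bar>nabla (L_inv F) t u\<bar> * (\<integral>\<^sup>+s\<in>cell t. ennreal (\<bar>nabla F s u\<bar>\<^sup>2) \<partial>lborel) \<partial>lborel"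
  have nF: "(\<lambda>x. nabla F (snd x) (fst x)) \<in> borel_measurable (path_law \<Otimes>\<^sub>M lborel)"
    and nY: "(\<lambda>x. nabla (L_inv F) (snd x) (fst x)) \<in> borel_measurable (path_law \<Otimes>\<^sub>M lborel)"
    by (rule measurable_nabla; measurable)+
  have ind: "(\<lambda>x. indicator {0..} (snd x)) \<in> borel_measurable (path_law \<Otimes>\<^sub>M (lborel :: real measure))" by measurable
  have mA: "?A \<in> borel_measurable path_law"
  proof -
    have "(\<lambda>u. inner_Rplus (\<lambda>t. nabla F t u) (\<lambda>t. - nabla (L_inv F) t u)) \<in> borel_measurable path_law"
      unfolding inner_Rplus_def set_lebesgue_integral_def
      by (rule lborel.borel_measurable_lebesgue_integral) (use nF nY in \<open>simp add: split_beta'\<close>)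
    then show ?thesis by simp
  qed
  have m2: "?R2 \<in> borel_measurable path_law"
    by (rule lborel.borel_measurable_nn_integral) (use nF nY ind in \<open>simp add: split_beta'\<close>)
  have m3: "?R3 \<in> borel_measurable path_law"
  proof -
    have nFs: "(\<lambda>x. nabla F (snd x) (fst (fst x))) \<in> borel_measurable ((path_law \<Otimes>\<^sub>M lborel) \<Otimes>\<^sub>M lborel)"
      by (rule measurable_nabla) measurable
    moreover have "(\<lambda>x. indicator (cell (snd (fst x))) (snd x) :: ennreal) \<in> borel_measurable ((path_law \<Otimes>\<^sub>M lborel) \<Otimes>\<^sub>M lborel)"
      by (rule measurable_indicator_cell) simp_all
    ultimately have "(\<lambda>x. \<integral>\<^sup>+s\<in>cell (snd x). ennreal (\<bar>nabla F s (fst x)\<bar>\<^sup>2) \<partial>lborel) \<in> borel_measurable (path_law \<Otimes>\<^sub>M lborel)"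
      by (intro lborel.borel_measurable_nn_integral) (simp add: split_beta')
    then show ?thesis
      by (intro lborel.borel_measurable_nn_integral) (use nY ind in \<open>simp add: split_beta'\<close>)
  qed
  show ?thesis
    unfolding transfer_nn[OF mA] transfer_nn[OF m2] transfer_nn[OF m3] d_W_def
  proof (rule SUP_least)
    fix h :: "real \<Rightarrow> real" assume "h \<in> {h. 1-lipschitz_on UNIV h}"
    then have lip: "1-lipschitz_on UNIV h" by simp
    then have hm: "h \<in> borel_measurable borel"
      by (intro borel_measurable_continuous_onI lipschitz_on_continuous_on)
    have N: "(\<integral>\<omega>. h (N \<omega>) \<partial>M') = (\<integral>z. h z * \<phi> z \<partial>lborel)"
      using distributed_integral[OF assms(5), of h] hm by (simp add: mult.commute)
    interpret stein_setup F h using assms(7) mean lip by unfold_locales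
    show "ennreal \<bar>(\<integral>\<omega>. h (X \<omega>) \<partial>M) - (\<integral>\<omega>. h (N \<omega>) \<partial>M')\<bar>
        \<le> integral\<^sup>N path_law ?A + 1 / 2 * integral\<^sup>N path_law ?R2 + 1 / 4 * integral\<^sup>N path_law ?R3"
      unfolding transfer[OF hm] N by (rule stein_bound[unfolded Y_def])
  qed
qed

end
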